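(* Let $z, w, a, E$ be indeterminates and let $Q=Q(w,a)$ denote the regular isotopy version of the Kauffman polynomial in the variables $w,a$. There exists a unique regular isotopy invariant of classical unoriented links $K[Q]:\mathcal{L}^u\to \mathbb{Z}[z, w^{\pm 1}, a^{\pm 1}, E^{\pm 1}]$ satisfying the following two rules: (1) For every unoriented Conway quadruple $L_+, L_-, L_0, L_\infty$ whose specified crossing involves two different components of the link, $$K[Q](L_+) + K[Q](L_-) = z\,\big( K[Q](L_0) + K[Q](L_\infty)\big).$$ (2) For every union $\mathcal{K}^r=\sqcup_{i=1}^r K_i$ of $r$ unlinked knots in $\mathcal{L}^u$, $r\geq 1$, $$K[Q](\mathcal{K}^r) = E^{1-r}\, Q(\mathcal{K}^r).$$
   Context: $\mathcal{L}^u$ is the set of (non-empty) classical unoriented link diagrams in the plane. Regular isotopy is the equivalence relation on diagrams generated by planar isotopy and Reidemeister moves II and III; a regular isotopy invariant is a function on diagrams constant on regular isotopy classes. For a crossing, swinging the overcrossing arc counterclockwise sweeps two of the four local regions; joining these two regions is the $A$-smoothing, joining the other two is the $B$-smoothing. A crossing (drawn in the plane as an X) is of positive type if its $A$-smoothing is horizontal (one arc on top and one arc at the bottom) and of negative type if its $A$-smoothing is vertical. An unoriented Conway quadruple $L_+,L_-,L_0,L_\infty$ consists of four unoriented diagrams identical except near one specified crossing, which is of positive type in $L_+$, switched in $L_-$, and replaced in $L_0$ and $L_\infty$ by, respectively, the $A$-smoothing (horizontal) and the $B$-smoothing (vertical) of the crossing of $L_+$. A union of $r$ unlinked knots $\mathcal{K}^r=\sqcup_{i=1}^r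 K_i$ is an $r$-component link diagram representing a split link whose $r$ split components are (possibly non-trivial) knots $K_1,\dots,K_r$. $Q(w,a)\in\mathbb{Z}[w^{\pm1},a^{\pm1}]$, the (known) regular isotopy version of the Kauffman polynomial, is the regular isotopy invariant of unoriented links determined by: (Q1) $Q(L_+)+Q(L_-)=w\,(Q(L_0)+Q(L_\infty))$ for every unoriented Conway quadruple (any crossing); (Q2) $Q(\text{diagram with a positive curl})=a\,Q(\text{diagram without the curl})$ and $Q(\text{diagram with a negative curl})=a^{-1}Q(\text{diagram without the curl})$, where a curl is a Reidemeister I kink, and its sign is the sign of its crossing for either orientation of the strand; (Q3) $Q=1$ on the standard crossingless unknot diagram. It follows that $Q(U)=a^{wr(U)}$ for a diagram $U$ of the unknot, where $wr$ is the writhe, and $Q(\mathcal{K}^r)=\gamma^{r-1}\prod_{i=1}^r Q(K_i)$ with $\gamma=\frac{a+a^{-1}}{w}-1$. *)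

theory Defs
  imports "HOL-Library.Poly_Mapping" "HOL-Library.Product_Plus"
begin

section \<open>Unoriented link diagrams in the plane\<close>

text \<open>
  A diagram is recorded in general position with respect to the height function of the plane:
  it is the list, read from top to bottom, of its local maxima, local minima and crossings,
  no two of which have the same height, every crossing being drawn as an X. Each entry carries
  the number of strands passing to the left of it. This is the usual combinatorial presentation
  of plane diagrams (Turaev, Freyd--Yetter): every diagram is planar isotopic to one in
  general position, and two of these are planar isotopic iff they are related by
  \<open>planar_move\<close>s below.

  \<open>Cap\<close> is a local maximum, \<open>Cup\<close> a local minimum. In \<open>Cross True\<close> the overcrossing arc runs
  from top left to bottom right, in \<open>Cross False\<close> from top right to bottom left. Swinging the
  overcrossing arc of \<open>Cross True\<close> counterclockwise sweeps the left and the right region, so its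
  A-smoothing is horizontal: \<open>Cross True\<close> is the crossing of positive type.
\<close>

datatype elem = Cap | Cup | Cross bool

type_synonym slices = "(elem \<times> nat) list"

fun strands_in :: "elem \<Rightarrow> nat" where
  "strands_in Cap = 0"
| "strands_in Cup = 2"
| "strands_in (Cross s) = 2"

fun strands_out :: "elem \<Rightarrow> nat" where
  "strands_out Cap = 2"
| "strands_out Cup = 0"
| "strands_out (Cross s) = 2"

text \<open>The number of strands below a list of slices that starts with no strands.\<close>

definition width :: "slices \<Rightarrow> nat" where
  "width ws = fold (\<lambda>(e, i) n. n - strands_in e + strands_out e) ws 0"

definition closed_slices :: "slices \<Rightarrow> bool" where
  "closed_slices ws \<longleftrightarrow>
     (\<forall>k < length ws. snd (ws ! k) + strands_in (fst (ws ! k)) \<le> width (take k ws)) \<and>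
     width ws = 0"

typedef link_diagram = "{ws :: slices. ws \<noteq> [] \<and> closed_slices ws}"
  morphisms slices Abs_link_diagram
proof
  show "[(Cap, 0), (Cup, 0)] \<in> {ws :: slices. ws \<noteq> [] \<and> closed_slices ws}"
    by (auto simp: closed_slices_def width_def less_Suc_eq)
qed

definition unknot_diagram :: link_diagram where
  "unknot_diagram = Abs_link_diagram [(Cap, 0), (Cup, 0)]"


section \<open>Components\<close>

text \<open>
  The point \<open>(k, p)\<close> is the \<open>p\<close>-th strand from the left on the horizontal line just above
  slice \<open>k\<close>. \<open>joined ws\<close> relates points that are the ends of one arc within a slice; at a
  crossing the arcs go straight through.
\<close>

definition points :: "slices \<Rightarrow> (nat \<times> nat) set" where
  "points ws = {(k, p). k \<le> length ws \<and> p < width (take k ws)}"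

inductive joined :: "slices \<Rightarrow> nat \<times> nat \<Rightarrow> nat \<times> nat \<Rightarrow> bool" for ws where
  left: "k < length ws \<Longrightarrow> ws ! k = (e, i) \<Longrightarrow> p < i \<Longrightarrow> joined ws (k, p) (Suc k, p)"
| right: "k < length ws \<Longrightarrow> ws ! k = (e, i) \<Longrightarrow> i + strands_in e \<le> p \<Longrightarrow> p < width (take k ws) \<Longrightarrow>
    joined ws (k, p) (Suc k, p - strands_in e + strands_out e)"
| cap: "k < length ws \<Longrightarrow> ws ! k = (Cap, i) \<Longrightarrow> joined ws (Suc k, i) (Suc k, Suc i)"
| cup: "k < length ws \<Longrightarrow> ws ! k = (Cup, i) \<Longrightarrow> joined ws (k, i) (k, Suc i)"
| cross_down: "k < length ws \<Longrightarrow> ws ! k = (Cross s, i) \<Longrightarrow> joined ws (k, i) (Suc k, Suc i)"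
| cross_up: "k < length ws \<Longrightarrow> ws ! k = (Cross s, i) \<Longrightarrow> joined ws (k, Suc i) (Suc k, i)"

definition same_component :: "link_diagram \<Rightarrow> nat \<times> nat \<Rightarrow> nat \<times> nat \<Rightarrow> bool" where
  "same_component D = equivclp (joined (slices D))"

definition is_knot :: "link_diagram \<Rightarrow> bool" where
  "is_knot D \<longleftrightarrow> (\<forall>x \<in> points (slices D). \<forall>y \<in> points (slices D). same_component D x y)"


section \<open>Planar isotopy and Reidemeister moves\<close>

text \<open>
  \<open>interchange\<close> changes the relative height of two distant elements, \<open>zigzag\<close> cancels a maximum
  against a minimum, and \<open>turn\<close> rotates a crossing, letting a maximum or minimum of one of its
  two arcs pass through it.
\<close>

inductive planar_move :: "slices \<Rightarrow> slices \<Rightarrow> bool" where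
  interchange: "planar_move
    [(e, i), (f, i + strands_out e + k)] [(f, i + strands_in e + k), (e, i)]"
| zigzag_left: "planar_move [(Cap, i), (Cup, Suc i)] []"
| zigzag_right: "planar_move [(Cap, Suc i), (Cup, i)] []"
| turn_cap: "planar_move [(Cap, Suc i), (Cross s, i)] [(Cap, i), (Cross (\<not> s), Suc i)]"
| turn_cup: "planar_move [(Cross s, i), (Cup, Suc i)] [(Cross (\<not> s), Suc i), (Cup, i)]"

text \<open>
  \<open>curl s\<close> relates a strand with a kink, lying to its right or to its left, to the strand without
  it; \<open>s\<close> says whether the kink is positive. Both passages of the strand through the crossing of
  the kink run downwards (or both upwards), and then \<open>Cross False\<close> is the crossing of sign \<open>+1\<close>.
\<close>

inductive curl :: "bool \<Rightarrow> slices \<Rightarrow> slices \<Rightarrow> bool" for s where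
  curl_right: "curl s [(Cap, Suc i), (Cross (\<not> s), i), (Cup, Suc i)] []"
| curl_left: "curl s [(Cap, i), (Cross (\<not> s), Suc i), (Cup, i)] []"

inductive reidemeister2 :: "slices \<Rightarrow> slices \<Rightarrow> bool" where
  "reidemeister2 [(Cross s, i), (Cross (\<not> s), i)] []"

text \<open>
  The side condition excludes the two assignments of crossings in which the three strands are
  cyclically above one another.
\<close>

inductive reidemeister3 :: "slices \<Rightarrow> slices \<Rightarrow> bool" where
  "s = t \<or> t = u \<Longrightarrow> reidemeister3
     [(Cross s, i), (Cross t, Suc i), (Cross u, i)]
     [(Cross u, Suc i), (Cross t, i), (Cross s, Suc i)]"

definition replaces :: "(slices \<Rightarrow> slices \<Rightarrow> bool) \<Rightarrow> link_diagram \<Rightarrow> link_diagram \<Rightarrow> bool" where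
  "replaces R D D' \<longleftrightarrow> (\<exists>us vs l r. R l r \<and> slices D = us @ l @ vs \<and> slices D' = us @ r @ vs)"

definition regular_isotopic :: "link_diagram \<Rightarrow> link_diagram \<Rightarrow> bool" where
  "regular_isotopic = equivclp (replaces (sup planar_move (sup reidemeister2 reidemeister3)))"

definition isotopic :: "link_diagram \<Rightarrow> link_diagram \<Rightarrow> bool" where
  "isotopic = equivclp (replaces
     (sup planar_move (sup (curl True) (sup (curl False) (sup reidemeister2 reidemeister3)))))"

definition regular_isotopy_invariant :: "(link_diagram \<Rightarrow> 'a) \<Rightarrow> bool" where
  "regular_isotopy_invariant I \<longleftrightarrow> (\<forall>D D'. regular_isotopic D D' \<longrightarrow> I D = I D')"


section \<open>Conway quadruples and unions of unlinked knots\<close>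

text \<open>
  The specified crossing is slice number \<open>length us\<close>, between the strands \<open>i\<close> and \<open>Suc i\<close>.
  Its horizontal smoothing is a cup above a cap, its vertical smoothing two straight strands.
\<close>

definition conway_quadruple_at ::
  "slices \<Rightarrow> nat \<Rightarrow> link_diagram \<Rightarrow> link_diagram \<Rightarrow> link_diagram \<Rightarrow> link_diagram \<Rightarrow> bool" where
  "conway_quadruple_at us i Lp Lm L0 Linf \<longleftrightarrow> (\<exists>vs.
     slices Lp = us @ [(Cross True, i)] @ vs \<and>
     slices Lm = us @ [(Cross False, i)] @ vs \<and>
     slices L0 = us @ [(Cup, i), (Cap, i)] @ vs \<and>
     slices Linf = us @ vs)"

definition conway_quadruple ::
  "link_diagram \<Rightarrow> link_diagram \<Rightarrow> link_diagram \<Rightarrow> link_diagram \<Rightarrow> bool" where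
  "conway_quadruple Lp Lm L0 Linf \<longleftrightarrow> (\<exists>us i. conway_quadruple_at us i Lp Lm L0 Linf)"

definition mixed_conway_quadruple ::
  "link_diagram \<Rightarrow> link_diagram \<Rightarrow> link_diagram \<Rightarrow> link_diagram \<Rightarrow> bool" where
  "mixed_conway_quadruple Lp Lm L0 Linf \<longleftrightarrow> (\<exists>us i. conway_quadruple_at us i Lp Lm L0 Linf \<and>
     \<not> same_component Lp (length us, i) (length us, Suc i))"

text \<open>Stacking closed diagrams on top of each other gives their split union.\<close>

definition unlinked_knots :: "nat \<Rightarrow> link_diagram \<Rightarrow> bool" where
  "unlinked_knots r D \<longleftrightarrow> (\<exists>Ks S. length Ks = r \<and> (\<forall>K \<in> set Ks. is_knot K) \<and>
     slices S = concat (map slices Ks) \<and> isotopic D S)"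


section \<open>Laurent polynomial rings and the Kauffman polynomial\<close>

text \<open>
  Monoid rings: exponents \<open>(i, j)\<close> stand for \<open>w^i a^j\<close> and \<open>(h, i, j, k)\<close> for
  \<open>z^h w^i a^j E^k\<close>, with \<open>h\<close> a natural number and the others integers.
\<close>

type_synonym laurent_wa = "(int \<times> int) \<Rightarrow>\<^sub>0 int"
type_synonym laurent_zwaE = "(nat \<times> int \<times> int \<times> int) \<Rightarrow>\<^sub>0 int"

definition monom_wa :: "int \<Rightarrow> int \<Rightarrow> laurent_wa" where
  "monom_wa i j = Poly_Mapping.single (i, j) 1"

definition var_z :: laurent_zwaE where
  "var_z = Poly_Mapping.single (1, 0, 0, 0) 1"

definition E_power :: "int \<Rightarrow> laurent_zwaE" where
  "E_power k = Poly_Mapping.single (0, 0, 0, k) 1"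

definition embed_wa :: "laurent_wa \<Rightarrow> laurent_zwaE" where
  "embed_wa p = (\<Sum>(i, j) \<in> Poly_Mapping.keys p.
     Poly_Mapping.single (0, i, j, 0) (Poly_Mapping.lookup p (i, j)))"

definition kauffman_polynomial :: "(link_diagram \<Rightarrow> laurent_wa) \<Rightarrow> bool" where
  "kauffman_polynomial Q \<longleftrightarrow>
     regular_isotopy_invariant Q \<and>
     (\<forall>Lp Lm L0 Linf. conway_quadruple Lp Lm L0 Linf \<longrightarrow>
        Q Lp + Q Lm = monom_wa 1 0 * (Q L0 + Q Linf)) \<and>
     (\<forall>D D'. replaces (curl True) D D' \<longrightarrow> Q D = monom_wa 0 1 * Q D') \<and>
     (\<forall>D D'. replaces (curl False) D D' \<longrightarrow> Q D = monom_wa 0 (-1) * Q D') \<and>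
     Q unknot_diagram = 1"

end

theory Submission
  imports Defs Complex_Main
begin

text \<open>
  Existence. Specialise \<open>z, w, a\<close> to positive reals and \<open>E\<close> to \<open>w / (N z)\<close> with a positive integer \<open>N\<close>, and
  put \<open>\<gamma> = (a + 1/a) / w - 1\<close>. Up to the constant factor \<open>(z / w) N \<gamma>\<close> the invariant of a diagram with \<open>c\<close>
  components is then \<open>(z / w)^c\<close> times the sum, over all colourings of the components by \<open>N\<close> colours, of
  the product over the colours of the values \<open>\<gamma> Q\<close> of the sublinks of one colour, with the sign
  \<open>(-1)^l\<close>, where \<open>l\<close> counts the crossings at which a smaller colour passes over a larger one. Switching a
  mixed crossing changes the sign of the colourings that separate its strands, so only the others
  contribute to the skein relation, and these obey the one of \<open>Q\<close>.

  Uniqueness. Switching mixed crossings turns a diagram of a link with at least two components into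
  one with two layers, which is a split union of two smaller links. So a property that passes from
  the other three diagrams of a mixed quadruple to the fourth holds as soon as it holds for unions
  of unlinked knots. The same induction shows that the specialised values come from a polynomial,
  and the points of evaluation are dense enough to determine it.

  That \<open>\<gamma> Q\<close> is multiplicative under split union is a skein theoretic fact as well: pulling the
  lowest maximum of a diagram down over everything else simplifies the diagram, up to switching
  crossings.
\<close>

section \<open>Tangles\<close>

text \<open>Colourings are never maps on components here: a colour word sits on each horizontal line
  and is updated slice by slice, so that facts about components become inductions on slices.
  \<open>same_component\<close> enters only through colourings that separate two points, and the
  number of components only through the number of 2-colourings. The constants come from unlinked
  knots. Each of r knots takes any of N colours, no crossing is mixed, and \<gamma> Q is
  multiplicative, so the sum with its factor is (z N / w)^r \<gamma> Q. Dividing by (z N / w)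
  \<gamma>, the value of the unknot, leaves (z N / w)^(r-1) Q, whence E = w / (N z). As N counts
  colours, the formula makes sense only at such E, and the polynomial has to be recovered from its
  values. The delicate point is the skein relation: the colourings of either smoothing of a mixed
  crossing must be exactly those of the crossing that give both strands one colour. Read slice by
  slice, this asks which colour words can be completed downwards; the parity argument around
  \<open>par\<close> answers it without tracing arcs.\<close>

text \<open>
  \<open>ok n ws\<close>: the slices \<open>ws\<close> fit below \<open>n\<close> strands; then \<open>wd n ws\<close> strands leave them at the bottom.
\<close>

fun ok :: "nat \<Rightarrow> slices \<Rightarrow> bool" where
  "ok n [] \<longleftrightarrow> True"
| "ok n ((e, i) # ws) \<longleftrightarrow> i + strands_in e \<le> n \<and> ok (n - strands_in e + strands_out e) ws"

fun wd :: "nat \<Rightarrow> slices \<Rightarrow> nat" where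
  "wd n [] = n"
| "wd n ((e, i) # ws) = wd (n - strands_in e + strands_out e) ws"

lemma Suc_Suc_minus_2 [simp]: "2 \<le> m \<Longrightarrow> Suc (Suc (m - 2)) = m"
  by simp

lemma ok_append [simp]: "ok n (us @ vs) \<longleftrightarrow> ok n us \<and> ok (wd n us) vs"
  by (induction n us rule: ok.induct) auto

lemma wd_append [simp]: "wd n (us @ vs) = wd (wd n us) vs"
  by (induction n us rule: ok.induct) auto

lemma wd_fold: "wd n ws = fold (\<lambda>(e, i) n. n - strands_in e + strands_out e) ws n"
  by (induction n ws rule: wd.induct) auto

lemma width_eq_wd: "width ws = wd 0 ws"
  by (simp add: width_def wd_fold)

lemma ok_iff_nth: "ok n ws \<longleftrightarrow> (\<forall>k < length ws. snd (ws ! k) + strands_in (fst (ws ! k)) \<le> wd n (take k ws))"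
proof (induction n ws rule: ok.induct)
  case (2 n e i ws)
  show ?case
    by (simp add: 2 All_less_Suc2)
qed simp

definition closed_tangle :: "slices \<Rightarrow> bool" where
  "closed_tangle ws \<longleftrightarrow> ok 0 ws \<and> wd 0 ws = 0"

lemma closed_slices_iff: "closed_slices ws \<longleftrightarrow> closed_tangle ws"
  by (simp add: closed_slices_def closed_tangle_def ok_iff_nth width_eq_wd)

lemma closed_slices [simp]: "closed_tangle (slices D)" "slices D \<noteq> []"
  using slices[of D] by (auto simp: closed_slices_iff)

lemma slices_Abs [simp]: "closed_tangle ws \<Longrightarrow> ws \<noteq> [] \<Longrightarrow> slices (Abs_link_diagram ws) = ws"
  by (simp add: Abs_link_diagram_inverse closed_slices_iff)

lemma Abs_slices [simp]: "Abs_link_diagram (slices D) = D"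
  by (rule slices_inverse)

definition shift :: "nat \<Rightarrow> slices \<Rightarrow> slices" where
  "shift d ws = map (\<lambda>(e, i). (e, i + d)) ws"

lemma shift_simps [simp]:
  "shift d [] = []" "shift d ((e, i) # ws) = (e, i + d) # shift d ws"
  "shift d (us @ vs) = shift d us @ shift d vs" "shift 0 ws = ws"
  "shift d (shift d' ws) = shift (d + d') ws"
  by (auto simp: shift_def intro!: map_idI)

lemma ok_shift: "ok n ws \<Longrightarrow> ok (n + d) (shift d ws)"
  and wd_shift: "ok n ws \<Longrightarrow> wd (n + d) (shift d ws) = wd n ws + d"
  by (induction n ws rule: ok.induct) (auto simp: algebra_simps)

section \<open>Regular isotopy of tangles\<close>

abbreviation basic_move :: "slices \<Rightarrow> slices \<Rightarrow> bool" where
  "basic_move \<equiv> sup planar_move (sup reidemeister2 reidemeister3)"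

text \<open>Stated for tangles below \<open>m\<close> strands so that moves can be made locally and
  then put in context. Both sides of a basic move must fit: \<open>[]\<close> fits below any number
  of strands, a zigzag does not.\<close>

inductive ri :: "nat \<Rightarrow> slices \<Rightarrow> slices \<Rightarrow> bool" where
  basic: "basic_move l r \<Longrightarrow> ok m l \<Longrightarrow> ok m r \<Longrightarrow> ri m l r"
| reflexive [simp]: "ri m ws ws"
| symmetric: "ri m us vs \<Longrightarrow> ri m vs us"
| transitive [trans]: "ri m us vs \<Longrightarrow> ri m vs ws \<Longrightarrow> ri m us ws"
| prefix: "ri (wd m us) vs vs' \<Longrightarrow> ri m (us @ vs) (us @ vs')"
| suffix: "ri m us us' \<Longrightarrow> ri m (us @ vs) (us' @ vs)"

lemma basic_move_cases:
  assumes "basic_move l r"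
  obtains (interchange) e f i k where "l = [(e, i), (f, i + strands_out e + k)]"
      "r = [(f, i + strands_in e + k), (e, i)]"
  | (zigzag_left) i where "l = [(Cap, i), (Cup, Suc i)]" "r = []"
  | (zigzag_right) i where "l = [(Cap, Suc i), (Cup, i)]" "r = []"
  | (turn_cap) i s where "l = [(Cap, Suc i), (Cross s, i)]" "r = [(Cap, i), (Cross (\<not> s), Suc i)]"
  | (turn_cup) i s where "l = [(Cross s, i), (Cup, Suc i)]" "r = [(Cross (\<not> s), Suc i), (Cup, i)]"
  | (r2) i s where "l = [(Cross s, i), (Cross (\<not> s), i)]" "r = []"
  | (r3) i s t u where "s = t \<or> t = u" "l = [(Cross s, i), (Cross t, Suc i), (Cross u, i)]"
      "r = [(Cross u, Suc i), (Cross t, i), (Cross s, Suc i)]"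
  using assms
  by (auto elim!: planar_move.cases reidemeister2.cases reidemeister3.cases)

lemma basic_move_wd:
  assumes "basic_move l r" "ok m l" "ok m r"
  shows "wd m l = wd m r"
  using assms by (cases rule: basic_move_cases) auto

lemma basic_move_shift:
  assumes "basic_move l r"
  shows "basic_move (shift d l) (shift d r)"
  using assms
proof (cases rule: basic_move_cases)
  case (interchange e f i k)
  show ?thesis
    using planar_move.interchange[of e "i + d" f k] by (simp add: interchange algebra_simps)
qed (auto intro: planar_move.intros reidemeister2.intros reidemeister3.intros)

lemma ri_ok_wd:
  assumes "ri m us vs"
  shows "(ok m us \<longleftrightarrow> ok m vs) \<and> (ok m us \<longrightarrow> wd m us = wd m vs)"
  using assms
proof (induction rule: ri.induct)
  case (basic l r m)
  then show ?case using basic_move_wd by blast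
qed auto

lemma ri_right:
  assumes "ok k ws" "i + strands_in e + k \<le> m"
  shows "ri m ((e, i) # shift (i + strands_out e) ws) (shift (i + strands_in e) ws @ [(e, i)])"
  using assms
proof (induction k ws arbitrary: m rule: ok.induct)
  case (2 k f j ws)
  let ?o = "i + strands_out e" and ?n = "i + strands_in e"
  have "ri m [(e, i), (f, ?o + j)] [(f, ?n + j), (e, i)]"
    using 2 by (intro ri.basic) (auto intro: planar_move.interchange)
  from ri.suffix[OF this, of "shift ?o ws"]
  have "ri m ((e, i) # shift ?o ((f, j) # ws)) ([(f, ?n + j)] @ ((e, i) # shift ?o ws))"
    by (simp add: add.commute)
  also have "ri m \<dots> ([(f, ?n + j)] @ (shift ?n ws @ [(e, i)]))"
    by (rule ri.prefix, rule 2(1)) (use 2 in auto)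
  finally show ?case by (simp add: add.commute)
qed simp

text \<open>The slice lies to the right of \<open>ws\<close>, which turns the \<open>k\<close>
  strands on its left into \<open>wd k ws\<close>; the \<open>i - k\<close> strands in between are
  untouched, which gives the new position.\<close>

lemma ri_left:
  assumes "ok k ws" "k \<le> i" "i + strands_in e \<le> m"
  shows "ri m ((e, i) # ws) (ws @ [(e, wd k ws + (i - k))])"
  using assms
proof (induction k ws arbitrary: m i rule: ok.induct)
  case (2 k f j ws)
  define i' where "i' = i - strands_in f + strands_out f"
  have i: "i = j + strands_in f + (i - j - strands_in f)" "i' = j + strands_out f + (i - j - strands_in f)"
    using 2 by (auto simp: i'_def)
  have "ri m [(f, j), (e, i')] [(e, i), (f, j)]"
    using 2 by (subst i(1), subst i(2), intro ri.basic sup2I1 planar_move.interchange) auto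
  hence "ri m ([(e, i), (f, j)] @ ws) ([(f, j), (e, i')] @ ws)"
    by (intro ri.suffix) (rule ri.symmetric)
  also have "[(f, j), (e, i')] @ ws = [(f, j)] @ ((e, i') # ws)" by simp
  also have "ri m \<dots> ([(f, j)] @ (ws @ [(e, wd (k - strands_in f + strands_out f) ws
      + (i' - (k - strands_in f + strands_out f)))]))"
    by (rule ri.prefix, rule 2(1)) (use 2 in \<open>auto simp: i'_def\<close>)
  finally show ?case using 2 by (simp add: i'_def)
qed simp

text \<open>One strand running to the right across \<open>k\<close> neighbours, over all of them if
  \<open>s\<close> and under all of them otherwise. In \<open>lcr\<close> it runs to the left, over
  them if \<open>\<not> s\<close>.\<close>

definition rcr :: "bool \<Rightarrow> nat \<Rightarrow> nat \<Rightarrow> slices" where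
  "rcr s p k = map (\<lambda>j. (Cross s, p + j)) [0..<k]"

definition lcr :: "bool \<Rightarrow> nat \<Rightarrow> nat \<Rightarrow> slices" where
  "lcr s p k = rev (rcr s p k)"

lemma rcr_0 [simp]: "rcr s p 0 = []" "lcr s p 0 = []"
  by (simp_all add: rcr_def lcr_def)

lemma rcr_add: "rcr s p (a + b) = rcr s p a @ rcr s (p + a) b"
  by (rule nth_equalityI) (auto simp: rcr_def nth_append)

lemma lcr_add: "lcr s p (a + b) = lcr s (p + a) b @ lcr s p a"
  by (simp add: lcr_def rcr_add)

lemma rcr_1: "rcr s p (Suc 0) = [(Cross s, p)]" "lcr s p (Suc 0) = [(Cross s, p)]"
  by (simp_all add: rcr_def lcr_def)

lemma rcr_Suc: "rcr s p (Suc k) = (Cross s, p) # rcr s (Suc p) k"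
  and lcr_Suc: "lcr s p (Suc k) = lcr s (Suc p) k @ [(Cross s, p)]"
  using rcr_add[of s p 1 k] lcr_add[of s p 1 k] by (simp_all add: rcr_1)

lemma rcr_Suc': "rcr s p (Suc k) = rcr s p k @ [(Cross s, p + k)]"
  and lcr_Suc': "lcr s p (Suc k) = (Cross s, p + k) # lcr s p k"
  using rcr_add[of s p k 1] lcr_add[of s p k 1] by (simp_all add: rcr_1)

lemma shift_rcr [simp]: "shift d (rcr s p k) = rcr s (p + d) k"
  by (auto simp: rcr_def shift_def)

lemma shift_lcr [simp]: "shift d (lcr s p k) = lcr s (p + d) k"
  by (simp add: lcr_def flip: shift_rcr) (simp add: shift_def rev_map)

lemma ok_rcr [simp]: "ok m (rcr s p k) \<longleftrightarrow> k = 0 \<or> p + k < m"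
  and wd_rcr: "k = 0 \<or> p + k < m \<Longrightarrow> wd m (rcr s p k) = m"
  by (induction k arbitrary: p) (auto simp: rcr_Suc)

lemma ok_lcr [simp]: "ok m (lcr s p k) \<longleftrightarrow> k = 0 \<or> p + k < m"
  and wd_lcr: "k = 0 \<or> p + k < m \<Longrightarrow> wd m (lcr s p k) = m"
  by (induction k arbitrary: p) (auto simp: lcr_Suc')

lemma rcr_commute_left:
  assumes "p + a < i" "i + strands_in e \<le> m"
  shows "ri m ((e, i) # rcr s p a) (rcr s p a @ [(e, i)])"
    and "ri m ((e, i) # lcr s p a) (lcr s p a @ [(e, i)])"
  using ri_left[of "p + a + 1" "rcr s p a" i e m] ri_left[of "p + a + 1" "lcr s p a" i e m] assms
  by (simp_all add: wd_rcr wd_lcr)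

lemma rcr_commute_right:
  assumes "i + strands_in e + d + b < m"
  shows "ri m ((e, i) # rcr s (i + strands_out e + d) b) (rcr s (i + strands_in e + d) b @ [(e, i)])"
    and "ri m ((e, i) # lcr s (i + strands_out e + d) b) (lcr s (i + strands_in e + d) b @ [(e, i)])"
  using ri_right[of "d + b + 1" "rcr s d b" i e m] ri_right[of "d + b + 1" "lcr s d b" i e m] assms
  by (simp_all add: add_ac)

text \<open>The travelling strand is above both others or below both, so the side condition of
  Reidemeister III holds whatever \<open>u\<close> is.\<close>

lemma slide_cross2:
  assumes "i + 2 < m"
  shows "ri m [(Cross s, i), (Cross s, Suc i), (Cross u, i)] [(Cross u, Suc i), (Cross s, i), (Cross s, Suc i)]"
    and "ri m [(Cross s, Suc i), (Cross s, i), (Cross u, Suc i)] [(Cross u, i), (Cross s, Suc i), (Cross s, i)]"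
proof -
  show "ri m [(Cross s, i), (Cross s, Suc i), (Cross u, i)] [(Cross u, Suc i), (Cross s, i), (Cross s, Suc i)]"
    using assms by (intro ri.basic sup2I2 reidemeister3.intros) auto
  show "ri m [(Cross s, Suc i), (Cross s, i), (Cross u, Suc i)] [(Cross u, i), (Cross s, Suc i), (Cross s, i)]"
    using assms by (intro ri.symmetric[OF ri.basic] sup2I2 reidemeister3.intros) auto
qed

text \<open>Turning one of the two crossings around the minimum makes them cancel by Reidemeister
  II.\<close>

lemma slide_cup2:
  assumes "i + 2 < m"
  shows "ri m [(Cross s, i), (Cross s, Suc i), (Cup, i)] [(Cup, Suc i)]"
    and "ri m [(Cross s, Suc i), (Cross s, i), (Cup, Suc i)] [(Cup, i)]"
proof -
  have t: "ri m [(Cross (\<not> s), i), (Cup, Suc i)] [(Cross s, Suc i), (Cup, i)]"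
    "ri m [(Cross s, i), (Cup, Suc i)] [(Cross (\<not> s), Suc i), (Cup, i)]"
    using assms planar_move.turn_cup[of "\<not> s" i] planar_move.turn_cup[of s i]
    by (auto intro!: ri.basic)
  have c: "ri m [(Cross s, j), (Cross (\<not> s), j)] []" if "j + 1 < m" for j
    using that by (intro ri.basic sup2I2 sup2I1 reidemeister2.intros) auto
  have "ri m ([(Cross s, i)] @ [(Cross s, Suc i), (Cup, i)]) ([(Cross s, i)] @ [(Cross (\<not> s), i), (Cup, Suc i)])"
    by (rule ri.prefix, rule ri.symmetric) (use t assms in simp)
  also have "ri m \<dots> ([] @ [(Cup, Suc i)])"
    using ri.suffix[OF c[of i], of "[(Cup, Suc i)]"] assms by simp
  finally show "ri m [(Cross s, i), (Cross s, Suc i), (Cup, i)] [(Cup, Suc i)]" by simp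
  have "ri m ([(Cross s, Suc i)] @ [(Cross s, i), (Cup, Suc i)])
      ([(Cross s, Suc i)] @ [(Cross (\<not> s), Suc i), (Cup, i)])"
    by (rule ri.prefix) (use t assms in simp)
  also have "ri m \<dots> ([] @ [(Cup, i)])"
    using ri.suffix[OF c[of "Suc i"], of "[(Cup, i)]"] assms by simp
  finally show "ri m [(Cross s, Suc i), (Cross s, i), (Cup, Suc i)] [(Cup, i)]" by simp
qed

lemma slide_cap2:
  assumes "i < m"
  shows "ri m [(Cap, Suc i), (Cross s, i), (Cross s, Suc i)] [(Cap, i)]"
    and "ri m [(Cap, i), (Cross s, Suc i), (Cross s, i)] [(Cap, Suc i)]"
proof -
  have t: "ri m [(Cap, Suc i), (Cross s, i)] [(Cap, i), (Cross (\<not> s), Suc i)]"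
    "ri m [(Cap, Suc i), (Cross (\<not> s), i)] [(Cap, i), (Cross s, Suc i)]"
    using assms planar_move.turn_cap[of i s] planar_move.turn_cap[of i "\<not> s"]
    by (auto intro!: ri.basic)
  have c: "ri (m + 2) [(Cross (\<not> s), j), (Cross s, j)] []" if "j < m + 1" for j
    using that reidemeister2.intros[of "\<not> s"] by (intro ri.basic sup2I2 sup2I1) auto
  have "ri m ([(Cap, Suc i), (Cross s, i)] @ [(Cross s, Suc i)])
      ([(Cap, i), (Cross (\<not> s), Suc i)] @ [(Cross s, Suc i)])"
    by (rule ri.suffix) (rule t)
  also have "\<dots> = [(Cap, i)] @ [(Cross (\<not> s), Suc i), (Cross s, Suc i)]" by simp
  also have "ri m \<dots> ([(Cap, i)] @ [])"
    by (rule ri.prefix) (use c assms in simp)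
  finally show "ri m [(Cap, Suc i), (Cross s, i), (Cross s, Suc i)] [(Cap, i)]" by simp
  have "ri m ([(Cap, i), (Cross s, Suc i)] @ [(Cross s, i)])
      ([(Cap, Suc i), (Cross (\<not> s), i)] @ [(Cross s, i)])"
    by (rule ri.suffix, rule ri.symmetric) (rule t)
  also have "\<dots> = [(Cap, Suc i)] @ [(Cross (\<not> s), i), (Cross s, i)]" by simp
  also have "ri m \<dots> ([(Cap, Suc i)] @ [])"
    by (rule ri.prefix) (use c assms in simp)
  finally show "ri m [(Cap, i), (Cross s, Suc i), (Cross s, i)] [(Cap, Suc i)]" by simp
qed

lemma slide2:
  assumes "i + strands_in e < m"
  shows "ri m (rcr s i (strands_in e) @ [(e, i)]) ((e, Suc i) # rcr s i (strands_out e))"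
    and "ri m (lcr s i (strands_in e) @ [(e, Suc i)]) ((e, i) # lcr s i (strands_out e))"
proof -
  have *: "rcr s i (Suc (Suc 0)) = [(Cross s, i), (Cross s, Suc i)]"
    "lcr s i (Suc (Suc 0)) = [(Cross s, Suc i), (Cross s, i)]" for i
    by (simp_all add: rcr_def lcr_def)
  show "ri m (rcr s i (strands_in e) @ [(e, i)]) ((e, Suc i) # rcr s i (strands_out e))"
    "ri m (lcr s i (strands_in e) @ [(e, Suc i)]) ((e, i) # lcr s i (strands_out e))"
    using assms slide_cap2[of i m s] slide_cup2[of i m s] slide_cross2[of i m s]
    by (cases e; auto simp: numeral_2_eq_2 * intro: ri.symmetric)+
qed

text \<open>The run of crossings is cut into those left of \<open>e\<close>, those with the strands
  of \<open>e\<close>, and those right of it. The outer two commute with \<open>e\<close> by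
  distance, the middle one by \<open>slide2\<close>.\<close>

lemma rcr_slide:
  assumes "p + a + strands_in e + b < m"
  shows "ri m (rcr s p (a + strands_in e + b) @ [(e, p + a)])
    ((e, Suc (p + a)) # rcr s p (a + strands_out e + b))"
proof -
  let ?n = "strands_in e" and ?o = "strands_out e" and ?j = "p + a"
  have "rcr s p (a + ?n + b) @ [(e, ?j)] = (rcr s p a @ rcr s ?j ?n) @ (rcr s (?j + ?n) b @ [(e, ?j)])"
    using rcr_add[of s p "a + ?n" b] rcr_add[of s p a ?n] by (simp add: add_ac)
  also have "ri m \<dots> ((rcr s p a @ rcr s ?j ?n) @ ([(e, ?j)] @ rcr s (?j + ?o) b))"
    using rcr_commute_right(1)[of ?j e 0 b m s] assms
    by (intro ri.prefix) (auto simp: wd_rcr intro: ri.symmetric)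
  also have "\<dots> = rcr s p a @ (rcr s ?j ?n @ [(e, ?j)]) @ rcr s (?j + ?o) b" by simp
  also have "ri m \<dots> (rcr s p a @ ([(e, Suc ?j)] @ rcr s ?j ?o) @ rcr s (?j + ?o) b)"
    using slide2(1)[of ?j e m s] assms by (intro ri.prefix ri.suffix) (auto simp: wd_rcr)
  also have "\<dots> = (rcr s p a @ [(e, Suc ?j)]) @ rcr s ?j ?o @ rcr s (?j + ?o) b" by simp
  also have "ri m \<dots> (((e, Suc ?j) # rcr s p a) @ rcr s ?j ?o @ rcr s (?j + ?o) b)"
    using rcr_commute_left(1)[of p a "Suc ?j" e m s] assms by (intro ri.suffix) (auto intro: ri.symmetric)
  also have "\<dots> = (e, Suc ?j) # rcr s p (a + ?o + b)"
    using rcr_add[of s p "a + ?o" b] rcr_add[of s p a ?o] by (simp add: add_ac)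
  finally show ?thesis .
qed

lemma lcr_slide:
  assumes "p + a + strands_in e + b < m"
  shows "ri m (lcr s p (a + strands_in e + b) @ [(e, Suc (p + a))])
    ((e, p + a) # lcr s p (a + strands_out e + b))"
proof -
  let ?n = "strands_in e" and ?o = "strands_out e" and ?j = "p + a"
  have "lcr s p (a + ?n + b) @ [(e, Suc ?j)] =
      (lcr s (?j + ?n) b @ lcr s ?j ?n) @ (lcr s p a @ [(e, Suc ?j)])"
    using lcr_add[of s p "a + ?n" b] lcr_add[of s p a ?n] by (simp add: add_ac)
  also have "ri m \<dots> ((lcr s (?j + ?n) b @ lcr s ?j ?n) @ ([(e, Suc ?j)] @ lcr s p a))"
    using rcr_commute_left(2)[of p a "Suc ?j" e m s] assms
    by (intro ri.prefix) (auto simp: wd_lcr intro: ri.symmetric)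
  also have "\<dots> = lcr s (?j + ?n) b @ (lcr s ?j ?n @ [(e, Suc ?j)]) @ lcr s p a" by simp
  also have "ri m \<dots> (lcr s (?j + ?n) b @ ([(e, ?j)] @ lcr s ?j ?o) @ lcr s p a)"
    using slide2(2)[of ?j e m s] assms by (intro ri.prefix ri.suffix) (auto simp: wd_lcr)
  also have "\<dots> = (lcr s (?j + ?n) b @ [(e, ?j)]) @ lcr s ?j ?o @ lcr s p a" by simp
  also have "ri m \<dots> (((e, ?j) # lcr s (?j + ?o) b) @ lcr s ?j ?o @ lcr s p a)"
    using rcr_commute_right(2)[of ?j e 0 b m s] assms by (intro ri.suffix) (auto intro: ri.symmetric)
  also have "\<dots> = (e, ?j) # lcr s p (a + ?o + b)"
    using lcr_add[of s p "a + ?o" b] lcr_add[of s p a ?o] by (simp add: add_ac)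
  finally show ?thesis .
qed

section \<open>Functions on tangles\<close>

text \<open>With \<open>m\<close> strands entering and none leaving, this is what remains of a
  function on closed diagrams once the upper slices are fixed.\<close>

definition move_inv :: "nat \<Rightarrow> (slices \<Rightarrow> 'v) \<Rightarrow> bool" where
  "move_inv m X \<longleftrightarrow> (\<forall>us l r vs. basic_move l r \<longrightarrow> ok m (us @ l @ vs) \<longrightarrow>
     ok m (us @ r @ vs) \<longrightarrow> wd m (us @ l @ vs) = 0 \<longrightarrow> X (us @ l @ vs) = X (us @ r @ vs))"

lemma move_inv_ri:
  assumes "move_inv m X" "ri k l r" "wd m us = k" "ok m (us @ l @ vs)" "wd m (us @ l @ vs) = 0"
  shows "X (us @ l @ vs) = X (us @ r @ vs)"
  using assms(2-)
proof (induction arbitrary: us vs rule: ri.induct)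
  case (basic l r k)
  then show ?case
    using assms(1) basic_move_wd[of l r k] unfolding move_inv_def
    by (metis ok_append)
next
  case (symmetric k l r)
  then show ?case
    by (metis ok_append wd_append ri_ok_wd)
next
  case (transitive k l r s)
  then show ?case
    by (metis ok_append wd_append ri_ok_wd)
next
  case (prefix k ws l r)
  then show ?case by (metis append.assoc ok_append wd_append)
next
  case (suffix k l r ws)
  then show ?case by (metis append.assoc ok_append wd_append)
qed auto

definition framed_move :: "real \<Rightarrow> real \<Rightarrow> slices \<Rightarrow> slices \<Rightarrow> bool" where
  "framed_move a f l r \<longleftrightarrow>
     f = 1 \<and> basic_move l r \<or> f = a \<and> curl True l r \<or> f = inverse a \<and> curl False l r"

definition framed :: "real \<Rightarrow> nat \<Rightarrow> (slices \<Rightarrow> real) \<Rightarrow> bool" where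
  "framed a m X \<longleftrightarrow> (\<forall>us l r vs f. framed_move a f l r \<longrightarrow> ok m (us @ l @ vs) \<longrightarrow>
     ok m (us @ r @ vs) \<longrightarrow> wd m (us @ l @ vs) = 0 \<longrightarrow> X (us @ l @ vs) = f * X (us @ r @ vs))"

definition skein :: "real \<Rightarrow> nat \<Rightarrow> (slices \<Rightarrow> real) \<Rightarrow> bool" where
  "skein w m X \<longleftrightarrow> (\<forall>us i vs. ok m (us @ (Cross True, i) # vs) \<longrightarrow>
     wd m (us @ (Cross True, i) # vs) = 0 \<longrightarrow>
     X (us @ (Cross True, i) # vs) + X (us @ (Cross False, i) # vs) =
       w * (X (us @ (Cup, i) # (Cap, i) # vs) + X (us @ vs)))"

text \<open>The circle may be the whole diagram, so that reductions can end at
  \<open>[]\<close>.\<close>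

definition circle_factor :: "real \<Rightarrow> (slices \<Rightarrow> real) \<Rightarrow> bool" where
  "circle_factor c X \<longleftrightarrow> (\<forall>us i vs. closed_tangle (us @ (Cap, i) # (Cup, i) # vs) \<longrightarrow>
     X (us @ (Cap, i) # (Cup, i) # vs) = c * X (us @ vs))"

lemma framed_move_inv: "framed a m X \<Longrightarrow> move_inv m X"
  unfolding framed_def move_inv_def framed_move_def by (metis mult_1)

lemma framed_curl:
  assumes "framed a m X" "curl s l r" "ok m (us @ l @ vs)" "ok m (us @ r @ vs)" "wd m (us @ l @ vs) = 0"
  shows "X (us @ l @ vs) = (if s then a else inverse a) * X (us @ r @ vs)"
  using assms unfolding framed_def framed_move_def by (cases s) fastforce+

section \<open>Kinks at a maximum or a minimum\<close>

lemma ri_context: "ri k l r \<Longrightarrow> wd m us = k \<Longrightarrow> ri m (us @ l @ vs) (us @ r @ vs)"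
  by (auto intro: ri.prefix ri.suffix)

lemma ri_interchange:
  "i + strands_in e + k + strands_in f \<le> m \<Longrightarrow>
    ri m [(e, i), (f, i + strands_out e + k)] [(f, i + strands_in e + k), (e, i)]"
  by (intro ri.basic sup2I1 planar_move.interchange) auto

lemma ri_zigzag:
  "i < m \<Longrightarrow> ri m [(Cap, i), (Cup, Suc i)] []"
  "i < m \<Longrightarrow> ri m [(Cap, Suc i), (Cup, i)] []"
  by (auto intro!: ri.basic planar_move.intros)

lemma ri_turn:
  "i < m \<Longrightarrow> ri m [(Cap, Suc i), (Cross s, i)] [(Cap, i), (Cross (\<not> s), Suc i)]"
  "Suc (Suc i) < m \<Longrightarrow> ri m [(Cross s, i), (Cup, Suc i)] [(Cross (\<not> s), Suc i), (Cup, i)]"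
  by (auto intro!: ri.basic planar_move.intros)

text \<open>The kink is absorbed by the maximum above it, which turns its crossing by a quarter. One
  passage then runs up and the other down, so the same sign belongs to the other type of crossing:
  \<open>Cross s\<close> instead of \<open>Cross (\<not> s)\<close>.\<close>

lemma ri_kink_cap:
  assumes "i \<le> m"
  shows "ri m [(Cap, i), (Cap, Suc (Suc i)), (Cross (\<not> s), Suc i), (Cup, Suc (Suc i))]
    [(Cap, i), (Cross s, i)]"
proof -
  have "ri m [(Cap, i), (Cap, Suc (Suc i)), (Cross (\<not> s), Suc i), (Cup, Suc (Suc i))]
      [(Cap, i), (Cap, i), (Cross (\<not> s), Suc i), (Cup, Suc (Suc i))]"
    using ri_context[OF ri_interchange[of i Cap 0 Cap m], of m "[]"
      "[(Cross (\<not> s), Suc i), (Cup, Suc (Suc i))]"] assms by simp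
  also have "ri m \<dots> [(Cap, i), (Cap, Suc i), (Cross s, i), (Cup, Suc (Suc i))]"
    using ri_context[OF ri.symmetric[OF ri_turn(1)[of i "m + 2" s]],
      of m "[(Cap, i)]" "[(Cup, Suc (Suc i))]"] assms by simp
  also have "ri m \<dots> [(Cap, i), (Cap, Suc i), (Cup, Suc (Suc i)), (Cross s, i)]"
    using ri_context[OF ri_interchange[of i "Cross s" 0 Cup "m + 4"],
      of m "[(Cap, i), (Cap, Suc i)]" "[]"] assms by simp
  also have "ri m \<dots> [(Cap, i), (Cross s, i)]"
    using ri_context[OF ri_zigzag(1)[of "Suc i" "m + 2"], of m "[(Cap, i)]" "[(Cross s, i)]"]
      assms by simp
  finally show ?thesis .
qed

lemma ri_kink_cup:
  assumes "Suc i < m"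
  shows "ri m [(Cap, Suc (Suc i)), (Cross (\<not> s), Suc i), (Cup, Suc (Suc i)), (Cup, i)]
    [(Cross s, i), (Cup, i)]"
proof -
  have "ri m [(Cap, Suc (Suc i)), (Cross (\<not> s), Suc i), (Cup, Suc (Suc i)), (Cup, i)]
      [(Cap, Suc (Suc i)), (Cross (\<not> s), Suc i), (Cup, i), (Cup, i)]"
    using ri_context[OF ri.symmetric[OF ri_interchange[of i Cup 0 Cup "m + 2"]],
      of m "[(Cap, Suc (Suc i)), (Cross (\<not> s), Suc i)]" "[]"] assms by simp
  also have "ri m \<dots> [(Cap, Suc (Suc i)), (Cross s, i), (Cup, Suc i), (Cup, i)]"
    using ri_context[OF ri.symmetric[OF ri_turn(2)[of i "m + 2" s]],
      of m "[(Cap, Suc (Suc i))]" "[(Cup, i)]"] assms by simp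
  also have "ri m \<dots> [(Cross s, i), (Cap, Suc (Suc i)), (Cup, Suc i), (Cup, i)]"
    using ri_context[OF ri.symmetric[OF ri_interchange[of i "Cross s" 0 Cap m]],
      of m "[]" "[(Cup, Suc i), (Cup, i)]"] assms by simp
  also have "ri m \<dots> [(Cross s, i), (Cup, i)]"
    using ri_context[OF ri_zigzag(2)[of "Suc i" m], of m "[(Cross s, i)]" "[(Cup, i)]"] assms by simp
  finally show ?thesis .
qed

lemma framed_kink_cap:
  assumes "framed a m X" "ok m (us @ (Cap, i) # vs)" "wd m (us @ (Cap, i) # vs) = 0"
  shows "X (us @ (Cap, i) # (Cross s, i) # vs) = (if s then a else inverse a) * X (us @ (Cap, i) # vs)"
proof -
  let ?c = "[(Cap, Suc (Suc i)), (Cross (\<not> s), Suc i), (Cup, Suc (Suc i))]"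
  have "X (us @ ((Cap, i) # ?c) @ vs) = X (us @ [(Cap, i), (Cross s, i)] @ vs)"
    by (rule move_inv_ri[OF framed_move_inv[OF assms(1)] ri_kink_cap[of i "wd m us" s] HOL.refl])
      (use assms in auto)
  moreover have "X ((us @ [(Cap, i)]) @ ?c @ vs) =
      (if s then a else inverse a) * X ((us @ [(Cap, i)]) @ [] @ vs)"
    by (rule framed_curl[OF assms(1) curl.curl_right]) (use assms in auto)
  ultimately show ?thesis by simp
qed

lemma framed_kink_cup:
  assumes "framed a m X" "ok m (us @ (Cup, i) # vs)" "wd m (us @ (Cup, i) # vs) = 0"
  shows "X (us @ (Cross s, i) # (Cup, i) # vs) = (if s then a else inverse a) * X (us @ (Cup, i) # vs)"
proof -
  let ?c = "[(Cap, Suc (Suc i)), (Cross (\<not> s), Suc i), (Cup, Suc (Suc i))]"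
  have "X (us @ (?c @ [(Cup, i)]) @ vs) = X (us @ [(Cross s, i), (Cup, i)] @ vs)"
    by (rule move_inv_ri[OF framed_move_inv[OF assms(1)] _ HOL.refl])
      (use assms ri_kink_cup[of i "wd m us" s] in auto)
  moreover have "X (us @ ?c @ (Cup, i) # vs) =
      (if s then a else inverse a) * X (us @ [] @ (Cup, i) # vs)"
    by (rule framed_curl[OF assms(1) curl.curl_right]) (use assms in auto)
  ultimately show ?thesis by simp
qed

section \<open>Skein relations determine framed invariants\<close>

fun is_cross :: "elem \<Rightarrow> bool" where
  "is_cross (Cross s) \<longleftrightarrow> True"
| "is_cross _ \<longleftrightarrow> False"

definition crossings :: "slices \<Rightarrow> nat" where
  "crossings ws = length (filter (\<lambda>x. is_cross (fst x)) ws)"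

lemma crossings_simps [simp]:
  "crossings [] = 0" "crossings (us @ vs) = crossings us + crossings vs"
  "crossings ((Cap, i) # ws) = crossings ws" "crossings ((Cup, i) # ws) = crossings ws"
  "crossings ((Cross s, i) # ws) = Suc (crossings ws)"
  by (simp_all add: crossings_def)

lemma crossings_Cons: "crossings ((f, j) # ws) = (if is_cross f then 1 else 0) + crossings ws"
  by (simp add: crossings_def)

lemma length_rcr [simp]: "length (rcr s p k) = k" "length (lcr s p k) = k"
  by (simp_all add: rcr_def lcr_def)

lemma crossings_rcr [simp]: "crossings (rcr s p k) = k" "crossings (lcr s p k) = k"
  by (simp_all add: rcr_def lcr_def crossings_def flip: rev_filter)

text \<open>A maximum whose right leg passes over the \<open>k\<close> strands next to it.\<close>

definition hook :: "nat \<Rightarrow> nat \<Rightarrow> slices" where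
  "hook i k = (Cap, i) # rcr True (Suc i) k"

lemma hook_simps [simp]:
  "shift d (hook i k) = hook (i + d) k" "length (hook i k) = Suc k" "crossings (hook i k) = k"
  by (simp_all add: hook_def)

lemma ok_hook [simp]: "ok m (hook i k) \<longleftrightarrow> i + k \<le> m"
  and wd_hook: "i + k \<le> m \<Longrightarrow> wd m (hook i k) = Suc (Suc m)"
  by (auto simp: hook_def wd_rcr)

lemma ri_r2: "s \<noteq> t \<Longrightarrow> Suc i < m \<Longrightarrow> ri m [(Cross s, i), (Cross t, i)] []"
  using reidemeister2.intros[of s i] by (intro ri.basic) auto

text \<open>The arc lies above the strands that it crosses, so its maximum can be moved to the other
  end. This lets the left leg be treated like the right one.\<close>

lemma hook_left: "i + k \<le> m \<Longrightarrow> ri m (hook i k) ((Cap, i + k) # lcr False i k)"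
proof (induction k)
  case 0
  then show ?case by (simp add: hook_def)
next
  case (Suc k)
  have "hook i (Suc k) = hook i k @ [(Cross True, Suc (i + k))]"
    by (simp add: hook_def rcr_Suc')
  also have "ri m \<dots> (((Cap, i + k) # lcr False i k) @ [(Cross True, Suc (i + k))])"
    by (rule ri.suffix) (use Suc in simp)
  also have "\<dots> = [(Cap, i + k)] @ (lcr False i k @ [(Cross True, Suc (i + k))]) @ []" by simp
  also have "ri m \<dots> ([(Cap, i + k)] @ ((Cross True, Suc (i + k)) # lcr False i k) @ [])"
    by (intro ri_context[OF ri.symmetric[OF rcr_commute_left(2)]]) (use Suc in auto)
  also have "\<dots> = [] @ [(Cap, i + k), (Cross True, Suc (i + k))] @ lcr False i k" by simp
  also have "ri m \<dots> ([] @ [(Cap, Suc (i + k)), (Cross False, i + k)] @ lcr False i k)"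
    using ri.symmetric[OF ri_turn(1)[of "i + k" m False]] Suc by (intro ri_context) auto
  finally show ?case by (simp add: lcr_Suc')
qed

lemma closed_ri: "ri (wd 0 us) l r \<Longrightarrow> closed_tangle (us @ l @ vs) \<Longrightarrow> closed_tangle (us @ r @ vs)"
  using ri_ok_wd by (fastforce simp: closed_tangle_def)

context
  fixes a w c :: real and X :: "slices \<Rightarrow> real"
  assumes framed: "framed a 0 X" and skein: "skein w 0 X" and circle: "circle_factor c X"
begin

lemma skein_fun_ri: "ri (wd 0 us) l r \<Longrightarrow> closed_tangle (us @ l @ vs) \<Longrightarrow> X (us @ l @ vs) = X (us @ r @ vs)"
  by (rule move_inv_ri[OF framed_move_inv[OF framed]]) (auto simp: closed_tangle_def)

text \<open>
  The hook is pulled down over the next slice below it. Each time, the number of crossings, the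
  length of the diagram or that of \<open>vs\<close> decreases, and none of the earlier ones increases.
\<close>

lemma hook_vanishes:
  assumes IH: "\<And>ws. closed_tangle ws \<Longrightarrow>
      crossings ws < N \<or> crossings ws = N \<and> length ws < L \<Longrightarrow> X ws = 0"
    and "closed_tangle (us @ hook i k @ vs)" "crossings (us @ hook i k @ vs) = N"
      "length (us @ hook i k @ vs) = L" "\<forall>x \<in> set vs. fst x \<noteq> Cap"
  shows "X (us @ hook i k @ vs) = 0"
  using assms(2-)
proof (induction vs arbitrary: us i k)
  case Nil
  then show ?case by (auto simp: closed_tangle_def wd_hook)
next
  case (Cons fj vs)
  obtain f j where fj: "fj = (f, j)" by force
  define n where "n = wd 0 us"
  note prems = Cons.prems[unfolded fj]
  have cl: "closed_tangle (us @ hook i k @ (f, j) # vs)"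
    and N: "crossings us + k + crossings ((f, j) # vs) = N"
    and L: "length us + k + length vs + 2 = L" using prems by auto
  have f: "strands_in f = 2" "f \<noteq> Cap" using prems by (cases f; simp)+
  have b: "i + k \<le> n" "j \<le> n" "ok 0 us" "ok (n + strands_out f) vs" "wd (n + strands_out f) vs = 0"
    using cl f by (auto simp: closed_tangle_def wd_hook n_def)
  have X_eq: "X (us @ hook i k @ (f, j) # vs) = X (us @ r @ vs)" "closed_tangle (us @ r @ vs)"
    if "ri n (hook i k @ [(f, j)]) r" for r
    using skein_fun_ri[of us "hook i k @ [(f, j)]" r vs] closed_ri[of us "hook i k @ [(f, j)]" r vs] that cl
    by (auto simp: n_def)
  have X_eq': "X (us @ hook i k @ (Cross s, j) # vs) = X (us @ r @ vs)" "closed_tangle (us @ r @ vs)"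
    if "ri n (hook i k @ [(Cross s, j)]) r" "is_cross f" for r s
    using skein_fun_ri[of us "hook i k @ [(Cross s, j)]" r vs] closed_ri[of us "hook i k @ [(Cross s, j)]" r vs] that cl
    by (cases f; auto simp: n_def closed_tangle_def wd_hook)+
  \<comment> \<open>up to diagrams with fewer crossings, a crossing may be switched\<close>
  have switch: "X (us @ hook i k @ (f, j) # vs) = 0"
    if "f = Cross t" "X (us @ hook i k @ (Cross s, j) # vs) = 0" for s t
  proof -
    have cl': "closed_tangle (us @ hook i k @ (Cross True, j) # vs)"
      using cl that by (auto simp: closed_tangle_def)
    have "X (us @ hook i k @ (Cup, j) # (Cap, j) # vs) = 0"
      by (rule IH) (use cl' N that b in \<open>auto simp: closed_tangle_def wd_hook n_def\<close>)
    moreover have "X (us @ hook i k @ vs) = 0"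
      by (rule IH) (use cl' N that b in \<open>auto simp: closed_tangle_def wd_hook n_def\<close>)
    ultimately have "X (us @ hook i k @ (Cross True, j) # vs) + X (us @ hook i k @ (Cross False, j) # vs) = 0"
      using skein[unfolded skein_def, rule_format, of "us @ hook i k" j vs] cl'
      by (auto simp: closed_tangle_def)
    with that show ?thesis by (cases t; cases s) auto
  qed
  have "X (us @ hook i k @ (f, j) # vs) = 0"
  proof -
    \<comment> \<open>The legs of the hook are strands \<open>i\<close> and
      \<open>i + k + 1\<close>, and the slice acts on \<open>j\<close> and \<open>j + 1\<close>:
      beside the hook, strictly between the legs, on both legs, or on one leg together with a
      neighbour outside or inside.\<close>
    consider (left) "j + 1 < i" | (right) "j > i + k + 1" | (inside) "i < j" "j < i + k"
      | (both) "j = i" "k = 0" | (outleft) "j + 1 = i" | (outright) "j = i + k + 1"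
      | (inleft) k' where "j = i" "k = Suc k'" | (inright) k' where "j = i + k" "k = Suc k'"
      by (cases k; fastforce simp: not_less le_less)
    then show ?thesis
    proof cases
      case left
      let ?i = "i - 2 + strands_out f"
      have "ri n ((f, j) # hook ?i k) (hook i k @ [(f, j)])"
        using ri_right[of "n - j - 2" "hook (i - j - 2) k" j f n] left f b
        by (simp add: algebra_simps)
      note X_eq[OF ri.symmetric[OF this]]
      moreover have "X ((us @ [(f, j)]) @ hook ?i k @ vs) = 0"
        by (rule Cons.IH) (use prems calculation in \<open>auto simp: crossings_Cons\<close>)
      ultimately show ?thesis by simp
    next
      case right
      have "ri n ((f, j - 2) # hook i k) (hook i k @ [(f, j)])"
        using ri_left[of "i + k" "hook i k" "j - 2" f n] right f b
        by (simp add: wd_hook)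
      note X_eq[OF ri.symmetric[OF this]]
      moreover have "X ((us @ [(f, j - 2)]) @ hook i k @ vs) = 0"
        by (rule Cons.IH) (use prems calculation in \<open>auto simp: crossings_Cons\<close>)
      ultimately show ?thesis by simp
    next
      case inside
      let ?k = "k - 2 + strands_out f"
      have "ri (Suc (Suc n)) (rcr True (Suc i) k @ [(f, j)]) ((f, Suc j) # rcr True (Suc i) ?k)"
        using rcr_slide[of "Suc i" "j - Suc i" f "k + i - Suc j" "Suc (Suc n)" True] inside f b
        by (simp add: algebra_simps)
      from ri_context[OF this, of n "[(Cap, i)]" "[]"]
      have "ri n (hook i k @ [(f, j)]) ([] @ [(Cap, i), (f, Suc j)] @ rcr True (Suc i) ?k)"
        by (simp add: hook_def)
      also have "ri n \<dots> ([] @ [(f, j - 1), (Cap, i)] @ rcr True (Suc i) ?k)"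
        using ri_interchange[of i Cap "j - Suc i" f n] inside f b by (intro ri_context) auto
      finally have "ri n (hook i k @ [(f, j)]) ((f, j - 1) # hook i ?k)"
        by (simp add: hook_def)
      note * = X_eq[OF this]
      show ?thesis
      proof (cases f)
        case Cup
        \<comment> \<open>A minimum between the legs takes two crossings off the hook; a crossing is
          merely moved above it, which shortens \<open>vs\<close>.\<close>
        have "X (us @ ((f, j - 1) # hook i ?k) @ vs) = 0"
          by (rule IH) (use * N Cup inside in auto)
        with * show ?thesis by simp
      next
        case (Cross s)
        have "X ((us @ [(f, j - 1)]) @ hook i ?k @ vs) = 0"
          by (rule Cons.IH) (use * prems inside Cross in auto)
        with * show ?thesis by simp
      qed (use f in auto)
    next
      case both
      show ?thesis
      proof (cases f)
        case Cup
        have "X (us @ vs) = 0"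
          by (rule IH) (use N L b f Cup in \<open>auto simp: closed_tangle_def n_def\<close>)
        then show ?thesis
          using circle[unfolded circle_factor_def, rule_format, of us i vs] cl Cup both
          by (simp add: hook_def)
      next
        case (Cross s)
        have "X (us @ (Cap, i) # vs) = 0"
          by (rule IH) (use N L b f Cross in \<open>auto simp: closed_tangle_def n_def\<close>)
        then show ?thesis
          using framed_kink_cap[OF framed, of us i vs s] cl Cross both
          by (auto simp: hook_def closed_tangle_def)
      qed (use f in auto)
    next
      case outleft
      show ?thesis
      proof (cases f)
        case Cup
        have "hook i k @ [(f, j)] = [(Cap, i)] @ (rcr True (Suc i) k @ [(Cup, j)]) @ []"
          by (simp add: hook_def Cup)
        also have "ri n \<dots> ([(Cap, i)] @ ((Cup, j) # rcr True j k) @ [])"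
          using rcr_commute_right(1)[of j Cup 0 k "Suc (Suc n)" True] outleft b
          by (intro ri_context[OF ri.symmetric]) auto
        also have "\<dots> = [] @ [(Cap, Suc j), (Cup, j)] @ rcr True j k"
          using outleft by simp
        also have "ri n \<dots> ([] @ [] @ rcr True j k)"
          using outleft b by (intro ri_context[OF ri_zigzag(2)]) auto
        finally have "ri n (hook i k @ [(f, j)]) (rcr True j k)" by simp
        note * = X_eq[OF this]
        have "X (us @ rcr True j k @ vs) = 0"
          by (rule IH) (use * N L Cup in auto)
        with * show ?thesis by simp
      next
        case (Cross s)
        \<comment> \<open>With this choice of crossing the left leg passes over one more strand, so
          that the slice becomes part of a longer hook.\<close>
        have "ri n (hook i k @ [(Cross False, j)]) (((Cap, i + k) # lcr False i k) @ [(Cross False, j)])"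
          by (rule ri.suffix[OF hook_left]) (use b in simp)
        also have "\<dots> = (Cap, j + Suc k) # lcr False j (Suc k)"
          using outleft by (auto simp: lcr_Suc)
        also have "ri n \<dots> (hook j (Suc k))"
          by (rule ri.symmetric[OF hook_left]) (use outleft b in simp)
        finally have *: "ri n (hook i k @ [(Cross False, j)]) (hook j (Suc k))" .
        have "X (us @ hook j (Suc k) @ vs) = 0"
          by (rule Cons.IH) (use X_eq'[OF *] prems Cross in auto)
        hence "X (us @ hook i k @ (Cross False, j) # vs) = 0"
          using X_eq'[OF *] Cross by simp
        then show ?thesis using switch Cross by blast
      qed (use f in auto)
    next
      case outright
      show ?thesis
      proof (cases f)
        case Cup
        have "ri n (hook i k @ [(f, j)]) (((Cap, i + k) # lcr False i k) @ [(f, j)])"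
          by (rule ri.suffix[OF hook_left]) (use b in simp)
        also have "\<dots> = [(Cap, i + k)] @ (lcr False i k @ [(Cup, j)]) @ []"
          by (simp add: Cup)
        also have "ri n \<dots> ([(Cap, i + k)] @ ((Cup, j) # lcr False i k) @ [])"
          using rcr_commute_left(2)[of i k j Cup "Suc (Suc n)" False] outright b
          by (intro ri_context[OF ri.symmetric]) auto
        also have "\<dots> = [] @ [(Cap, i + k), (Cup, Suc (i + k))] @ lcr False i k"
          using outright by simp
        also have "ri n \<dots> ([] @ [] @ lcr False i k)"
          using outright b by (intro ri_context[OF ri_zigzag(1)]) auto
        finally have "ri n (hook i k @ [(f, j)]) (lcr False i k)" by simp
        note * = X_eq[OF this]
        have "X (us @ lcr False i k @ vs) = 0"
          by (rule IH) (use * N L Cup in auto)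
        with * show ?thesis by simp
      next
        case (Cross s)
        have h: "hook i k @ [(Cross True, j)] = hook i (Suc k)"
          using outright by (simp add: hook_def rcr_Suc')
        have *: "ri n (hook i k @ [(Cross True, j)]) (hook i (Suc k))"
          by (simp add: h)
        have "X (us @ hook i (Suc k) @ vs) = 0"
          by (rule Cons.IH) (use X_eq'[OF *] prems Cross in auto)
        hence "X (us @ hook i k @ (Cross True, j) # vs) = 0"
          using X_eq'[OF *] Cross by simp
        then show ?thesis using switch Cross by blast
      qed (use f in auto)
    next
      case inleft
      let ?h = "(Cap, i + k) # lcr False (Suc i) k'"
      have h: "ri n (hook i k @ [x]) (?h @ [(Cross False, i), x])" for x
        using ri.suffix[OF hook_left, of i k n "[x]"] inleft b by (simp add: lcr_Suc)
      have wh: "wd n ?h = Suc (Suc n)"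
        using inleft b by (simp add: wd_lcr)
      show ?thesis
      proof (cases f)
        case Cup
        have "X ((us @ ?h) @ (Cross False, i) # (Cup, i) # vs) = inverse a * X ((us @ ?h) @ (Cup, i) # vs)"
          using framed_kink_cup[OF framed, of "us @ ?h" i vs False] X_eq[OF h] Cup inleft
          by (auto simp: closed_tangle_def)
        moreover have "X ((us @ ?h) @ (Cup, i) # vs) = 0"
          by (rule IH) (use X_eq[OF h] N L Cup inleft b in \<open>auto simp: closed_tangle_def wd_lcr\<close>)
        ultimately show ?thesis using X_eq[OF h] Cup inleft by simp
      next
        case (Cross s)
        \<comment> \<open>With this choice the crossing cancels one of the hook by Reidemeister
          II.\<close>
        have "ri n (?h @ [(Cross False, i), (Cross True, i)] @ []) (?h @ [] @ [])"
          by (rule ri_context[OF ri_r2]) (use inleft b wh in auto)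
        from ri.transitive[OF h[of "(Cross True, i)"]] this
        have *: "ri n (hook i k @ [(Cross True, j)]) ?h" using inleft by simp
        have "X (us @ ?h @ vs) = 0"
          by (rule IH) (use X_eq'[OF *] N Cross inleft in auto)
        hence "X (us @ hook i k @ (Cross True, j) # vs) = 0"
          using X_eq'[OF *] Cross by simp
        then show ?thesis using switch Cross by blast
      qed (use f in auto)
    next
      case inright
      let ?h = "hook i k'"
      have h: "hook i k @ [x] = ?h @ [(Cross True, j), x]" for x
        using inright by (simp add: rcr_Suc' hook_def)
      have wh: "wd n ?h = Suc (Suc n)"
        using inright b by (simp add: wd_hook)
      show ?thesis
      proof (cases f)
        case Cup
        have cl': "closed_tangle ((us @ ?h) @ (Cross True, j) # (Cup, j) # vs)"
          using cl h[of "(f, j)"] Cup by simp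
        have "X ((us @ ?h) @ (Cross True, j) # (Cup, j) # vs) = a * X ((us @ ?h) @ (Cup, j) # vs)"
          using framed_kink_cup[OF framed, of "us @ ?h" j vs True] cl'
          by (auto simp: closed_tangle_def)
        moreover have "X ((us @ ?h) @ (Cup, j) # vs) = 0"
          by (rule IH) (use cl' N Cup inright b in \<open>auto simp: closed_tangle_def wd_hook n_def\<close>)
        ultimately show ?thesis using h[of "(f, j)"] Cup inright by simp
      next
        case (Cross s)
        have "ri n (?h @ [(Cross True, j), (Cross False, j)] @ []) (?h @ [] @ [])"
          by (rule ri_context[OF ri_r2]) (use inright b wh in auto)
        hence *: "ri n (hook i k @ [(Cross False, j)]) ?h" using h[of "(Cross False, j)"] by simp
        have "X (us @ ?h @ vs) = 0"
          by (rule IH) (use X_eq'[OF *] N Cross inright in auto)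
        hence "X (us @ hook i k @ (Cross False, j) # vs) = 0"
          using X_eq'[OF *] Cross by simp
        then show ?thesis using switch Cross by blast
      qed (use f in auto)
    qed
  qed
  then show ?case by (simp add: fj)
qed

text \<open>The lowest maximum is the one to pull down: another maximum met between the legs of the
  hook would add two crossings to it.\<close>

lemma last_cap:
  assumes "ok 0 ws" "ws \<noteq> []"
  obtains us i vs where "ws = us @ (Cap, i) # vs" "\<forall>x \<in> set vs. fst x \<noteq> Cap"
proof -
  have "\<exists>x \<in> set ws. fst x = Cap"
    using assms by (cases ws; cases "fst (hd ws)") auto
  from split_list_last_prop[OF this] that show ?thesis
    by (metis prod.collapse)
qed

text \<open>All rules are linear in \<open>X\<close> and the reduction ends at the empty diagram.
  Applied to a difference, this shows that \<open>X []\<close> determines \<open>X\<close>.\<close>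

theorem skein_vanishing:
  assumes "X [] = 0" "closed_tangle ws"
  shows "X ws = 0"
  using assms(2)
proof (induction "(crossings ws, length ws)" arbitrary: ws rule: wf_induct[OF wf_lex_prod[OF wf_less_than wf_less_than]])
  case (1 ws)
  show ?case
  proof (cases "ws = []")
    case False
    then obtain us i vs where ws: "ws = us @ (Cap, i) # vs" "\<forall>x \<in> set vs. fst x \<noteq> Cap"
      using last_cap[of ws] 1(2) by (auto simp: closed_tangle_def)
    have "X (us @ hook i 0 @ vs) = 0"
      by (rule hook_vanishes[of "crossings ws" "length ws"]) (use 1 ws in \<open>auto simp: hook_def\<close>)
    then show ?thesis by (simp add: ws hook_def)
  qed (use assms in simp)
qed

end

section \<open>Layered diagrams split\<close>

lemma ri_shift: "ri m us vs \<Longrightarrow> ok m us \<Longrightarrow> ri (m + d) (shift d us) (shift d vs)"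
proof (induction rule: ri.induct)
  case (basic l r m)
  then show ?case
    by (intro ri.basic basic_move_shift ok_shift)
next
  case (symmetric m us vs)
  then show ?case using ri_ok_wd ri.symmetric by blast
next
  case (transitive m us vs ws)
  then show ?case using ri_ok_wd ri.transitive by blast
next
  case (prefix m us vs vs')
  then show ?case
    by (auto intro!: ri.prefix simp: wd_shift)
next
  case (suffix m us us' vs)
  then show ?case by (auto intro!: ri.suffix)
qed auto

text \<open>
  Starting with the strands coloured \<open>True\<close> on the left and those coloured \<open>False\<close> on the
  right, \<open>unsort c\<close> moves the former over the latter to form the colour word \<open>c\<close>.
\<close>

fun unsort :: "bool list \<Rightarrow> slices" where
  "unsort [] = []"
| "unsort (True # c) = shift 1 (unsort c)"
| "unsort (False # c) = lcr True 0 (count_list c True) @ shift 1 (unsort c)"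

lemma count_list_bool: "count_list c True + count_list c False = length c"
  by (induction c) auto

lemma count_list_le: "count_list c b \<le> length c"
  by (induction c) auto

lemma ok_unsort: "ok (length c) (unsort c)"
  and wd_unsort: "wd (length c) (unsort c) = length c"
proof (induction c rule: unsort.induct)
  case (2 c)
  case 1 show ?case using 2 ok_shift[of "length c" "unsort c" 1] by simp
  case 2 show ?case using "2.IH" wd_shift[of "length c" "unsort c" 1] by simp
next
  case (3 c)
  note le = count_list_le[of c True]
  case 1 show ?case using 3 le ok_shift[of "length c" "unsort c" 1] by (simp add: wd_lcr)
  case 2 show ?case using "3.IH" le wd_shift[of "length c" "unsort c" 1] by (simp add: wd_lcr)
qed simp_all

text \<open>The strands of \<open>e\<close> go one by one under a group of \<open>K\<close> strands.
  Regrouped by the members of that group, each of them runs over all strands of \<open>e\<close> in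
  one go, and \<open>slide2\<close> takes \<open>e\<close> past one member at a time.\<close>

lemma double_slide:
  assumes "strands_in e + K < Suc m"
  shows "ri m (concat (map (\<lambda>j. lcr True j K) [0..<strands_in e]) @ [(e, 0)])
    ((e, K) # concat (map (\<lambda>j. lcr True j K) [0..<strands_out e]))"
  using assms
proof (induction K)
  case (Suc K)
  let ?d = "\<lambda>n K. concat (map (\<lambda>j. lcr True j K) [0..<n])"
  let ?n = "strands_in e" and ?o = "strands_out e"
  \<comment> \<open>Moves the crossings with the rightmost strand of the group to the top.\<close>
  have step: "ri k (?d n (Suc K)) (rcr True K n @ ?d n K)"
    if n: "n + K < k" "n = ?n \<or> n = ?o" for k n
  proof -
    consider "n = 0" | "n = 2" using n(2) by (cases e) auto
    then show ?thesis
    proof cases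
      case 2
      have d: "?d 2 K = lcr True 0 K @ lcr True (Suc 0) K" for K
        by (simp add: numeral_2_eq_2)
      have "?d 2 (Suc K) = [(Cross True, K)] @ (lcr True 0 K @ [(Cross True, Suc K)]) @ lcr True (Suc 0) K"
        unfolding d by (simp add: lcr_Suc')
      also have "ri k \<dots> ([(Cross True, K)] @ ((Cross True, Suc K) # lcr True 0 K) @ lcr True (Suc 0) K)"
        using n 2 by (intro ri_context[OF ri.symmetric[OF rcr_commute_left(2)]]) auto
      also have "\<dots> = rcr True K 2 @ ?d 2 K"
        unfolding d by (simp add: numeral_2_eq_2 rcr_Suc)
      finally show ?thesis using 2 by simp
    qed simp
  qed
  have "ri m (?d ?n (Suc K) @ [(e, 0)]) ((rcr True K ?n @ ?d ?n K) @ [(e, 0)])"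
    by (intro ri.suffix step) (use Suc in auto)
  also have "\<dots> = rcr True K ?n @ (?d ?n K @ [(e, 0)])" by simp
  also have "ri m \<dots> (rcr True K ?n @ ((e, K) # ?d ?o K))"
    by (intro ri.prefix) (use Suc in \<open>auto simp: wd_rcr\<close>)
  also have "\<dots> = (rcr True K ?n @ [(e, K)]) @ ?d ?o K" by simp
  also have "ri m \<dots> (((e, Suc K) # rcr True K ?o) @ ?d ?o K)"
    by (intro ri.suffix slide2) (use Suc in simp)
  also have "\<dots> = [(e, Suc K)] @ (rcr True K ?o @ ?d ?o K)" by simp
  also have "ri m \<dots> ([(e, Suc K)] @ ?d ?o (Suc K))"
    by (intro ri.prefix ri.symmetric[OF step]) (use Suc in auto)
  finally show ?case by simp
qed (cases e; simp add: numeral_2_eq_2)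

lemma unsort_replicate_True: "unsort (replicate n True @ c) = shift n (unsort c)"
  by (induction n) auto

lemma unsort_replicate_False:
  assumes "n = strands_in e \<or> n = strands_out e"
  shows "unsort (replicate n False @ c) =
    concat (map (\<lambda>j. lcr True j (count_list c True)) [0..<n]) @ shift n (unsort c)"
  using assms by (cases e) (auto simp: numeral_2_eq_2)

text \<open>A slice with strands of one colour is drawn up through the sorting braid, since each
  layer passes entirely over or under the other. On top the word is sorted with \<open>True\<close>
  first, which gives the position.\<close>

lemma unsort_natural:
  fixes x y :: "bool list"
  defines "w \<equiv> \<lambda>n b. x @ replicate n b @ y"
  shows "ri (length x + strands_in e + length y) (unsort (w (strands_in e) b) @ [(e, length x)])
    ((e, if b then count_list x True else count_list (x @ y) True + count_list x False) #
      unsort (w (strands_out e) b))"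
  unfolding w_def
proof (induction x)
  case Nil
  let ?n = "strands_in e" and ?o = "strands_out e"
  let ?d = "\<lambda>n. concat (map (\<lambda>j. lcr True j (count_list y True)) [0..<n])"
  note le = count_list_le[of y True]
  have c: "ri (?n + length y) (shift ?n (unsort y) @ [(e, 0)]) ((e, 0) # shift ?o (unsort y))"
    using ri_right[of "length y" "unsort y" 0 e] ok_unsort by (auto intro: ri.symmetric)
  show ?case
  proof (cases b)
    case True
    then show ?thesis using c by (simp add: unsort_replicate_True)
  next
    case False
    have d: "wd (?n + length y) (?d ?n) = ?n + length y"
      using le by (cases e) (auto simp: numeral_2_eq_2 wd_lcr)
    have "ri (?n + length y) (?d ?n @ (shift ?n (unsort y) @ [(e, 0)])) (?d ?n @ ((e, 0) # shift ?o (unsort y)))"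
      by (intro ri.prefix) (use c d in simp)
    also have "\<dots> = (?d ?n @ [(e, 0)]) @ shift ?o (unsort y)" by simp
    also have "ri (?n + length y) \<dots> (((e, count_list y True) # ?d ?o) @ shift ?o (unsort y))"
      by (intro ri.suffix double_slide) (use le in simp)
    finally show ?thesis
      using False by (simp add: unsort_replicate_False[of ?n e] unsort_replicate_False[of ?o e])
  qed
next
  case (Cons h x)
  let ?n = "strands_in e" and ?o = "strands_out e"
  let ?c = "\<lambda>n. x @ replicate n b @ y"
  let ?m = "length x + ?n + length y"
  let ?p = "if b then count_list x True else count_list (x @ y) True + count_list x False"
  have "ok ?m (unsort (?c ?n) @ [(e, length x)])"
    using ok_unsort[of "?c ?n"] wd_unsort[of "?c ?n"] by (simp add: add_ac)
  from ri_shift[OF Cons.IH this, of 1]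
  have *: "ri (Suc ?m) (shift 1 (unsort (?c ?n)) @ [(e, Suc (length x))]) ((e, Suc ?p) # shift 1 (unsort (?c ?o)))"
    by simp
  show ?case
  proof (cases h)
    case True
    then show ?thesis using * by (simp split: if_splits)
  next
    case False
    let ?k = "\<lambda>n. count_list (?c n) True"
    have le: "?k ?n \<le> ?m" using count_list_le[of "?c ?n" True] by simp
    have "ri (Suc ?m) (lcr True 0 (?k ?n) @ (shift 1 (unsort (?c ?n)) @ [(e, Suc (length x))]))
       (lcr True 0 (?k ?n) @ ((e, Suc ?p) # shift 1 (unsort (?c ?o))))"
      by (intro ri.prefix) (use * le in \<open>simp add: wd_lcr\<close>)
    also have "\<dots> = (lcr True 0 (?k ?n) @ [(e, Suc ?p)]) @ shift 1 (unsort (?c ?o))" by simp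
    \<comment> \<open>The strand of \<open>h\<close> runs left under all strands coloured
      \<open>True\<close>. It meets \<open>e\<close> only if \<open>e\<close> has that colour;
      otherwise \<open>e\<close> already lies to the right of all of them.\<close>
    also have "ri (Suc ?m) \<dots> (((e, if b then ?p else Suc ?p) # lcr True 0 (?k ?o)) @ shift 1 (unsort (?c ?o)))"
    proof (intro ri.suffix, cases b)
      case True
      have k: "?k n = count_list x True + n + count_list y True" for n
        using True by (induction n) (auto)
      show "ri (Suc ?m) (lcr True 0 (?k ?n) @ [(e, Suc ?p)]) ((e, if b then ?p else Suc ?p) # lcr True 0 (?k ?o))"
        using lcr_slide[of 0 "count_list x True" e "count_list y True" "Suc ?m" True] le True unfolding k by simp
    next
      case False
      have k: "?k n = count_list (x @ y) True" for n
        using False by (induction n) (auto)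
      have "?p + ?n \<le> ?m"
        using False count_list_bool[of x] count_list_le[of y True] by simp
      then show "ri (Suc ?m) (lcr True 0 (?k ?n) @ [(e, Suc ?p)]) ((e, if b then ?p else Suc ?p) # lcr True 0 (?k ?o))"
        using rcr_commute_left(2)[of 0 "count_list (x @ y) True" "Suc ?p" e "Suc ?m" True] False unfolding k
        by (auto intro: ri.symmetric)
    qed
    finally show ?thesis using False by (simp split: if_splits)
  qed
qed

text \<open>Between the colours \<open>b\<close> and \<open>\<not> b\<close>, \<open>Cross b\<close>
  has \<open>True\<close> on top, as in the sorting braid. For \<open>b = True\<close> it is one
  more crossing of the braid, for \<open>b = False\<close> it cancels one by Reidemeister
  II.\<close>

lemma unsort_mixed:
  "ri (length x + 2 + length y) (unsort (x @ b # (\<not> b) # y) @ [(Cross b, length x)])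
    (unsort (x @ (\<not> b) # b # y))"
proof (induction x)
  case Nil
  let ?U = "shift 2 (unsort y)" and ?k = "count_list y True" and ?m = "2 + length y"
  have c: "ri ?m (?U @ [(Cross b, 0)]) ((Cross b, 0) # ?U)"
    using ri_right[of "length y" "unsort y" 0 "Cross b"] ok_unsort
    by (auto intro: ri.symmetric simp: numeral_2_eq_2)
  have le: "?k \<le> length y" by (rule count_list_le)
  show ?case
  proof (cases b)
    case True
    have "ri ?m (lcr True 1 ?k @ (?U @ [(Cross b, 0)])) (lcr True 1 ?k @ ((Cross b, 0) # ?U))"
      by (intro ri.prefix) (use c le in \<open>simp add: wd_lcr\<close>)
    then show ?thesis using True by (simp add: lcr_Suc numeral_2_eq_2)
  next
    case False
    have "ri ?m (lcr True 0 (Suc ?k) @ (?U @ [(Cross b, 0)])) (lcr True 0 (Suc ?k) @ ((Cross b, 0) # ?U))"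
      by (intro ri.prefix) (use c le in \<open>simp add: wd_lcr\<close>)
    also have "\<dots> = lcr True 1 ?k @ [(Cross True, 0), (Cross False, 0)] @ ?U"
      using False by (simp add: lcr_Suc)
    also have "ri ?m \<dots> (lcr True 1 ?k @ [] @ ?U)"
      by (intro ri_context[OF ri_r2]) (use le in \<open>auto simp: wd_lcr\<close>)
    finally show ?thesis using False by (simp add: numeral_2_eq_2)
  qed
next
  case (Cons h x)
  let ?c = "\<lambda>b. x @ b # (\<not> b) # y" and ?m = "length x + 2 + length y"
  have "ok ?m (unsort (?c b) @ [(Cross b, length x)])"
    using ok_unsort[of "?c b"] wd_unsort[of "?c b"] by (simp add: add_ac)
  from ri_shift[OF Cons.IH this, of 1]
  have *: "ri (Suc ?m) (shift 1 (unsort (?c b)) @ [(Cross b, Suc (length x))]) (shift 1 (unsort (?c (\<not> b))))"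
    by simp
  show ?case
  proof (cases h)
    case True
    then show ?thesis using * by simp
  next
    case False
    have k: "count_list (?c b) True = count_list (?c (\<not> b)) True" by simp
    have le: "count_list (?c b) True \<le> ?m" using count_list_le[of "?c b" True] by simp
    have "ri (Suc ?m) (lcr True 0 (count_list (?c b) True) @ (shift 1 (unsort (?c b)) @ [(Cross b, Suc (length x))]))
       (lcr True 0 (count_list (?c b) True) @ shift 1 (unsort (?c (\<not> b))))"
      by (intro ri.prefix) (use * le in \<open>simp add: wd_lcr\<close>)
    then show ?thesis using False k by simp
  qed
qed

section \<open>Sums over colourings\<close>

text \<open>
  \<open>outs C e m\<close>: the colour words \<open>m'\<close> below \<open>e\<close> for the colour word \<open>m\<close> above it, together
  with the colour of \<open>e\<close> (none for a crossing between different colours). \<open>coef\<close> contributes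
  a factor \<open>\<sigma>\<close> for each crossing at which the smaller colour passes over the larger one.
\<close>

fun outs :: "'c set \<Rightarrow> elem \<Rightarrow> 'c list \<Rightarrow> ('c list \<times> 'c option) set" where
  "outs C Cap m = (\<lambda>b. ([b, b], Some b)) ` C"
| "outs C Cup m = (if m ! 0 = m ! 1 then {([], Some (m ! 0))} else {})"
| "outs C (Cross s) m = (if m ! 0 = m ! 1 then {(m, Some (m ! 0))} else {([m ! 1, m ! 0], None)})"

fun coef :: "real \<Rightarrow> elem \<Rightarrow> 'c :: linorder list \<Rightarrow> real" where
  "coef \<sigma> (Cross s) m = (if (if s then m ! 0 < m ! 1 else m ! 1 < m ! 0) then \<sigma> else 1)"
| "coef \<sigma> e m = 1"

text \<open>Inside the tangle of its own colour a slice keeps to its left only the strands of that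
  colour, hence \<open>count_list x b\<close>. A crossing of two colours belongs to no
  tangle.\<close>

definition upd :: "elem \<Rightarrow> 'c list \<Rightarrow> 'c option \<Rightarrow> ('c \<Rightarrow> slices) \<Rightarrow> 'c \<Rightarrow> slices" where
  "upd e x oc r = (case oc of None \<Rightarrow> r | Some b \<Rightarrow> r(b := (e, count_list x b) # r b))"

lemma upd_simps [simp]:
  "upd e x None r = r" "upd e x (Some b) r = r(b := (e, count_list x b) # r b)"
  by (simp_all add: upd_def)

text \<open>A transfer matrix sum: the state is the colour word on the current line. Since
  \<open>\<Phi>\<close> is precomposed with the slices read, it is applied at the bottom to the
  finished family of one-coloured tangles. Minima enforce that only colourings of whole components
  survive.\<close>

fun tsum :: "'c :: linorder set \<Rightarrow> real \<Rightarrow> (('c \<Rightarrow> slices) \<Rightarrow> real) \<Rightarrow> 'c list \<Rightarrow> slices \<Rightarrow> real" where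
  "tsum C \<sigma> \<Phi> c [] = (if c = [] then \<Phi> (\<lambda>_. []) else 0)"
| "tsum C \<sigma> \<Phi> c ((e, i) # ws) =
    coef \<sigma> e (take (strands_in e) (drop i c)) *
    (\<Sum>(m, oc) \<in> outs C e (take (strands_in e) (drop i c)).
       tsum C \<sigma> (\<lambda>r. \<Phi> (upd e (take i c) oc r)) (take i c @ m @ drop (i + strands_in e) c) ws)"

lemma tsum_step:
  "length m = strands_in e \<Longrightarrow> tsum C \<sigma> \<Phi> (x @ m @ y) ((e, length x) # ws) =
    coef \<sigma> e m * (\<Sum>(m', oc) \<in> outs C e m. tsum C \<sigma> (\<lambda>r. \<Phi> (upd e x oc r)) (x @ m' @ y) ws)"
  by simp

lemma split_word:
  assumes "i + n \<le> length c"
  obtains x m y where "c = x @ m @ y" "length x = i" "length m = n"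
proof -
  have *: "c = take i c @ take n (drop i c) @ drop n (drop i c)"
    by (simp only: append_take_drop_id)
  show ?thesis using assms by (intro that[OF *]) auto
qed

lemma finite_outs [simp]: "finite C \<Longrightarrow> finite (outs C e m)"
  by (cases e) auto

lemma length_2_conv: "length m = 2 \<longleftrightarrow> (\<exists>p q. m = [p, q])"
  by (auto simp: numeral_2_eq_2 length_Suc_conv)

lemma outsD:
  assumes "(m', oc) \<in> outs C e m" "length m = strands_in e" "set m \<subseteq> C"
  shows "length m' = strands_out e" "set m' \<subseteq> C"
    "\<And>b. oc = Some b \<Longrightarrow> b \<in> C \<and> m = replicate (strands_in e) b \<and> m' = replicate (strands_out e) b"
    "\<And>b. oc \<noteq> Some b \<Longrightarrow> count_list m' b = count_list m b"
proof -
  have "length m' = strands_out e \<and> set m' \<subseteq> C \<and>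
    (\<forall>b. oc = Some b \<longrightarrow> b \<in> C \<and> m = replicate (strands_in e) b \<and> m' = replicate (strands_out e) b) \<and>
    (\<forall>b. oc \<noteq> Some b \<longrightarrow> count_list m' b = count_list m b)"
  proof (cases e)
    case Cap
    with assms show ?thesis by (auto simp: numeral_2_eq_2 split: if_splits)
  next
    case Cup
    with assms obtain p q where "m = [p, q]" by (auto simp: length_2_conv)
    with Cup assms show ?thesis by (auto simp: numeral_2_eq_2 split: if_splits)
  next
    case (Cross s)
    with assms obtain p q where "m = [p, q]" by (auto simp: length_2_conv)
    with Cross assms show ?thesis by (auto simp: numeral_2_eq_2 split: if_splits)
  qed
  then show "length m' = strands_out e" "set m' \<subseteq> C"
    "\<And>b. oc = Some b \<Longrightarrow> b \<in> C \<and> m = replicate (strands_in e) b \<and> m' = replicate (strands_out e) b"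
    "\<And>b. oc \<noteq> Some b \<Longrightarrow> count_list m' b = count_list m b"
    by blast+
qed

definition valid_fam :: "'c set \<Rightarrow> 'c list \<Rightarrow> ('c \<Rightarrow> slices) \<Rightarrow> bool" where
  "valid_fam C c r \<longleftrightarrow> (\<forall>b \<in> C. ok (count_list c b) (r b) \<and> wd (count_list c b) (r b) = 0)"

lemma count_list_replicate: "count_list (replicate n b) c = (if b = c then n else 0)"
  by (induction n) auto

lemma valid_fam_upd:
  assumes "valid_fam C (x @ m' @ y) r" "(m', oc) \<in> outs C e m" "length m = strands_in e" "set m \<subseteq> C"
  shows "valid_fam C (x @ m @ y) (upd e x oc r)"
proof -
  have "ok (count_list (x @ m @ y) b) (upd e x oc r b) \<and> wd (count_list (x @ m @ y) b) (upd e x oc r b) = 0"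
    if "b \<in> C" for b
  proof (cases "oc = Some b")
    case True
    have m: "m = replicate (strands_in e) b" "m' = replicate (strands_out e) b"
      using outsD(3)[OF assms(2-4) True] by simp_all
    with assms(1)[unfolded valid_fam_def, rule_format, OF that] True show ?thesis
      by (simp add: count_list_replicate add_ac)
  next
    case False
    hence "upd e x oc r b = r b" by (cases oc) auto
    with outsD(4)[OF assms(2-4) False] assms(1)[unfolded valid_fam_def, rule_format, OF that]
    show ?thesis by simp
  qed
  thus ?thesis by (simp add: valid_fam_def)
qed

lemma tsum_cong:
  assumes "\<And>r. valid_fam C c r \<Longrightarrow> \<Phi> r = \<Psi> r" "ok (length c) ws" "wd (length c) ws = 0" "set c \<subseteq> C"
  shows "tsum C \<sigma> \<Phi> c ws = tsum C \<sigma> \<Psi> c ws"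
  using assms
proof (induction ws arbitrary: c \<Phi> \<Psi>)
  case Nil
  then show ?case by (simp add: valid_fam_def)
next
  case (Cons ei ws)
  obtain e i where ei: "ei = (e, i)" by force
  with Cons.prems have "i + strands_in e \<le> length c" by simp
  then obtain x m y where xmy: "c = x @ m @ y" "length x = i" "length m = strands_in e"
    by (rule split_word)
  note c = xmy(1,3)
  have ei: "ei = (e, length x)" using ei xmy by simp
  have "tsum C \<sigma> (\<lambda>r. \<Phi> (upd e x oc r)) (x @ m' @ y) ws = tsum C \<sigma> (\<lambda>r. \<Psi> (upd e x oc r)) (x @ m' @ y) ws"
    if "(m', oc) \<in> outs C e m" for m' oc
    using Cons.prems c ei valid_fam_upd[of C x m' y _ oc e m] outsD(1,2)[OF that c(2)] that
    by (intro Cons.IH) (auto simp: algebra_simps)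
  then show ?case
    unfolding ei c(1) tsum_step[OF c(2)] by (auto intro!: sum.cong)
qed

lemma tsum_linear:
  "tsum C \<sigma> (\<lambda>r. \<alpha> * \<Phi> r + \<beta> * \<Psi> r) c ws = \<alpha> * tsum C \<sigma> \<Phi> c ws + \<beta> * tsum C \<sigma> \<Psi> c ws"
proof (induction ws arbitrary: c \<Phi> \<Psi>)
  case (Cons ei ws)
  then show ?case
    by (cases ei) (simp add: case_prod_unfold sum.distrib sum_distrib_left mult.left_commute distrib_left)
qed simp

lemma tsum_scale: "tsum C \<sigma> (\<lambda>r. \<alpha> * \<Phi> r) c ws = \<alpha> * tsum C \<sigma> \<Phi> c ws"
  using tsum_linear[of C \<sigma> \<alpha> \<Phi> 0 \<Phi> c ws] by simp

text \<open>Reading one more slice above acts linearly on the sums below it, and in the same way for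
  every member of \<open>ls\<close>. So a linear relation passes to any common prefix;
  \<open>R\<close> carries its hypotheses along the colour words.\<close>

lemma tsum_prefix:
  assumes base: "\<And>c \<Phi>. R [] c \<Phi> \<Longrightarrow> (\<Sum>(\<alpha>, l) \<leftarrow> ls. \<alpha> * tsum C \<sigma> \<Phi> c l) = 0"
    and step: "\<And>e us x m y \<Phi> m' oc. R ((e, length x) # us) (x @ m @ y) \<Phi> \<Longrightarrow> length m = strands_in e \<Longrightarrow>
      (m', oc) \<in> outs C e m \<Longrightarrow> R us (x @ m' @ y) (\<lambda>r. \<Phi> (upd e x oc r))"
    and "R us c \<Phi>" "ok (length c) us" "set c \<subseteq> C"
  shows "(\<Sum>(\<alpha>, l) \<leftarrow> ls. \<alpha> * tsum C \<sigma> \<Phi> c (us @ l)) = 0"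
  using assms(3-)
proof (induction us arbitrary: c \<Phi>)
  case Nil
  then show ?case using base by simp
next
  case (Cons ei us)
  obtain e i where ei: "ei = (e, i)" by force
  with Cons.prems have "i + strands_in e \<le> length c" by simp
  then obtain x m y where xmy: "c = x @ m @ y" "length x = i" "length m = strands_in e"
    by (rule split_word)
  note c = xmy(1,3)
  have ei: "ei = (e, length x)" using ei xmy by simp
  have sum_list_sum: "(\<Sum>(\<alpha>, l) \<leftarrow> ls. \<alpha> * (k * (\<Sum>z \<in> S. h z l))) = k * (\<Sum>z \<in> S. \<Sum>(\<alpha>, l) \<leftarrow> ls. \<alpha> * h z l)"
    for k S and h :: "_ \<Rightarrow> _ \<Rightarrow> real"
    by (induction ls) (auto simp: sum.distrib sum_distrib_left algebra_simps)
  have "(\<Sum>(\<alpha>, l) \<leftarrow> ls. \<alpha> * tsum C \<sigma> (\<lambda>r. \<Phi> (upd e x oc r)) (x @ m' @ y) (us @ l)) = 0"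
    if "(m', oc) \<in> outs C e m" for m' oc
    using Cons.prems c ei outsD(1,2)[OF that c(2)] that step[of e x us m y \<Phi> m' oc]
    by (intro Cons.IH) (auto simp: algebra_simps)
  then show ?case
    unfolding ei c(1) append_Cons tsum_step[OF c(2)] case_prod_unfold
      sum_list_sum[unfolded case_prod_unfold, of "coef \<sigma> e m"
        "\<lambda>z l. tsum C \<sigma> (\<lambda>r. \<Phi> (upd e x (snd z) r)) (x @ fst z @ y) (us @ l)" "outs C e m"]
    by (auto intro!: sum.neutral)
qed

text \<open>The analogue of multilinearity: \<open>P\<close> holds in each colour separately while
  the tangles of the other colours are fixed.\<close>

definition fam :: "(nat \<Rightarrow> (slices \<Rightarrow> real) \<Rightarrow> bool) \<Rightarrow> 'c set \<Rightarrow> 'c list \<Rightarrow> (('c \<Rightarrow> slices) \<Rightarrow> real) \<Rightarrow> bool" where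
  "fam P C c \<Phi> \<longleftrightarrow>
    (\<forall>r. valid_fam C c r \<longrightarrow> (\<forall>b \<in> C. P (count_list c b) (\<lambda>s. \<Phi> (r(b := s)))))"

lemma fam_upd:
  assumes fam: "fam P C (x @ m @ y) \<Phi>"
    and o: "(m', oc) \<in> outs C e m" "length m = strands_in e" "set m \<subseteq> C"
    and Cons: "\<And>k X i. P k X \<Longrightarrow> i + strands_in e \<le> k \<Longrightarrow>
      P (k - strands_in e + strands_out e) (\<lambda>s. X ((e, i) # s))"
  shows "fam P C (x @ m' @ y) (\<lambda>r. \<Phi> (upd e x oc r))"
  unfolding fam_def
proof (intro allI impI ballI)
  fix r b assume r: "valid_fam C (x @ m' @ y) r" and b: "b \<in> C"
  note v = valid_fam_upd[OF r o]
  have F: "P (count_list (x @ m @ y) b) (\<lambda>s. \<Phi> ((upd e x oc r)(b := s)))"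
    using fam v b by (simp add: fam_def)
  show "P (count_list (x @ m' @ y) b) (\<lambda>s. \<Phi> (upd e x oc (r(b := s))))"
  proof (cases "oc = Some b")
    case True
    with outsD(3)[OF o True] Cons[OF F, of "count_list x b"] show ?thesis
      by (simp add: count_list_replicate algebra_simps)
  next
    case False
    have "upd e x oc (r(b := s)) = (upd e x oc r)(b := s)" for s
      using False by (cases oc) (auto simp: fun_upd_twist)
    with F outsD(4)[OF o False] show ?thesis by simp
  qed
qed

lemma framed_Cons:
  assumes "framed a m X" "i + strands_in e \<le> m"
  shows "framed a (m - strands_in e + strands_out e) (\<lambda>s. X ((e, i) # s))"
  unfolding framed_def
proof (intro allI impI)
  fix us l r vs f
  let ?m = "m - strands_in e + strands_out e"
  assume "framed_move a f l r" "ok ?m (us @ l @ vs)" "ok ?m (us @ r @ vs)" "wd ?m (us @ l @ vs) = 0"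
  then show "X ((e, i) # us @ l @ vs) = f * X ((e, i) # us @ r @ vs)"
    using assms(1)[unfolded framed_def, rule_format, of f l r "(e, i) # us" vs] assms(2) by simp
qed

section \<open>Layered diagrams\<close>

fun under :: "elem \<Rightarrow> bool list \<Rightarrow> bool" where
  "under (Cross s) m \<longleftrightarrow> m ! 0 \<noteq> m ! 1 \<and> s \<noteq> m ! 0"
| "under e m \<longleftrightarrow> False"

text \<open>
  \<open>layers c ws P n\<close>: the colour word \<open>c\<close> on the strands entering \<open>ws\<close> extends to a colouring of
  the components in which the strands of colour \<open>b\<close> form the tangle \<open>P b\<close>, and colour \<open>True\<close>
  passes under colour \<open>False\<close> at exactly \<open>n\<close> crossings.
\<close>

inductive layers :: "bool list \<Rightarrow> slices \<Rightarrow> (bool \<Rightarrow> slices) \<Rightarrow> nat \<Rightarrow> bool" where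
  Nil: "layers [] [] (\<lambda>_. []) 0"
| Cons: "length m = strands_in e \<Longrightarrow> (m', oc) \<in> outs UNIV e m \<Longrightarrow> layers (x @ m' @ y) ws P n \<Longrightarrow>
    layers (x @ m @ y) ((e, length x) # ws) (upd e x oc P) (if under e m then Suc n else n)"

lemma layers_valid: "layers c ws P n \<Longrightarrow> valid_fam UNIV c P"
  by (induction rule: layers.induct) (auto intro: valid_fam_upd simp: valid_fam_def[of _ "[]"])

text \<open>A one-coloured slice is drawn up by \<open>unsort_natural\<close> and so leaves the
  mixed part of the diagram for its own layer.\<close>

lemma layers_ri_step:
  assumes "ri (length x + strands_out e + length y) (unsort (x @ replicate (strands_out e) b @ y) @ ws) (P True @ P False)"
    and P: "ok (count_list (x @ replicate (strands_out e) b @ y) True) (P True)"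
      "wd (count_list (x @ replicate (strands_out e) b @ y) True) (P True) = 0"
    and P': "P' = P(b := (e, count_list x b) # P b)"
  shows "ri (length x + strands_in e + length y)
    (unsort (x @ replicate (strands_in e) b @ y) @ (e, length x) # ws) (P' True @ P' False)"
proof -
  let ?m = "length x + strands_in e + length y"
  let ?c = "\<lambda>n. x @ replicate n b @ y"
  let ?k = "count_list (x @ y) True"
  let ?p = "if b then count_list x True else ?k + count_list x False"
  have le: "?p + strands_in e \<le> ?m"
    using count_list_bool[of x] count_list_le[of x True] count_list_le[of y True] by auto
  have "ri ?m ((unsort (?c (strands_in e)) @ [(e, length x)]) @ ws) (((e, ?p) # unsort (?c (strands_out e))) @ ws)"
    by (intro ri.suffix unsort_natural)
  also have "\<dots> = [(e, ?p)] @ (unsort (?c (strands_out e)) @ ws)" by simp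
  also have "ri ?m \<dots> ([(e, ?p)] @ (P True @ P False))"
    using le by (intro ri.prefix) (use assms(1) in \<open>simp add: algebra_simps\<close>)
  \<comment> \<open>A slice of colour \<open>False\<close> now lies to the right of the upper layer
    and sinks past all of it. \<open>P True\<close> absorbs its own strands, which leaves
    \<open>count_list x False\<close> on the left.\<close>
  also have "ri ?m \<dots> (P' True @ P' False)"
  proof (cases b)
    case False
    have [simp]: "count_list (?c n) True = ?k" for n
      using False by (induction n) auto
    have "ri ?m ((e, ?p) # P True) (P True @ [(e, count_list x False)])"
      using ri_left[of ?k "P True" ?p e ?m] False P le by simp
    from ri.suffix[OF this, of "P False"] show ?thesis
      using False by (simp add: P')
  qed (simp add: P')
  finally show ?thesis by simp
qed

text \<open>For \<open>c = []\<close> the sorting braid is empty, and a diagram without wrong mixed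
  crossings becomes its two layers stacked on each other.\<close>

lemma layers_ri: "layers c ws P n \<Longrightarrow> n = 0 \<Longrightarrow> ri (length c) (unsort c @ ws) (P True @ P False)"
proof (induction rule: layers.induct)
  case (Cons m e m' oc x y ws P n)
  hence n: "n = 0" "\<not> under e m" by (auto split: if_splits)
  show ?case
  proof (cases oc)
    case (Some b)
    have m: "m = replicate (strands_in e) b" "m' = replicate (strands_out e) b"
      using outsD(3)[OF Cons.hyps(2,1) _ Some] by simp_all
    have P: "ok (count_list (x @ m' @ y) True) (P True)" "wd (count_list (x @ m' @ y) True) (P True) = 0"
      using layers_valid[OF Cons.hyps(3)] by (simp_all add: valid_fam_def)
    have "ri (length x + strands_out e + length y) (unsort (x @ replicate (strands_out e) b @ y) @ ws) (P True @ P False)"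
      using Cons.IH[OF n(1)] by (simp add: m add.assoc)
    from layers_ri_step[OF this P[unfolded m(2)] HOL.refl] show ?thesis
      by (simp add: m(1) Some add.assoc)
  next
    case None
    with Cons.hyps(1,2) n(2) obtain b where m: "e = Cross b" "m = [b, \<not> b]" "m' = [\<not> b, b]"
      by (cases e) (auto simp: length_2_conv split: if_splits)
    have "ri (length (x @ m @ y)) ((unsort (x @ m @ y) @ [(e, length x)]) @ ws) (unsort (x @ m' @ y) @ ws)"
      using ri.suffix[OF unsort_mixed[of x y b], of ws] m by simp
    also have "ri (length (x @ m @ y)) \<dots> (P True @ P False)"
      using Cons.IH[OF n(1)] m by simp
    finally show ?thesis by (simp add: None)
  qed
qed simp

section \<open>Invariance of the coloured sums under the moves\<close>

declare tsum.simps(2) [simp del]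

definition sg :: "real \<Rightarrow> bool \<Rightarrow> 'c :: linorder \<Rightarrow> 'c \<Rightarrow> real" where
  "sg \<sigma> s p q = (if (if s then p < q else q < p) then \<sigma> else 1)"

lemma tsum_Cap:
  "tsum C \<sigma> \<Phi> (x @ y) ((Cap, length x) # ws) =
    (\<Sum>b \<in> C. tsum C \<sigma> (\<lambda>r. \<Phi> (r(b := (Cap, count_list x b) # r b))) (x @ b # b # y) ws)"
proof -
  have "inj_on (\<lambda>b. ([b, b], Some b)) C" by (auto simp: inj_on_def)
  then show ?thesis
    using tsum_step[of "[]" Cap C \<sigma> \<Phi> x y ws] by (simp add: sum.reindex)
qed

lemma tsum_Cup:
  "tsum C \<sigma> \<Phi> (x @ p # q # y) ((Cup, length x) # ws) =
    (if p = q then tsum C \<sigma> (\<lambda>r. \<Phi> (r(p := (Cup, count_list x p) # r p))) (x @ y) ws else 0)"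
  using tsum_step[of "[p, q]" Cup C \<sigma> \<Phi> x y ws] by simp

lemma tsum_Cross:
  "tsum C \<sigma> \<Phi> (x @ p # q # y) ((Cross s, length x) # ws) =
    (if p = q then tsum C \<sigma> (\<lambda>r. \<Phi> (r(p := (Cross s, count_list x p) # r p))) (x @ p # q # y) ws
     else sg \<sigma> s p q * tsum C \<sigma> \<Phi> (x @ q # p # y) ws)"
  using tsum_step[of "[p, q]" "Cross s" C \<sigma> \<Phi> x y ws] by (auto simp: sg_def)

lemmas tsum_elem = tsum_Cap tsum_Cup tsum_Cross
  tsum_Cap[of C \<sigma> \<Phi> "[]" for C \<sigma> \<Phi>, simplified]
  tsum_Cap[of C \<sigma> \<Phi> "x @ [p]" for C \<sigma> \<Phi> x p, simplified]
  tsum_Cup[of C \<sigma> \<Phi> "x @ [p]" for C \<sigma> \<Phi> x p, simplified]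
  tsum_Cross[of C \<sigma> \<Phi> "x @ [p]" for C \<sigma> \<Phi> x p, simplified]

lemma framed_famD:
  assumes "fam (framed a) C c \<Phi>" "framed_move a f l l'" "b \<in> C"
    "valid_fam C c (r(b := l @ v))" "valid_fam C c (r(b := l' @ v))"
  shows "\<Phi> (r(b := l @ v)) = f * \<Phi> (r(b := l' @ v))"
proof -
  have "framed a (count_list c b) (\<lambda>s. \<Phi> (r(b := s)))"
    using assms(1)[unfolded fam_def, rule_format, OF assms(4,3)] by simp
  from this[unfolded framed_def, rule_format, OF assms(2), of "[]" v]
    assms(4,5)[unfolded valid_fam_def, rule_format, OF assms(3)]
  show ?thesis by simp
qed

lemma framed_famD':
  assumes "fam (framed a) C c \<Phi>" "framed_move a f l l'" "b \<in> C" "valid_fam C c' r"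
    "\<And>b'. b' \<noteq> b \<Longrightarrow> count_list c' b' = count_list c b'"
    "wd (count_list c b) l = count_list c' b" "ok (count_list c b) l"
    "wd (count_list c b) l' = count_list c' b" "ok (count_list c b) l'"
  shows "\<Phi> (r(b := l @ r b)) = f * \<Phi> (r(b := l' @ r b))"
  by (rule framed_famD[OF assms(1-3)]) (use assms(3-) in \<open>auto simp: valid_fam_def\<close>)

lemma tsum_cong_scale:
  assumes "\<And>r. valid_fam C c r \<Longrightarrow> \<Phi> r = f * \<Psi> r" "ok (length c) ws" "wd (length c) ws = 0" "set c \<subseteq> C"
  shows "tsum C \<sigma> \<Phi> c ws = f * tsum C \<sigma> \<Psi> c ws"
  using tsum_cong[of C c \<Phi> "\<lambda>r. f * \<Psi> r", OF assms] by (simp add: tsum_scale)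

lemma tsum_interchange:
  assumes F: "fam (framed a) C c \<Phi>" and c: "c = x @ m @ y @ n @ z" "length m = strands_in e" "length n = strands_in f"
    and vs: "ok (length c) ([(e, length x), (f, length x + strands_out e + length y)] @ vs)"
      "wd (length c) ([(e, length x), (f, length x + strands_out e + length y)] @ vs) = 0"
    and C: "set c \<subseteq> C"
  shows "tsum C \<sigma> \<Phi> c ([(e, length x), (f, length x + strands_out e + length y)] @ vs) =
    tsum C \<sigma> \<Phi> c ([(f, length x + strands_in e + length y), (e, length x)] @ vs)" (is "?L = ?R")
proof -
  define G where "G = (\<lambda>m' oc n' od. tsum C \<sigma> (\<lambda>r. \<Phi> (upd f (x @ m @ y) od (upd e x oc r))) (x @ m' @ y @ n' @ z) vs)"
  have eq: "tsum C \<sigma> (\<lambda>r. \<Phi> (upd e x oc (upd f (x @ m' @ y) od r))) (x @ m' @ y @ n' @ z) vs = G m' oc n' od"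
    if o: "(m', oc) \<in> outs C e m" "(n', od) \<in> outs C f n" for m' oc n' od
    unfolding G_def
  proof (rule tsum_cong)
    have mC: "set m \<subseteq> C" "set n \<subseteq> C" using C c by auto
    note om = outsD[OF o(1) c(2) mC(1)] and on = outsD[OF o(2) c(3) mC(2)]
    show "set (x @ m' @ y @ n' @ z) \<subseteq> C" using om(2) on(2) C c by auto
    show "ok (length (x @ m' @ y @ n' @ z)) vs" "wd (length (x @ m' @ y @ n' @ z)) vs = 0"
      using vs c om(1) on(1) by (simp_all add: algebra_simps)
    fix r assume r: "valid_fam C (x @ m' @ y @ n' @ z) r"
    have 1: "valid_fam C c (upd e x oc (upd f (x @ m' @ y) od r))"
      using valid_fam_upd[of C "x @ m' @ y" n' z r od f n] valid_fam_upd[of C x m' "y @ n @ z" _ oc e m] r o mC c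
      by simp
    have 2: "valid_fam C c (upd f (x @ m @ y) od (upd e x oc r))"
      using valid_fam_upd[of C "x @ m @ y" n' z _ od f n] valid_fam_upd[of C x m' "y @ n' @ z" r oc e m] r o mC c
      by simp
    show "\<Phi> (upd e x oc (upd f (x @ m' @ y) od r)) = \<Phi> (upd f (x @ m @ y) od (upd e x oc r))"
    \<comment> \<open>Slices of equal colour are interchanged within the tangle of that colour;
      otherwise they enter different tangles, or none, and the updates commute.\<close>
    proof (cases "\<exists>b. oc = Some b \<and> od = Some b")
      case True
      then obtain b where b: "oc = Some b" "od = Some b" by auto
      have mm: "m = replicate (strands_in e) b" "m' = replicate (strands_out e) b" "b \<in> C"
        using om(3)[OF b(1)] by auto
      let ?i = "count_list x b" and ?k = "count_list y b"
      have "framed_move a 1 [(e, ?i), (f, ?i + strands_out e + ?k)] [(f, ?i + strands_in e + ?k), (e, ?i)]"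
        by (auto simp: framed_move_def intro: planar_move.interchange)
      from framed_famD[OF F this mm(3), of r "r b"] 1 2 show ?thesis
        by (simp add: b mm(1,2) count_list_replicate add.assoc)
    next
      case False
      have "upd e x oc (upd f (x @ m' @ y) od r) = upd f (x @ m @ y) od (upd e x oc r)"
        using False om(4) by (cases oc; cases od) (auto simp: fun_upd_twist)
      then show ?thesis by simp
    qed
  qed
  have "?L = coef \<sigma> e m * (\<Sum>(m', oc) \<in> outs C e m. coef \<sigma> f n * (\<Sum>(n', od) \<in> outs C f n. G m' oc n' od))"
  proof -
    have "tsum C \<sigma> (\<lambda>r. \<Phi> (upd e x oc r)) (x @ m' @ y @ n @ z) ((f, length x + strands_out e + length y) # vs) =
        coef \<sigma> f n * (\<Sum>(n', od) \<in> outs C f n. G m' oc n' od)"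
      if o: "(m', oc) \<in> outs C e m" for m' oc
      using tsum_step[OF c(3), of C \<sigma> "\<lambda>r. \<Phi> (upd e x oc r)" "x @ m' @ y" z vs] eq[OF o] outsD(1)[OF o c(2)] C c(1)
      by (auto simp: add.assoc intro!: sum.cong)
    then show ?thesis
      using tsum_step[OF c(2), of C \<sigma> \<Phi> x "y @ n @ z"] by (auto simp: c(1) intro!: sum.cong)
  qed
  also have "\<dots> = coef \<sigma> f n * (\<Sum>(n', od) \<in> outs C f n. coef \<sigma> e m * (\<Sum>(m', oc) \<in> outs C e m. G m' oc n' od))"
    by (simp add: case_prod_unfold sum_distrib_left mult.left_commute)
      (rule sum.swap)
  also have "\<dots> = ?R"
    using tsum_step[OF c(3), of C \<sigma> \<Phi> "x @ m @ y" z "(e, length x) # vs"]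
      tsum_step[OF c(2), of C \<sigma> "\<lambda>r. \<Phi> (upd f (x @ m @ y) od r)" x "y @ n' @ z" vs for od n']
    by (simp add: c G_def add.assoc)
  finally show ?thesis .
qed

lemma word_at:
  "i < length c \<Longrightarrow> \<exists>x p y. c = x @ p # y \<and> length x = i"
  "Suc i < length c \<Longrightarrow> \<exists>x p q y. c = x @ p # q # y \<and> length x = i"
  "Suc (Suc i) < length c \<Longrightarrow> \<exists>x p q t y. c = x @ p # q # t # y \<and> length x = i"
proof -
  show "\<exists>x p y. c = x @ p # y \<and> length x = i" if "i < length c"
    using id_take_nth_drop[OF that] that by (intro exI[of _ "take i c"]) auto
  show "\<exists>x p q y. c = x @ p # q # y \<and> length x = i" if "Suc i < length c"
    using id_take_nth_drop[of i c] Cons_nth_drop_Suc[of "Suc i" c] that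
    by (metis Suc_lessD length_take less_or_eq_imp_le min.absorb2)
  show "\<exists>x p q t y. c = x @ p # q # t # y \<and> length x = i" if "Suc (Suc i) < length c"
    using id_take_nth_drop[of i c] Cons_nth_drop_Suc[of "Suc i" c] Cons_nth_drop_Suc[of "Suc (Suc i)" c] that
    by (metis Suc_lessD length_take less_or_eq_imp_le min.absorb2)
qed

lemma sg_sq: "\<sigma> * \<sigma> = 1 \<Longrightarrow> sg \<sigma> s p q * sg \<sigma> s p q = 1"
  by (simp add: sg_def)

lemma sg_flip: "p \<noteq> q \<Longrightarrow> sg \<sigma> (\<not> s) q p = sg \<sigma> s p q"
  by (auto simp: sg_def)

lemma framed_move_curl: "curl s l l' \<Longrightarrow> framed_move a (if s then a else inverse a) l l'"
  by (auto simp: framed_move_def)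

text \<open>If all strands of the move have one colour, it is a move in the tangle of that colour.
  Otherwise every colour keeps its tangle and the signs agree: Reidemeister II yields a square,
  while turns and Reidemeister III preserve, for each pair of strands, which one is on top.\<close>

lemma tsum_framed_move:
  assumes m: "framed_move a f l l'" and F: "fam (framed a) C c \<Phi>" and C: "finite C" "set c \<subseteq> C"
    and vs: "ok (length c) (l @ vs)" "wd (length c) (l @ vs) = 0" "ok (length c) (l' @ vs)"
    and \<sigma>: "\<sigma> * \<sigma> = 1"
  shows "tsum C \<sigma> \<Phi> c (l @ vs) = f * tsum C \<sigma> \<Phi> c (l' @ vs)"
proof -
  have F': "\<Phi> (r(b := k @ r b)) = f * \<Phi> (r(b := k' @ r b))"
    if "framed_move a f k k'" "b \<in> C" "valid_fam C c' r"
    "\<And>b'. b' \<noteq> b \<Longrightarrow> count_list c' b' = count_list c b'"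
    "wd (count_list c b) k = count_list c' b" "ok (count_list c b) k"
    "wd (count_list c b) k' = count_list c' b" "ok (count_list c b) k'"
    for k k' b c' r
    using framed_famD'[OF F that] .
  \<comment> \<open>Zigzags and curls involve a single strand, whose colour \<open>p\<close> forces
    that of the maximum.\<close>
  have one_strand: "tsum C \<sigma> \<Phi> c (l @ vs) = f * tsum C \<sigma> \<Phi> c (l' @ vs)"
    if "l' = []" "c = x @ p # y" "framed_move a f k []" "wd (count_list c p) k = count_list c p" "ok (count_list c p) k"
      "wd (length c) l = length c" "tsum C \<sigma> \<Phi> c (l @ vs) =
        (\<Sum>b \<in> C. if b = p then tsum C \<sigma> (\<lambda>r. \<Phi> (r(p := k @ r p))) c vs else 0)" for x p y k
  proof -
    have p: "p \<in> C" using C that(2) by simp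
    have "tsum C \<sigma> \<Phi> c (l @ vs) = tsum C \<sigma> (\<lambda>r. \<Phi> (r(p := k @ r p))) c vs"
      unfolding that(7) using C(1) p by simp
    also have "\<dots> = f * tsum C \<sigma> \<Phi> c vs"
      using vs C(2) F'[OF that(3) p, of c] that(1,4-6) by (auto intro!: tsum_cong_scale)
    finally show ?thesis using that(1) by simp
  qed
  consider (basic) "f = 1" "basic_move l l'" | (curl) s where "f = (if s then a else inverse a)" "curl s l l'"
    using m unfolding framed_move_def by (metis (full_types))
  then show ?thesis
  proof cases
    case basic
    from basic(2) show ?thesis
    proof (cases rule: basic_move_cases)
      case (interchange e g i k)
      have le: "i + strands_in e + k + strands_in g \<le> length c"
        using vs(3) by (auto simp: interchange)
      from split_word[of i "strands_in e" c] le obtain x m y' where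
        1: "c = x @ m @ y'" "length x = i" "length m = strands_in e" by auto
      from split_word[of k "strands_in g" y'] le 1 obtain y n z where
        2: "y' = y @ n @ z" "length y = k" "length n = strands_in g" by auto
      show ?thesis
        using tsum_interchange[OF F, of x m y n z e g vs \<sigma>] 1 2 vs C by (simp add: interchange basic)
    next
      case (zigzag_left i)
      then obtain x p y where c: "c = x @ p # y" "length x = i"
        using word_at(1)[of i c] vs by auto
      note [simp] = zigzag_left basic(1) c(1) c(2)[symmetric]
      let ?k = "count_list x p"
      have "framed_move a f [(Cap, ?k), (Cup, Suc ?k)] []"
        by (auto simp: framed_move_def intro: planar_move.intros)
      then show ?thesis
        by (intro one_strand[OF _ c(1)]) (auto simp: tsum_elem intro!: sum.cong)
    next
      case (zigzag_right i)
      then obtain x p y where c: "c = x @ p # y" "length x = i"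
        using word_at(1)[of i c] vs by auto
      note [simp] = zigzag_right basic(1) c(1) c(2)[symmetric]
      let ?k = "count_list x p"
      have "framed_move a f [(Cap, Suc ?k), (Cup, ?k)] []"
        by (auto simp: framed_move_def intro: planar_move.intros)
      then show ?thesis
        by (intro one_strand[OF _ c(1)]) (auto simp: tsum_elem intro!: sum.cong)
    next
      case (turn_cap i s)
      then obtain x p y where c: "c = x @ p # y" "length x = i"
        using word_at(1)[of i c] vs by auto
      note [simp] = turn_cap basic(1) c(1) c(2)[symmetric]
      have p: "p \<in> C" using C by simp
      let ?k = "count_list x p"
      have M: "framed_move a f [(Cap, Suc ?k), (Cross s, ?k)] [(Cap, ?k), (Cross (\<not> s), Suc ?k)]"
        by (auto simp: framed_move_def intro: planar_move.intros reidemeister2.intros)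
      have "tsum C \<sigma> (\<lambda>r. \<Phi> (r(p := (Cap, Suc (?k)) # (Cross s, ?k) # r p))) (x @ p # p # p # y) vs =
        tsum C \<sigma> (\<lambda>r. \<Phi> (r(p := (Cap, ?k) # (Cross (\<not> s), Suc (?k)) # r p))) (x @ p # p # p # y) vs"
        using C vs F'[OF M p] by (intro tsum_cong) auto
      then show ?thesis
        by (auto simp: tsum_elem sg_flip intro!: sum.cong)
    next
      case (turn_cup i s)
      then obtain x p q t y where c: "c = x @ p # q # t # y" "length x = i"
        using word_at(3)[of i c] vs by auto
      note [simp] = turn_cup basic(1) c(1) c(2)[symmetric]
      have p: "p \<in> C" using C by simp
      let ?k = "count_list x p"
      have M: "framed_move a f [(Cross s, ?k), (Cup, Suc ?k)] [(Cross (\<not> s), Suc ?k), (Cup, ?k)]"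
        by (auto simp: framed_move_def intro: planar_move.intros reidemeister2.intros)
      have "tsum C \<sigma> (\<lambda>r. \<Phi> (r(p := (Cross s, ?k) # (Cup, Suc (?k)) # r p))) (x @ p # y) vs =
        tsum C \<sigma> (\<lambda>r. \<Phi> (r(p := (Cross (\<not> s), Suc (?k)) # (Cup, ?k) # r p))) (x @ p # y) vs"
        if "p = q" "q = t" using C vs F'[OF M p] that by (intro tsum_cong) auto
      then show ?thesis
        by (auto simp: tsum_elem sg_flip)
    next
      case (r2 i s)
      then obtain x p q y where c: "c = x @ p # q # y" "length x = i"
        using word_at(2)[of i c] vs by auto
      note [simp] = r2 basic(1) c(1) c(2)[symmetric]
      have p: "p \<in> C" using C by simp
      let ?k = "count_list x p"
      have M: "framed_move a f [(Cross s, ?k), (Cross (\<not> s), ?k)] []"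
        by (auto simp: framed_move_def intro: planar_move.intros reidemeister2.intros)
      have "tsum C \<sigma> (\<lambda>r. \<Phi> (r(p := (Cross s, ?k) # (Cross (\<not> s), ?k) # r p))) (x @ p # p # y) vs =
        tsum C \<sigma> \<Phi> (x @ p # p # y) vs"
        if "p = q" using C vs F'[OF M p] that by (intro tsum_cong) auto
      then show ?thesis
        using sg_sq[OF \<sigma>] by (auto simp: tsum_elem sg_flip simp flip: mult.assoc)
    next
      case (r3 i s t u)
      then obtain x p q v y where c: "c = x @ p # q # v # y" "length x = i"
        using word_at(3)[of i c] vs by auto
      note [simp] = r3(2,3) basic(1) c(1) c(2)[symmetric]
      have p: "p \<in> C" using C by simp
      let ?k = "count_list x p"
      have M: "framed_move a f [(Cross s, ?k), (Cross t, Suc ?k), (Cross u, ?k)] [(Cross u, Suc ?k), (Cross t, ?k), (Cross s, Suc ?k)]"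
        using r3(1) by (auto simp: framed_move_def intro: reidemeister3.intros)
      have "tsum C \<sigma> (\<lambda>r. \<Phi> (r(p := (Cross s, ?k) # (Cross t, Suc (?k)) # (Cross u, ?k) # r p)))
          (x @ p # p # p # y) vs =
        tsum C \<sigma> (\<lambda>r. \<Phi> (r(p := (Cross u, Suc (?k)) # (Cross t, ?k) # (Cross s, Suc (?k)) # r p)))
          (x @ p # p # p # y) vs"
        if "p = q" "q = v" using C vs F'[OF M p] that by (intro tsum_cong) auto
      then show ?thesis
        by (auto simp: tsum_elem)
    qed
  next
    case (curl s)
    from curl(2) show ?thesis
    proof cases
      case (curl_right i)
      then obtain x p y where c: "c = x @ p # y" "length x = i"
        using word_at(1)[of i c] vs by auto
      note [simp] = curl_right c(1) c(2)[symmetric]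
      let ?k = "count_list x p"
      have "framed_move a f [(Cap, Suc ?k), (Cross (\<not> s), ?k), (Cup, Suc ?k)] []"
        unfolding curl(1) by (intro framed_move_curl curl.intros)
      then show ?thesis
        by (intro one_strand[OF _ c(1)]) (auto simp: tsum_elem intro!: sum.cong)
    next
      case (curl_left i)
      then obtain x p y where c: "c = x @ p # y" "length x = i"
        using word_at(1)[of i c] vs by auto
      note [simp] = curl_left c(1) c(2)[symmetric]
      let ?k = "count_list x p"
      have "framed_move a f [(Cap, ?k), (Cross (\<not> s), Suc ?k), (Cup, ?k)] []"
        unfolding curl(1) by (intro framed_move_curl curl.intros)
      then show ?thesis
        by (intro one_strand[OF _ c(1)]) (auto simp: tsum_elem intro!: sum.cong)
    qed
  qed
qed

lemma tsum_framed:
  assumes "framed_move a f l l'" "fam (framed a) C c \<Phi>" "finite C" "set c \<subseteq> C" "\<sigma> * \<sigma> = 1"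
    and "ok (length c) (us @ l @ vs)" "wd (length c) (us @ l @ vs) = 0" "ok (length c) (us @ l' @ vs)"
  shows "tsum C \<sigma> \<Phi> c (us @ l @ vs) = f * tsum C \<sigma> \<Phi> c (us @ l' @ vs)"
proof -
  define R where "R us c \<Phi> \<longleftrightarrow> fam (framed a) C c \<Phi> \<and> set c \<subseteq> C \<and> ok (length c) (us @ l @ vs) \<and>
    wd (length c) (us @ l @ vs) = 0 \<and> ok (length c) (us @ l' @ vs)" for us c \<Phi>
  have "(\<Sum>(\<alpha>, k) \<leftarrow> [(1, l @ vs), (- f, l' @ vs)]. \<alpha> * tsum C \<sigma> \<Phi> c (us @ k)) = 0"
  proof (rule tsum_prefix[where R = R])
    fix c \<Phi> assume "R [] c \<Phi>"
    then show "(\<Sum>(\<alpha>, k) \<leftarrow> [(1, l @ vs), (- f, l' @ vs)]. \<alpha> * tsum C \<sigma> \<Phi> c k) = 0"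
      using tsum_framed_move[OF assms(1), of C c \<Phi> vs \<sigma>] assms by (simp add: R_def)
  next
    fix e us x m y \<Phi> m' oc
    assume R: "R ((e, length x) # us) (x @ m @ y) \<Phi>" and m: "length m = strands_in e" "(m', oc) \<in> outs C e m"
    have mC: "set m \<subseteq> C" using R by (simp add: R_def)
    have "fam (framed a) C (x @ m' @ y) (\<lambda>r. \<Phi> (upd e x oc r))"
      by (rule fam_upd[where P = "framed a", OF _ m(2,1) mC]) (use R in \<open>simp add: R_def\<close>, rule framed_Cons)
    then show "R us (x @ m' @ y) (\<lambda>r. \<Phi> (upd e x oc r))"
      using R m(1) outsD(1,2)[OF m(2,1) mC] by (simp add: R_def add_ac)
  qed (use assms in \<open>auto simp: R_def\<close>)
  then show ?thesis by simp
qed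

lemma framed_tsum:
  "fam (framed a) C [] \<Phi> \<Longrightarrow> finite C \<Longrightarrow> \<sigma> * \<sigma> = 1 \<Longrightarrow> framed a 0 (tsum C \<sigma> \<Phi> [])"
  unfolding framed_def[of a 0] by (intro allI impI tsum_framed) auto

section \<open>Colourings and mixed crossings\<close>

inductive cpath :: "'c list \<Rightarrow> slices \<Rightarrow> 'c list \<Rightarrow> bool" where
  Nil: "cpath c [] c"
| Cons: "length m = strands_in e \<Longrightarrow> (m', oc) \<in> outs UNIV e m \<Longrightarrow> cpath (x @ m' @ y) ws d \<Longrightarrow>
    cpath (x @ m @ y) ((e, length x) # ws) d"

inductive_cases cpath_NilE: "cpath c [] d"
inductive_cases cpath_ConsE: "cpath c ((e, i) # ws) d"

lemma outs_UNIV: "(m', oc) \<in> outs C e m \<Longrightarrow> (m', oc) \<in> outs UNIV e m"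
  by (cases e) (auto split: if_splits)

lemma length_outs: "(m', oc) \<in> outs UNIV e m \<Longrightarrow> length m = strands_in e \<Longrightarrow> length m' = strands_out e"
  using outsD(1) by blast

lemma tsum_nonzero_cpath: "tsum C \<sigma> \<Phi> c ws \<noteq> 0 \<Longrightarrow> ok (length c) ws \<Longrightarrow> cpath c ws []"
proof (induction ws arbitrary: c \<Phi>)
  case Nil
  then show ?case by (auto intro: cpath.Nil split: if_splits)
next
  case (Cons ei ws)
  obtain e i where ei: "ei = (e, i)" by force
  with Cons.prems have "i + strands_in e \<le> length c" by simp
  then obtain x m y where xmy: "c = x @ m @ y" "length x = i" "length m = strands_in e"
    by (rule split_word)
  have ei: "ei = (e, length x)" using ei xmy by simp
  note c = xmy(1,3)
  obtain m' oc where o: "(m', oc) \<in> outs C e m"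
    "tsum C \<sigma> (\<lambda>r. \<Phi> (upd e x oc r)) (x @ m' @ y) ws \<noteq> 0"
    using Cons.prems(1) unfolding ei c(1) tsum_step[OF c(2)]
    by (auto elim!: sum.not_neutral_contains_not_neutral)
  from outs_UNIV[OF o(1)] have oU: "(m', oc) \<in> outs UNIV e m" .
  show ?case
    unfolding ei c(1)
    by (rule cpath.Cons[OF c(2) oU], rule Cons.IH[OF o(2)])
      (use Cons.prems(2) ei c length_outs[OF oU c(2)] in \<open>auto simp: add_ac\<close>)
qed

text \<open>
  The parity of the number of strands coloured \<open>True\<close> by \<open>u\<close> and \<open>b\<close> by \<open>c\<close> is constant along
  a tangle. It shows how a colouring separating the strands of a crossing constrains all others.
\<close>

definition par :: "bool list \<Rightarrow> 'c list \<Rightarrow> bool" where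
  "par u c \<longleftrightarrow> (\<forall>b. even (count_list (zip u c) (True, b)))"

lemma par_Nil [simp]: "par [] []"
  by (simp add: par_def)

text \<open>Maxima and minima create or remove two strands with the same pair of colours, and
  crossings only permute strands.\<close>

lemma par_outs:
  assumes "(k', od) \<in> outs UNIV e k" "(m', oc) \<in> outs UNIV e m" "length k = strands_in e" "length m = strands_in e"
    "length z = length x"
  shows "par (z @ k @ v) (x @ m @ y) \<longleftrightarrow> par (z @ k' @ v) (x @ m' @ y)"
proof -
  have l: "length k' = strands_out e" "length m' = strands_out e"
    using assms length_outs by blast+
  have "even (count_list (zip k m) (True, b)) = even (count_list (zip k' m') (True, b))" for b
    using assms by (cases e) (auto simp: length_2_conv split: if_splits)
  then show ?thesis using assms l by (simp add: par_def)
qed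

lemma par_cpath:
  "cpath u ws [] \<Longrightarrow> cpath d ws [] \<Longrightarrow> length u = length d \<Longrightarrow> par u d"
proof (induction ws arbitrary: u d)
  case Nil
  then show ?case by (auto elim!: cpath_NilE)
next
  case (Cons ei ws)
  obtain e i where ei: "ei = (e, i)" by force
  from Cons.prems(1)[unfolded ei] obtain k k' od z v where u: "u = z @ k @ v" "length z = i" "length k = strands_in e"
    "(k', od) \<in> outs UNIV e k" "cpath (z @ k' @ v) ws []"
    by (rule cpath_ConsE) auto
  from Cons.prems(2)[unfolded ei] obtain m m' oc x y where d: "d = x @ m @ y" "length x = i" "length m = strands_in e"
    "(m', oc) \<in> outs UNIV e m" "cpath (x @ m' @ y) ws []"
    by (rule cpath_ConsE) auto
  have "par (z @ k' @ v) (x @ m' @ y)"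
    using Cons.prems(3) u d length_outs[OF u(4,3)] length_outs[OF d(4,3)] by (intro Cons.IH) auto
  then show ?case
    using par_outs[OF u(4) d(4) u(3) d(3), of z x v y] u d by simp
qed

text \<open>
  Some 2-colouring, starting with \<open>u\<close> above \<open>us\<close>, separates the strands \<open>i\<close> and \<open>i + 1\<close> of a crossing
  between \<open>us\<close> and \<open>vs\<close>.
\<close>

definition sep :: "slices \<Rightarrow> nat \<Rightarrow> slices \<Rightarrow> bool list \<Rightarrow> bool" where
  "sep us i vs u \<longleftrightarrow> (\<exists>x p y. cpath u us (x @ p # (\<not> p) # y) \<and> length x = i \<and> cpath (x @ (\<not> p) # p # y) vs [])"

lemma sep_Cons:
  assumes "sep ((e, i) # us) j vs u"
  obtains z k v k' od where "u = z @ k @ v" "length z = i" "length k = strands_in e"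
    "(k', od) \<in> outs UNIV e k" "sep us j vs (z @ k' @ v)"
  using assms unfolding sep_def by (elim exE conjE cpath_ConsE) blast

lemma sep_Nil:
  fixes c :: "'c list"
  assumes "sep [] i vs u" "length u = length c" "par u c"
  obtains x0 p0 y0 x p q y where "u = x0 @ p0 # (\<not> p0) # y0" "c = x @ p # q # y" "length x = i" "length x0 = i"
    "length y0 = length y" "cpath (x0 @ (\<not> p0) # p0 # y0) vs []"
    "\<And>d :: 'c list. length d = length c \<Longrightarrow> cpath d vs [] \<Longrightarrow> par (x0 @ (\<not> p0) # p0 # y0) d"
proof -
  obtain x0 p0 y0 where u: "u = x0 @ p0 # (\<not> p0) # y0" "length x0 = i" "cpath (x0 @ (\<not> p0) # p0 # y0) vs []"
    using assms(1) by (auto simp: sep_def elim!: cpath_NilE)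
  obtain x p q y where "c = x @ p # q # y" "length x = i"
    using word_at(2)[of i c] u assms(2) by auto
  then show ?thesis
    using u assms(2) by (intro that[of x0 p0 y0 x p q y]) (auto intro!: par_cpath[OF u(3)])
qed

text \<open>Strands away from the crossing count alike above and below it. Of the two strands at the
  crossing, exactly one is coloured \<open>True\<close> by the separating colouring, on opposite
  sides above and below, so its two colours must match.\<close>

lemma par_swap:
  assumes "par (x0 @ p0 # (\<not> p0) # y0) (x @ p # q # y)" "par (x0 @ (\<not> p0) # p0 # y0) (x @ p' # q' # y)"
    "length x0 = length x"
  shows "if p0 then p = q' else q = p'"
proof -
  have *: "even (a + b + c) \<Longrightarrow> even (a + b' + c) \<Longrightarrow> even (b + b')" for a b b' c :: nat
    by presburger
  have e: "count_list (zip (x0 @ a # a' # y0) (x @ r # s # y)) z =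
      count_list (zip x0 x) z + count_list [(a, r), (a', s)] z + count_list (zip y0 y) z" for a a' r s z
    using assms(3) by simp
  have ev: "even (count_list [(p0, p), (\<not> p0, q)] (True, b) + count_list [(\<not> p0, p'), (p0, q')] (True, b))" for b
    using assms(1,2)[unfolded par_def, rule_format, of b] unfolding e by (rule *)
  show ?thesis
    using ev[of p] ev[of q] by (cases p0) (auto split: if_splits)
qed

lemma skein_Cons:
  assumes "skein w m X" "i + strands_in e \<le> m"
  shows "skein w (m - strands_in e + strands_out e) (\<lambda>s. X ((e, i) # s))"
  unfolding skein_def
proof (intro allI impI)
  fix us j vs
  let ?m = "m - strands_in e + strands_out e"
  assume "ok ?m (us @ (Cross True, j) # vs)" "wd ?m (us @ (Cross True, j) # vs) = 0"
  then show "X ((e, i) # us @ (Cross True, j) # vs) + X ((e, i) # us @ (Cross False, j) # vs) =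
      w * (X ((e, i) # us @ (Cup, j) # (Cap, j) # vs) + X ((e, i) # us @ vs))"
    using assms(1)[unfolded skein_def, rule_format, of "(e, i) # us" j vs] assms(2) by auto
qed

text \<open>Smoothing a mixed crossing merges two components, so both arcs of a smoothing must
  receive one colour. The first claim says this for the vertical smoothing, the second for the
  horizontal one, with a minimum of colour \<open>p\<close> above a maximum of colour
  \<open>b\<close>.\<close>

lemma sep_zero:
  fixes x y :: "'c :: linorder list"
  assumes "par (x0 @ p0 # (\<not> p0) # y0) (x @ p # q # y)" "length x0 = length x"
    "\<And>d :: 'c list. length d = length (x @ p # q # y) \<Longrightarrow> cpath d vs [] \<Longrightarrow> par (x0 @ (\<not> p0) # p0 # y0) d"
    "ok (length (x @ p # q # y)) vs"
  shows "p \<noteq> q \<Longrightarrow> tsum C \<sigma> \<Phi> (x @ p # q # y) vs = 0"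
    and "p = q \<Longrightarrow> b \<noteq> p \<Longrightarrow> tsum C \<sigma> \<Phi> (x @ b # b # y) vs = 0"
proof -
  have *: "if p0 then p = q' else q = p'" if "tsum C \<sigma> \<Phi> (x @ p' # q' # y) vs \<noteq> 0" for p' q'
  proof (rule par_swap[OF assms(1)])
    have "cpath (x @ p' # q' # y) vs []"
      using tsum_nonzero_cpath[OF that] assms(4) by simp
    then show "par (x0 @ (\<not> p0) # p0 # y0) (x @ p' # q' # y)"
      using assms(3)[of "x @ p' # q' # y"] by simp
  qed (use assms(2) in simp)
  show "p \<noteq> q \<Longrightarrow> tsum C \<sigma> \<Phi> (x @ p # q # y) vs = 0"
    and "p = q \<Longrightarrow> b \<noteq> p \<Longrightarrow> tsum C \<sigma> \<Phi> (x @ b # b # y) vs = 0"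
    using *[of p q] *[of b b] by (metis (full_types))+
qed

lemma tsum_skein_base:
  fixes c :: "'c :: linorder list"
  assumes sep: "sep [] i vs u" and u: "length u = length c" "par u c"
    and F: "fam (skein w) C c \<Phi>" and C: "finite C" "set c \<subseteq> C"
    and vs: "ok (length c) ((Cross True, i) # vs)" "wd (length c) ((Cross True, i) # vs) = 0"
  shows "tsum C (- 1) \<Phi> c ((Cross True, i) # vs) + tsum C (- 1) \<Phi> c ((Cross False, i) # vs) =
    w * (tsum C (- 1) \<Phi> c ((Cup, i) # (Cap, i) # vs) + tsum C (- 1) \<Phi> c vs)"
proof -
  from sep_Nil[OF sep u] obtain x0 p0 y0 x p q y where
    c: "u = x0 @ p0 # (\<not> p0) # y0" "c = x @ p # q # y" "length x = i" "length x0 = i" "length y0 = length y"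
      "cpath (x0 @ (\<not> p0) # p0 # y0) vs []"
    and *: "\<And>d :: 'c list. length d = length c \<Longrightarrow> cpath d vs [] \<Longrightarrow> par (x0 @ (\<not> p0) # p0 # y0) d" by blast
  have zero: "p \<noteq> q \<Longrightarrow> tsum C (- 1) \<Psi> (x @ p # q # y) vs = 0"
     "p = q \<Longrightarrow> b \<noteq> p \<Longrightarrow> tsum C (- 1) \<Psi> (x @ b # b # y) vs = 0" for b \<Psi>
    using sep_zero(1)[of x0 p0 y0 x p q y vs C "- 1" \<Psi>] sep_zero(2)[of x0 p0 y0 x p q y vs b C "- 1" \<Psi>]
      u c * vs by auto
  show ?thesis
  \<comment> \<open>For different colours exactly one of the two crossings has the smaller colour on
    top, so with \<sigma> = -1 they cancel, and both smoothings contribute 0. For equal colours the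
    relation is that of \<Phi> in colour \<open>p\<close>.\<close>
  proof (cases "p = q")
    case False
    then show ?thesis
      using zero(1)[of \<Phi>] by (auto simp: c(2) tsum_elem sg_def simp flip: c(3))
  next
    case True
    define k where "k = count_list x p"
    define T where "T = (\<lambda>v. tsum C (- 1) (\<lambda>r. \<Phi> (r(p := v @ r p))) c vs)"
    have p: "p \<in> C" using C c by simp
    have vs': "ok (length c) vs" "wd (length c) vs = 0" using vs c by auto
    have "T [(Cross True, k)] + T [(Cross False, k)] = w * (T [(Cup, k), (Cap, k)] + T [])"
    proof -
      have "1 * T [(Cross True, k)] + 1 * T [(Cross False, k)] = w * T [(Cup, k), (Cap, k)] + w * T []"
        unfolding T_def tsum_linear[symmetric]
      proof (rule tsum_cong[OF _ vs' C(2)])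
        fix r assume r: "valid_fam C c r"
        have "skein w (count_list c p) (\<lambda>s. \<Phi> (r(p := s)))"
          using F r p by (simp add: fam_def)
        from this[unfolded skein_def, rule_format, of "[]" k "r p"]
          r[unfolded valid_fam_def, rule_format, OF p]
        show "1 * \<Phi> (r(p := [(Cross True, k)] @ r p)) + 1 * \<Phi> (r(p := [(Cross False, k)] @ r p)) =
            w * \<Phi> (r(p := [(Cup, k), (Cap, k)] @ r p)) + w * \<Phi> (r(p := [] @ r p))"
          using True by (simp add: k_def c(2) distrib_left)
      qed
      then show ?thesis by (simp add: distrib_left)
    qed
    moreover have "tsum C (- 1) \<Phi> c ((Cross s, i) # vs) = T [(Cross s, k)]" for s
      using True by (simp add: c(2) tsum_elem T_def k_def flip: c(3))
    moreover have "tsum C (- 1) \<Phi> c vs = T []"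
      by (simp add: T_def)
    moreover have "tsum C (- 1) \<Phi> c ((Cup, i) # (Cap, i) # vs) = T [(Cup, k), (Cap, k)]"
    proof -
      have "tsum C (- 1) \<Phi> c ((Cup, i) # (Cap, i) # vs) =
          (\<Sum>b \<in> C. if b = p then T [(Cup, k), (Cap, k)] else 0)"
        using True zero(2) by (auto simp: c(2) tsum_elem T_def k_def simp flip: c(3) intro!: sum.cong)
      then show ?thesis using C p by simp
    qed
    ultimately show ?thesis by simp
  qed
qed

text \<open>The form of \<open>sep\<close> that travels down \<open>us\<close> along with an
  arbitrary colour word: at each slice the separating colouring makes its own choice and
  \<open>par\<close> is kept. At the top both words are empty.\<close>

definition separable :: "nat \<Rightarrow> slices \<Rightarrow> slices \<Rightarrow> 'c list \<Rightarrow> bool" where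
  "separable i vs us c \<longleftrightarrow> (\<exists>u. sep us i vs u \<and> length u = length c \<and> par u c)"

lemma separable_step:
  assumes "separable i vs ((e, length x) # us) (x @ m @ y)" "length m = strands_in e" "(m', oc) \<in> outs C e m"
  shows "separable i vs us (x @ m' @ y)"
proof -
  from assms(1) obtain u where u: "sep ((e, length x) # us) i vs u" "length u = length (x @ m @ y)" "par u (x @ m @ y)"
    by (auto simp: separable_def)
  from sep_Cons[OF u(1)] obtain z k v k' od where z: "u = z @ k @ v" "length z = length x" "length k = strands_in e"
    "(k', od) \<in> outs UNIV e k" "sep us i vs (z @ k' @ v)" by metis
  note o = outs_UNIV[OF assms(3)]
  have "par (z @ k' @ v) (x @ m' @ y)"
    using par_outs[OF z(4) o z(3) assms(2) z(2), of v y] u z by simp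
  then show ?thesis
    using z u assms(2) length_outs[OF z(4,3)] length_outs[OF o assms(2)] unfolding separable_def
    by (intro exI[of _ "z @ k' @ v"]) auto
qed

lemma tsum_skein:
  assumes sep: "separable i vs us c"
    and F: "fam (skein w) C c \<Phi>" and C: "finite C" "set c \<subseteq> C"
    and vs: "ok (length c) (us @ (Cross True, i) # vs)" "wd (length c) (us @ (Cross True, i) # vs) = 0"
  shows "tsum C (- 1) \<Phi> c (us @ (Cross True, i) # vs) + tsum C (- 1) \<Phi> c (us @ (Cross False, i) # vs) =
    w * (tsum C (- 1) \<Phi> c (us @ (Cup, i) # (Cap, i) # vs) + tsum C (- 1) \<Phi> c (us @ vs))"
proof -
  define R where "R us c \<Phi> \<longleftrightarrow> separable i vs us c \<and> fam (skein w) C c \<Phi> \<and> set c \<subseteq> C \<and>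
    ok (length c) (us @ (Cross True, i) # vs) \<and> wd (length c) (us @ (Cross True, i) # vs) = 0" for us c \<Phi>
  let ?ls = "[(1, (Cross True, i) # vs), (1, (Cross False, i) # vs), (- w, (Cup, i) # (Cap, i) # vs), (- w, vs)]"
  have "(\<Sum>(\<alpha>, k) \<leftarrow> ?ls. \<alpha> * tsum C (- 1) \<Phi> c (us @ k)) = 0"
  proof (rule tsum_prefix[where R = R])
    fix c \<Phi> assume "R [] c \<Phi>"
    then show "(\<Sum>(\<alpha>, k) \<leftarrow> ?ls. \<alpha> * tsum C (- 1) \<Phi> c k) = 0"
      using tsum_skein_base[of i vs _ c w C \<Phi>] C(1) by (auto simp: R_def separable_def algebra_simps)
  next
    fix e us x m y \<Phi> m' oc
    assume R: "R ((e, length x) # us) (x @ m @ y) \<Phi>" and m: "length m = strands_in e" "(m', oc) \<in> outs C e m"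
    have mC: "set m \<subseteq> C" using R by (simp add: R_def)
    have "fam (skein w) C (x @ m' @ y) (\<lambda>r. \<Phi> (upd e x oc r))"
      by (rule fam_upd[where P = "skein w", OF _ m(2,1) mC]) (use R in \<open>simp add: R_def\<close>, rule skein_Cons)
    moreover have "separable i vs us (x @ m' @ y)"
      using R m by (intro separable_step[of i vs e x us m y]) (auto simp: R_def)
    ultimately show "R us (x @ m' @ y) (\<lambda>r. \<Phi> (upd e x oc r))"
      using R m(1) outsD(1,2)[OF m(2,1) mC] by (auto simp: R_def add_ac)
  qed (use assms in \<open>auto simp: R_def\<close>)
  then show ?thesis by (simp add: algebra_simps)
qed

section \<open>The number of 2-colourings\<close>

text \<open>Equal to 2^c for c components. Using it in place of c makes isotopy invariance a case of
  \<open>framed_tsum\<close>.\<close>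

definition cnt :: "bool list \<Rightarrow> slices \<Rightarrow> real" where
  "cnt = tsum UNIV 1 (\<lambda>_. 1)"

lemma coef_1 [simp]: "coef 1 e m = 1"
  by (cases e) auto

lemma cnt_step:
  "length m = strands_in e \<Longrightarrow> cnt (x @ m @ y) ((e, length x) # ws) = (\<Sum>(m', oc) \<in> outs UNIV e m. cnt (x @ m' @ y) ws)"
  unfolding cnt_def by (subst tsum_step) auto

lemma cnt_Nil [simp]: "cnt c [] = (if c = [] then 1 else 0)"
  by (simp add: cnt_def)

lemma cnt_elem:
  "cnt (x @ y) ((Cap, length x) # ws) = (\<Sum>b \<in> UNIV. cnt (x @ b # b # y) ws)"
  "cnt (x @ p # q # y) ((Cup, length x) # ws) = (if p = q then cnt (x @ y) ws else 0)"
  "cnt (x @ p # q # y) ((Cross s, length x) # ws) = cnt (x @ q # p # y) ws"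
  by (auto simp: cnt_def tsum_elem sg_def)

lemma cnt_framed: "framed 1 0 (cnt [])"
  unfolding cnt_def by (rule framed_tsum) (auto simp: fam_def framed_def framed_move_def)

lemma cnt_smoothings:
  assumes "separable i vs us (c :: bool list)" "ok (length c) (us @ (Cross True, i) # vs)"
  shows "cnt c (us @ (Cup, i) # (Cap, i) # vs) = cnt c (us @ vs)"
proof -
  define R where "R us (c :: bool list) (\<Phi> :: (bool \<Rightarrow> slices) \<Rightarrow> real) \<longleftrightarrow> \<Phi> = (\<lambda>_. 1) \<and> separable i vs us c \<and>
    ok (length c) (us @ (Cross True, i) # vs)" for us c \<Phi>
  let ?ls = "[(1, (Cup, i) # (Cap, i) # vs), (- 1, vs)]"
  have "(\<Sum>(\<alpha>, k) \<leftarrow> ?ls. \<alpha> * tsum UNIV 1 (\<lambda>_. 1) c (us @ k)) = 0"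
  proof (rule tsum_prefix[where R = R])
    fix c \<Phi> assume R: "R [] c \<Phi>"
    then obtain u where u: "sep [] i vs u" "length u = length c" "par u c"
      by (auto simp: R_def separable_def)
    from sep_Nil[OF u] obtain x0 p0 y0 x p q y where
      c: "u = x0 @ p0 # (\<not> p0) # y0" "c = x @ p # q # y" "length x = i" "length x0 = i" "length y0 = length y"
      "cpath (x0 @ (\<not> p0) # p0 # y0) vs []"
      and *: "\<And>d :: bool list. length d = length c \<Longrightarrow> cpath d vs [] \<Longrightarrow> par (x0 @ (\<not> p0) # p0 # y0) d" by blast
    have ok: "ok (length c) vs" using R c by (simp add: R_def)
    have zero: "cnt (x @ p # q # y) vs = 0" if "p \<noteq> q"
      unfolding cnt_def by (rule sep_zero(1)[of x0 p0 y0 x p q y]) (use u c * ok that in auto)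
    have zero': "cnt (x @ (\<not> p) # (\<not> p) # y) vs = 0" if "p = q"
      unfolding cnt_def by (rule sep_zero(2)[of x0 p0 y0 x p q y]) (use u c * ok that in auto)
    have "cnt c ((Cup, i) # (Cap, i) # vs) = (if p = q then cnt (x @ p # p # y) vs + cnt (x @ (\<not> p) # (\<not> p) # y) vs else 0)"
      unfolding c(2) c(3)[symmetric] by (cases p) (simp_all add: cnt_elem UNIV_bool)
    also have "\<dots> = cnt c vs"
      using zero zero' by (auto simp: c(2))
    finally show "(\<Sum>(\<alpha>, k) \<leftarrow> ?ls. \<alpha> * tsum UNIV 1 \<Phi> c k) = 0"
      using R by (simp add: R_def cnt_def)
  next
    fix e us x m y and \<Phi> :: "(bool \<Rightarrow> slices) \<Rightarrow> real" and m' oc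
    assume R: "R ((e, length x) # us) (x @ m @ y) \<Phi>" and m: "length m = strands_in e" "(m', oc) \<in> outs UNIV e m"
    then show "R us (x @ m' @ y) (\<lambda>r. \<Phi> (upd e x oc r))"
      using length_outs[OF m(2,1)] separable_step[of i vs e x us m y m' oc UNIV] by (auto simp: R_def add_ac)
  qed (use assms in \<open>auto simp: R_def\<close>)
  then show ?thesis by (simp add: cnt_def)
qed

text \<open>Addition over Z/2, under which the 2-colourings of a closed diagram form a vector
  space.\<close>

definition xorw :: "bool list \<Rightarrow> bool list \<Rightarrow> bool list" where
  "xorw = map2 (\<noteq>)"

lemma xorw_simps [simp]:
  "xorw [] [] = []" "xorw (p # c) (q # u) = (p \<noteq> q) # xorw c u" "length (xorw c u) = min (length c) (length u)"
  "length x = length z \<Longrightarrow> xorw (x @ y) (z @ v) = xorw x z @ xorw y v"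
  by (simp_all add: xorw_def)

lemma sum_outs_xorw:
  assumes "length m = strands_in e" "length k = strands_in e" "(k', od) \<in> outs UNIV e k"
  shows "(\<Sum>(m', oc) \<in> outs UNIV e (xorw m k). f m') = (\<Sum>(m', oc) \<in> outs UNIV e m. f (xorw m' k'))"
    (is "?L = ?R")
proof (cases e)
  case Cap
  have "inj (\<lambda>b. ([b, b], Some b))" by (auto simp: inj_on_def)
  then show ?thesis using Cap assms by (auto simp: sum.reindex UNIV_bool add.commute)
qed (use assms in \<open>auto simp: length_2_conv split: if_splits\<close>)

text \<open>Adding the fixed colouring that starts with \<open>u\<close> is a bijection between the
  colourings from \<open>c\<close> and those from \<open>xorw c u\<close>.\<close>

lemma cnt_xorw: "cpath u ws [] \<Longrightarrow> length c = length u \<Longrightarrow> cnt (xorw c u) ws = cnt c ws"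
proof (induction ws arbitrary: u c)
  case Nil
  then show ?case by (auto elim!: cpath_NilE)
next
  case (Cons ei ws)
  obtain e i where ei: "ei = (e, i)" by force
  from Cons.prems(1)[unfolded ei] obtain k k' od z v where u: "u = z @ k @ v" "length z = i" "length k = strands_in e"
    "(k', od) \<in> outs UNIV e k" "cpath (z @ k' @ v) ws []"
    by (rule cpath_ConsE) auto
  have "i + strands_in e \<le> length c" using Cons.prems(2) u by simp
  then obtain x m y where c: "c = x @ m @ y" "length x = i" "length m = strands_in e"
    by (rule split_word)
  have ly: "length y = length v" using Cons.prems(2) c u by simp
  have xw: "xorw c u = xorw x z @ xorw m k @ xorw y v"
    unfolding c(1) u(1) using c(2,3) u(2,3) ly by simp
  have li: "length (xorw x z) = i" using c(2) u(2) by simp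
  have lm: "length (xorw m k) = strands_in e" using c(3) u(3) by simp
  have "cnt (xorw c u) ((e, i) # ws) = (\<Sum>(m', oc) \<in> outs UNIV e (xorw m k). cnt (xorw x z @ m' @ xorw y v) ws)"
    unfolding xw using cnt_step[OF lm, of "xorw x z" "xorw y v" ws] unfolding li .
  also have "\<dots> = (\<Sum>(m', oc) \<in> outs UNIV e m. cnt (xorw x z @ xorw m' k' @ xorw y v) ws)"
    by (rule sum_outs_xorw[OF c(3) u(3,4)])
  also have "\<dots> = (\<Sum>(m', oc) \<in> outs UNIV e m. cnt (x @ m' @ y) ws)"
  proof (intro sum.cong HOL.refl, clarify)
    fix m' oc assume o: "(m', oc) \<in> outs UNIV e m"
    have l: "length m' = length k'" "length x = length z"
      using length_outs[OF o c(3)] length_outs[OF u(4,3)] c(2) u(2) by simp_all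
    have "cnt (xorw (x @ m' @ y) (z @ k' @ v)) ws = cnt (x @ m' @ y) ws"
      by (rule Cons.IH[OF u(5)]) (use l ly in simp)
    then show "cnt (xorw x z @ xorw m' k' @ xorw y v) ws = cnt (x @ m' @ y) ws"
      using l by simp
  qed
  also have "\<dots> = cnt c ((e, i) # ws)"
    using cnt_step[OF c(3), of x y ws] unfolding c(1,2) by simp
  finally show ?case by (simp add: ei)
qed

lemma par_xorw: "length u = length c \<Longrightarrow> par u c \<Longrightarrow> par u (xorw c u)"
proof -
  assume "length u = length c"
  hence "count_list (zip u (xorw c u)) (True, b) = count_list (zip u c) (True, \<not> b)" for b
    by (induction u c rule: list_induct2) auto
  then show "par u c \<Longrightarrow> par u (xorw c u)" by (simp add: par_def)
qed

text \<open>
  Adding the separating colouring exchanges the colourings that agree at the crossing with those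
  that differ there.
\<close>

lemma cnt_cross_aux:
  assumes "sep us i vs u" "length u = length c" "par u c" "ok (length c) (us @ (Cross s, i) # vs)"
  shows "cnt c (us @ (Cross s, i) # vs) = cnt c (us @ vs) + cnt (xorw c u) (us @ vs)"
  using assms
proof (induction us arbitrary: c u)
  case Nil
  from sep_Nil[OF Nil(1-3)] obtain x0 p0 y0 x p q y where
    c: "u = x0 @ p0 # (\<not> p0) # y0" "c = x @ p # q # y" "length x = i" "length x0 = i" "length y0 = length y"
      "cpath (x0 @ (\<not> p0) # p0 # y0) vs []"
    and *: "\<And>d :: bool list. length d = length c \<Longrightarrow> cpath d vs [] \<Longrightarrow> par (x0 @ (\<not> p0) # p0 # y0) d" by blast
  have ok: "ok (length c) vs" using Nil(4) c by simp
  have L: "cnt c ((Cross s, i) # vs) = cnt (x @ q # p # y) vs"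
    using cnt_elem(3)[of x p q y s vs] c by simp
  have w: "xorw c u = xorw x x0 @ (p \<noteq> p0) # (q \<noteq> (\<not> p0)) # xorw y y0" "length (xorw c u) = length c"
    using c by auto
  show ?case
  proof (cases "p = q")
    case True
    have pw: "par (x0 @ p0 # (\<not> p0) # y0) (xorw x x0 @ (p \<noteq> p0) # (q \<noteq> (\<not> p0)) # xorw y y0)"
      using par_xorw[OF Nil(2,3)] w(1) c(1) by (simp only:)
    have l: "length (xorw x x0 @ (p \<noteq> p0) # (q \<noteq> (\<not> p0)) # xorw y y0) = length c"
      using c(2-5) by simp
    have "cnt (xorw c u) vs = 0"
      unfolding w(1) cnt_def
    proof (rule sep_zero(1)[OF pw])
      show "(p \<noteq> p0) \<noteq> (q \<noteq> (\<not> p0))" using True by simp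
    qed (unfold l, use c(3,4) ok in simp_all, rule *, simp_all)
    then show ?thesis using True L c by simp
  next
    case False
    have "cnt c vs = 0"
      unfolding c(2) cnt_def
    proof (rule sep_zero(1)[OF Nil(3)[unfolded c(1,2)]])
      show "par (x0 @ (\<not> p0) # p0 # y0) d" if "length d = length (x @ p # q # y)" "cpath d vs []" for d :: "bool list"
        using * that c(2) by simp
    qed (use c(2-4) ok False in simp_all)
    moreover have xx: "length a = length b \<Longrightarrow> xorw (xorw a b) b = a" for a b
      by (induction a b rule: list_induct2) auto
    \<comment> \<open>Adding the part of the separating colouring below the crossing turns
      \<open>xorw c u\<close> into \<open>c\<close> with the two letters at the crossing
      exchanged.\<close>
    have "cnt (xorw c u) vs = cnt (xorw (xorw c u) (x0 @ (\<not> p0) # p0 # y0)) vs"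
      by (rule cnt_xorw[symmetric, OF c(6)]) (use c w in simp)
    moreover have "xorw (xorw c u) (x0 @ (\<not> p0) # p0 # y0) = x @ q # p # y"
      unfolding w(1) using c(3-5) False xx[of x x0] xx[of y y0] by auto
    ultimately show ?thesis using L by simp
  qed
next
  case (Cons ei us)
  obtain e j where ei: "ei = (e, j)" by force
  from sep_Cons[OF Cons.prems(1)[unfolded ei]] obtain z k v k' od where
    u: "u = z @ k @ v" "length z = j" "length k = strands_in e"
    "(k', od) \<in> outs UNIV e k" "sep us i vs (z @ k' @ v)" by metis
  have "j + strands_in e \<le> length c" using Cons.prems(2) u by simp
  then obtain x m y where c: "c = x @ m @ y" "length x = j" "length m = strands_in e"
    by (rule split_word)
  have ly: "length y = length v" using Cons.prems(2) c u by simp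
  have xw: "xorw c u = xorw x z @ xorw m k @ xorw y v"
    unfolding c(1) u(1) using c(2,3) u(2,3) ly by simp
  have li: "length (xorw x z) = j" using c(2) u(2) by simp
  have lm: "length (xorw m k) = strands_in e" using c(3) u(3) by simp
  have step: "cnt c ((e, j) # ws) = (\<Sum>(m', oc) \<in> outs UNIV e m. cnt (x @ m' @ y) ws)" for ws
    using cnt_step[OF c(3), of x y ws] unfolding c(1,2) by simp
  have "cnt c ((e, j) # us @ (Cross s, i) # vs) = (\<Sum>(m', oc) \<in> outs UNIV e m.
      cnt (x @ m' @ y) (us @ vs) + cnt (xorw x z @ xorw m' k' @ xorw y v) (us @ vs))"
    unfolding step
  proof (intro sum.cong HOL.refl, clarify)
    fix m' oc assume o: "(m', oc) \<in> outs UNIV e m"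
    have l: "length m' = length k'" "length x = length z" "length m' = strands_out e"
      using length_outs[OF o c(3)] length_outs[OF u(4,3)] c(2) u(2) by simp_all
    have par: "par (z @ k' @ v) (x @ m' @ y)"
      using par_outs[OF u(4) o u(3) c(3), of z x v y] Cons.prems(3) c(1) u(1) l by simp
    have "cnt (x @ m' @ y) (us @ (Cross s, i) # vs) =
        cnt (x @ m' @ y) (us @ vs) + cnt (xorw (x @ m' @ y) (z @ k' @ v)) (us @ vs)"
      by (rule Cons.IH[OF u(5) _ par]) (use l ly Cons.prems(4) c(1,3) ei in \<open>auto simp: add_ac\<close>)
    then show "cnt (x @ m' @ y) (us @ (Cross s, i) # vs) =
        cnt (x @ m' @ y) (us @ vs) + cnt (xorw x z @ xorw m' k' @ xorw y v) (us @ vs)"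
      using l by simp
  qed
  also have "\<dots> = (\<Sum>(m', oc) \<in> outs UNIV e m. cnt (x @ m' @ y) (us @ vs)) +
      (\<Sum>(m', oc) \<in> outs UNIV e m. cnt (xorw x z @ xorw m' k' @ xorw y v) (us @ vs))"
    by (simp add: case_prod_unfold sum.distrib)
  also have "(\<Sum>(m', oc) \<in> outs UNIV e m. cnt (xorw x z @ xorw m' k' @ xorw y v) (us @ vs)) =
      (\<Sum>(m', oc) \<in> outs UNIV e (xorw m k). cnt (xorw x z @ m' @ xorw y v) (us @ vs))"
    by (rule sum_outs_xorw[OF c(3) u(3,4), symmetric])
  also have "\<dots> = cnt (xorw c u) ((e, j) # us @ vs)"
    unfolding xw using cnt_step[OF lm, of "xorw x z" "xorw y v" "us @ vs"] unfolding li by simp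
  also have "(\<Sum>(m', oc) \<in> outs UNIV e m. cnt (x @ m' @ y) (us @ vs)) = cnt c ((e, j) # us @ vs)"
    by (rule step[symmetric])
  finally show ?case by (simp add: ei)
qed

section \<open>Colourings as sequences of words, indexed like the points of a diagram\<close>

definition step :: "elem \<times> nat \<Rightarrow> 'c list \<Rightarrow> 'c list \<Rightarrow> bool" where
  "step ei c d \<longleftrightarrow> (\<exists>x m m' oc y. c = x @ m @ y \<and> d = x @ m' @ y \<and> length x = snd ei \<and>
     length m = strands_in (fst ei) \<and> (m', oc) \<in> outs UNIV (fst ei) m)"

text \<open>\<open>W k\<close> lists the colours on the horizontal line just above slice \<open>k\<close>.\<close>

definition colouring :: "slices \<Rightarrow> (nat \<Rightarrow> 'c list) \<Rightarrow> bool" where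
  "colouring ws W \<longleftrightarrow> (\<forall>k < length ws. step (ws ! k) (W k) (W (Suc k)))"

lemma colouring_append:
  assumes "colouring us W" "colouring vs V" "W (length us) = V 0"
  shows "colouring (us @ vs) (\<lambda>k. if k \<le> length us then W k else V (k - length us))"
  unfolding colouring_def
proof (intro allI impI)
  fix k assume k: "k < length (us @ vs)"
  show "step ((us @ vs) ! k) (if k \<le> length us then W k else V (k - length us))
      (if Suc k \<le> length us then W (Suc k) else V (Suc k - length us))"
  proof (cases "k < length us")
    case False
    then have "step (vs ! (k - length us)) (V (k - length us)) (V (Suc (k - length us)))"
      using k assms(2) by (auto simp: colouring_def)
    moreover have "(if k \<le> length us then W k else V (k - length us)) = V (k - length us)"
      using False assms(3) by auto
    ultimately show ?thesis using False by (simp add: nth_append Suc_diff_le)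
  qed (use assms(1) in \<open>auto simp: nth_append colouring_def\<close>)
qed

lemma cpath_colouring: "cpath c ws d \<Longrightarrow> \<exists>W. colouring ws W \<and> W 0 = c \<and> W (length ws) = d"
proof (induction rule: cpath.induct)
  case (Nil c)
  then show ?case by (intro exI[of _ "\<lambda>_. c"]) (simp add: colouring_def)
next
  case (Cons m e m' oc x y ws d)
  then obtain W where W: "colouring ws W" "W 0 = x @ m' @ y" "W (length ws) = d" by blast
  have "step (e, length x) (x @ m @ y) (W 0)"
    using Cons.hyps W(2) unfolding step_def
    by (intro exI[of _ x] exI[of _ m] exI[of _ m'] exI[of _ oc] exI[of _ y]) auto
  then show ?case using W
    by (intro exI[of _ "\<lambda>k. case k of 0 \<Rightarrow> x @ m @ y | Suc k \<Rightarrow> W k"])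
      (auto simp: colouring_def less_Suc_eq_0_disj)
qed

lemma colouring_cpath: "colouring ws W \<Longrightarrow> cpath (W 0) ws (W (length ws))"
proof (induction ws arbitrary: W)
  case Nil
  then show ?case by (simp add: cpath.Nil)
next
  case (Cons ei ws)
  have "colouring ws (\<lambda>k. W (Suc k))"
    using Cons.prems by (auto simp: colouring_def)
  from Cons.IH[OF this] have c: "cpath (W (Suc 0)) ws (W (length (ei # ws)))" by simp
  have "step ei (W 0) (W (Suc 0))"
    using Cons.prems by (auto simp: colouring_def)
  then obtain x m m' oc y where "W 0 = x @ m @ y" "W (Suc 0) = x @ m' @ y" "length x = snd ei"
     "length m = strands_in (fst ei)" "(m', oc) \<in> outs UNIV (fst ei) m"
    unfolding step_def by blast
  then show ?case
    using cpath.Cons[of m "fst ei" m' oc x y ws "W (length (ei # ws))"] c by simp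
qed

lemma colouring_take: "colouring (us @ vs) W \<Longrightarrow> colouring us W"
  and colouring_drop: "colouring (us @ vs) W \<Longrightarrow> colouring vs (\<lambda>k. W (length us + k))"
proof -
  show "colouring (us @ vs) W \<Longrightarrow> colouring us W"
    unfolding colouring_def
  proof (intro allI impI)
    fix k assume W: "\<forall>k < length (us @ vs). step ((us @ vs) ! k) (W k) (W (Suc k))" and "k < length us"
    then show "step (us ! k) (W k) (W (Suc k))"
      using W[rule_format, of k] by (simp add: nth_append)
  qed
  assume W: "colouring (us @ vs) W"
  show "colouring vs (\<lambda>k. W (length us + k))"
    unfolding colouring_def
  proof (intro allI impI)
    fix k assume "k < length vs"
    then show "step (vs ! k) (W (length us + k)) (W (length us + Suc k))"
      using W[unfolded colouring_def, rule_format, of "length us + k"] by simp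
  qed
qed

lemma cpath_append: "cpath c us d \<Longrightarrow> cpath d vs d' \<Longrightarrow> cpath c (us @ vs) d'"
  by (induction rule: cpath.induct) (auto intro: cpath.Cons)

lemma cpath_appendD: "cpath c (us @ vs) d' \<Longrightarrow> \<exists>d. cpath c us d \<and> cpath d vs d'"
proof (induction us arbitrary: c)
  case Nil
  then show ?case by (auto intro: cpath.Nil)
next
  case (Cons ei us)
  obtain e i where ei: "ei = (e, i)" by force
  from Cons.prems[unfolded ei append_Cons] obtain m m' oc x y where "c = x @ m @ y" "i = length x"
    "length m = strands_in e" "(m', oc) \<in> outs UNIV e m" "cpath (x @ m' @ y) (us @ vs) d'"
    by (rule cpath_ConsE) auto
  with Cons.IH[of "x @ m' @ y"] show ?case
    unfolding ei by (auto intro: cpath.Cons)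
qed

lemma length_cpath: "cpath c ws d \<Longrightarrow> ok (length c) ws \<and> length d = wd (length c) ws"
  by (induction rule: cpath.induct) (auto dest: length_outs simp: add_ac)

lemma length_colouring:
  assumes "colouring ws W" "W 0 = []" "k \<le> length ws"
  shows "length (W k) = width (take k ws)"
proof -
  have "colouring (take k ws) W"
    using colouring_take[of "take k ws" "drop k ws"] assms(1) by simp
  from length_cpath[OF colouring_cpath[OF this]] assms(2,3) show ?thesis
    by (simp add: width_eq_wd min_absorb2)
qed

section \<open>Colourings and components\<close>

lemma joined_colouring:
  assumes "joined ws a b" "colouring ws W"
  shows "W (fst a) ! snd a = W (fst b) ! snd b"
proof -
  have st: "\<exists>x m m' oc y. W k = x @ m @ y \<and> W (Suc k) = x @ m' @ y \<and> length x = i \<and>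
     length m = strands_in e \<and> (m', oc) \<in> outs UNIV e m" if "k < length ws" "ws ! k = (e, i)" for k e i
    using assms(2)[unfolded colouring_def, rule_format, OF that(1)] that(2) by (simp add: step_def)
  show ?thesis
    using assms(1)
  proof cases
    case (left k e i p)
    from st[OF left(3,4)] obtain x m m' oc y where *: "W k = x @ m @ y" "W (Suc k) = x @ m' @ y" "length x = i"
      by blast
    show ?thesis using left(5) unfolding left(1,2) fst_conv snd_conv *(1,2) by (simp add: *(3) nth_append)
  next
    case (right k e i p)
    from st[OF right(3,4)] obtain x m m' oc y where *: "W k = x @ m @ y" "W (Suc k) = x @ m' @ y" "length x = i"
      "length m = strands_in e" "(m', oc) \<in> outs UNIV e m" by blast
    obtain q where p: "p = i + strands_in e + q"
      using right(5) le_Suc_ex by blast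
    have "W k ! p = y ! q" "W (Suc k) ! (p - strands_in e + strands_out e) = y ! q"
      using length_outs[OF *(5,4)] unfolding p *(1,2) by (simp_all add: *(3,4) nth_append)
    then show ?thesis unfolding right(1,2) by simp
  next
    case (cap k i)
    from st[OF cap(3,4)] obtain x m m' oc y where *: "W (Suc k) = x @ m' @ y" "length x = i" "(m', oc) \<in> outs UNIV Cap m"
      by blast
    from *(3) obtain b where "m' = [b, b]" by auto
    with * show ?thesis unfolding cap(1,2) by (simp add: nth_append)
  next
    case (cup k i)
    from st[OF cup(3,4)] obtain x m m' oc y where *: "W k = x @ m @ y" "length x = i" "length m = 2" "(m', oc) \<in> outs UNIV Cup m"
      by auto
    from *(3,4) obtain b where "m = [b, b]" by (auto simp: length_2_conv split: if_splits)
    with * show ?thesis unfolding cup(1,2) by (simp add: nth_append)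
  next
    case (cross_down k s i)
    from st[OF cross_down(3,4)] obtain x m m' oc y where *: "W k = x @ m @ y" "W (Suc k) = x @ m' @ y" "length x = i"
      "length m = 2" "(m', oc) \<in> outs UNIV (Cross s) m" by auto
    from *(4,5) obtain b c where "m = [b, c]" "m' = [c, b]" by (auto simp: length_2_conv split: if_splits)
    with * show ?thesis unfolding cross_down(1,2) by (simp add: nth_append)
  next
    case (cross_up k s i)
    from st[OF cross_up(3,4)] obtain x m m' oc y where *: "W k = x @ m @ y" "W (Suc k) = x @ m' @ y" "length x = i"
      "length m = 2" "(m', oc) \<in> outs UNIV (Cross s) m" by auto
    from *(4,5) obtain b c where "m = [b, c]" "m' = [c, b]" by (auto simp: length_2_conv split: if_splits)
    with * show ?thesis unfolding cross_up(1,2) by (simp add: nth_append)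
  qed
qed

lemma same_component_colouring:
  assumes "same_component D a b" "colouring (slices D) W"
  shows "W (fst a) ! snd a = W (fst b) ! snd b"
  using assms(1) unfolding same_component_def
proof (induction rule: equivclp_induct)
  case (step y z)
  then show ?case using joined_colouring[OF _ assms(2)] by metis
qed simp

text \<open>The converse of \<open>joined_colouring\<close>; it turns the characteristic function of
  a component into a colouring.\<close>

lemma colouring_of_points:
  assumes f: "\<And>a b. joined ws a b \<Longrightarrow> f a = f b" and ok: "ok 0 ws"
  shows "colouring ws (\<lambda>k. map (\<lambda>p. f (k, p)) [0..<width (take k ws)])"
  unfolding colouring_def
proof (intro allI impI)
  fix k assume k: "k < length ws"
  obtain e i where ei: "ws ! k = (e, i)" by force
  let ?n = "width (take k ws)" and ?F = "\<lambda>k a b. map (\<lambda>p. f (k, p)) [a..<b]"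
  have "ok 0 (take k ws @ (e, i) # drop (Suc k) ws)"
    using id_take_nth_drop[OF k] ei ok by simp
  hence le: "i + strands_in e \<le> ?n" by (simp add: width_eq_wd)
  have n': "width (take (Suc k) ws) = ?n - strands_in e + strands_out e"
    using k ei by (simp add: take_Suc_conv_app_nth width_eq_wd)
  have left: "?F (Suc k) 0 i = ?F k 0 i"
    using f[OF joined.left[OF k ei]] by auto
  have right: "?F (Suc k) (i + strands_out e) (?n - strands_in e + strands_out e) = ?F k (i + strands_in e) ?n"
  proof -
    have "f (Suc k, q + (i + strands_out e)) = f (k, q + (i + strands_in e))" if "q < ?n - (i + strands_in e)" for q
      using f[OF joined.right[OF k ei, of "q + (i + strands_in e)"]] that by (simp add: algebra_simps)
    then show ?thesis
      using le by (intro nth_equalityI) (auto simp: add.commute)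
  qed
  have split: "?F k' 0 (i + j + l) = ?F k' 0 i @ ?F k' i (i + j) @ ?F k' (i + j) (i + j + l)" for k' j l
    using upt_add_eq_append[of 0 i "j + l"] upt_add_eq_append[of i "i + j" l] by (simp add: add.assoc)
  have o: "\<exists>oc. (?F (Suc k) i (i + strands_out e), oc) \<in> outs UNIV e (?F k i (i + strands_in e))"
  proof (cases e)
    case Cap
    then have "f (Suc k, i) = f (Suc k, Suc i)" using joined.cap[OF k] ei f by simp
    then show ?thesis using Cap by (auto simp: numeral_2_eq_2)
  next
    case Cup
    then have "f (k, i) = f (k, Suc i)" using joined.cup[OF k] ei f by simp
    then show ?thesis using Cup by (simp add: numeral_2_eq_2)
  next
    case (Cross s)
    then have "f (k, i) = f (Suc k, Suc i)" "f (k, Suc i) = f (Suc k, i)"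
      using joined.cross_up[OF k] joined.cross_down[OF k] ei f by simp_all
    then show ?thesis using Cross by (auto simp: numeral_2_eq_2)
  qed
  define l where "l = ?n - i - strands_in e"
  have l: "?n = i + strands_in e + l" "?n - strands_in e + strands_out e = i + strands_out e + l"
    using le by (simp_all add: l_def)
  show "step (ws ! k) (?F k 0 ?n) (?F (Suc k) 0 (width (take (Suc k) ws)))"
    unfolding n' l(2) unfolding l(1) split ei step_def using o left right[unfolded l(2), unfolded l(1)]
    by (intro exI[of _ "?F k 0 i"] exI[of _ "?F k i (i + strands_in e)"]
        exI[of _ "?F (Suc k) i (i + strands_out e)"]) auto
qed

lemma sep_not_same_component:
  assumes "sep us i vs []" "slices D = us @ (Cross s, i) # vs"
  shows "\<not> same_component D (length us, i) (length us, Suc i)"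
proof
  assume same: "same_component D (length us, i) (length us, Suc i)"
  from assms(1) obtain x p y where x: "cpath [] us (x @ p # (\<not> p) # y)" "length x = i" "cpath (x @ (\<not> p) # p # y) vs []"
    by (auto simp: sep_def)
  have "cpath (x @ p # (\<not> p) # y) ((Cross s, i) # vs) []"
    using cpath.Cons[of "[p, \<not> p]" "Cross s" "[\<not> p, p]" None x y vs "[]"] x by simp
  from cpath_colouring[OF this] cpath_colouring[OF x(1)] obtain W V where
    W: "colouring us W" "W (length us) = x @ p # (\<not> p) # y"
    and V: "colouring ((Cross s, i) # vs) V" "V 0 = x @ p # (\<not> p) # y" by blast
  from same_component_colouring[OF same, of "\<lambda>k. if k \<le> length us then W k else V (k - length us)"]
    colouring_append[OF W(1) V(1)] assms(2) W V x(2) show False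
    by (simp add: nth_append)
qed

lemma width_slices: "width (slices D) = 0" "ok 0 (slices D)"
  using closed_slices(1)[of D] by (auto simp: closed_tangle_def width_eq_wd)

text \<open>The separating colouring is the characteristic function of the component of strand
  \<open>i\<close>.\<close>

lemma not_same_component_sep:
  assumes "\<not> same_component D (length us, i) (length us, Suc i)" "slices D = us @ (Cross s, i) # vs"
  shows "sep us i vs []"
proof -
  let ?f = "\<lambda>a. same_component D (length us, i) a" and ?n = "length us"
  define W where "W = (\<lambda>k. map (\<lambda>p. ?f (k, p)) [0..<width (take k (slices D))])"
  have f: "?f a = ?f b" if "joined (slices D) a b" for a b
    using that unfolding same_component_def
    by (meson equivclp_sym equivclp_trans r_into_equivclp)
  have "colouring (slices D) W"
    using colouring_of_points[of "slices D" ?f, OF f] width_slices(2)[of D] by (simp add: W_def)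
  hence W: "colouring (us @ (Cross s, i) # vs) W"
    by (simp only: assms(2))
  have w0: "W 0 = []" by (simp add: W_def width_eq_wd)
  have wn: "W (length (slices D)) = []" by (simp add: W_def width_slices)
  have c1: "cpath [] us (W ?n)"
    using colouring_cpath[OF colouring_take[OF W]] w0 by simp
  have "cpath (W ?n) ((Cross s, i) # vs) []"
    using colouring_cpath[OF colouring_drop[OF W]] wn assms(2) by simp
  then obtain m m' oc x y where c2: "W ?n = x @ m @ y" "i = length x" "length m = strands_in (Cross s)"
    "(m', oc) \<in> outs UNIV (Cross s) m" "cpath (x @ m' @ y) vs []"
    by (rule cpath_ConsE) auto
  from c2(3) obtain b c where m: "m = [b, c]" by (auto simp: length_2_conv)
  have lw: "length (W ?n) = width (take ?n (slices D))" by (simp add: W_def)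
  have "W ?n ! p = ?f (?n, p)" if "p < length (W ?n)" for p
    using that by (simp add: W_def)
  from this[of i] this[of "Suc i"] have "b = ?f (?n, i)" "c = ?f (?n, Suc i)"
    using c2(1,2) m by (simp_all add: nth_append)
  with assms(1) have bc: "b = True" "c = False"
    by (auto simp: same_component_def)
  with c2(4) m have "m' = [False, True]" by simp
  with c1 c2 m bc show ?thesis
    unfolding sep_def by (intro exI[of _ x] exI[of _ True] exI[of _ y]) simp
qed

lemma is_knot_colouring:
  assumes "is_knot D" "colouring (slices D) W" "W 0 = []" "k \<le> length (slices D)" "l \<le> length (slices D)"
    "b \<in> set (W k)" "c \<in> set (W l)"
  shows "b = c"
proof -
  from assms(6,7) obtain p q where p: "p < length (W k)" "W k ! p = b" and q: "q < length (W l)" "W l ! q = c"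
    by (auto simp: in_set_conv_nth)
  have "(k, p) \<in> points (slices D)" "(l, q) \<in> points (slices D)"
    using p q assms length_colouring[OF assms(2,3)] by (auto simp: points_def)
  with assms(1) have "same_component D (k, p) (l, q)" by (simp add: is_knot_def)
  from same_component_colouring[OF this assms(2)] p q show ?thesis by simp
qed

lemma not_is_knot_colouring:
  assumes "\<not> is_knot D"
  obtains W :: "nat \<Rightarrow> bool list" and k l where "colouring (slices D) W" "W 0 = []" "W (length (slices D)) = []"
    "k \<le> length (slices D)" "l \<le> length (slices D)" "True \<in> set (W k)" "False \<in> set (W l)"
proof -
  from assms obtain k p l q where u: "(k, p) \<in> points (slices D)" and v: "(l, q) \<in> points (slices D)"
    and not: "\<not> same_component D (k, p) (l, q)" unfolding is_knot_def by auto
  let ?f = "\<lambda>a. same_component D (k, p) a"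
  define W where "W = (\<lambda>k. map (\<lambda>p. ?f (k, p)) [0..<width (take k (slices D))])"
  have f: "?f a = ?f b" if "joined (slices D) a b" for a b
    using that unfolding same_component_def
    by (meson equivclp_sym equivclp_trans r_into_equivclp)
  have tt: "?f (k, p)" by (simp add: same_component_def)
  have "colouring (slices D) W"
    using colouring_of_points[of "slices D" ?f, OF f] width_slices(2)[of D] by (simp add: W_def)
  moreover have "W 0 = []" "W (length (slices D)) = []"
    by (simp_all add: W_def width_eq_wd width_slices[unfolded width_eq_wd])
  moreover have "True \<in> set (W k)" "False \<in> set (W l)"
    using u v not tt by (force simp: W_def points_def)+
  ultimately show ?thesis using u v by (intro that) (auto simp: points_def)
qed

section \<open>Knots in a split union\<close>

lemma replicate_split:
  "i + j \<le> n \<Longrightarrow> replicate n b = replicate i b @ replicate j b @ replicate (n - i - j) b"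
  by (simp flip: replicate_add)

text \<open>The colour \<open>b\<close> of the first maximum spreads over the whole knot, so one
  summand survives at each slice. \<open>us\<close> is the part already read and \<open>W\<close>
  its constant colouring, kept in order to apply \<open>is_knot\<close> to all of
  \<open>D\<close>.\<close>

lemma tsum_knot_aux:
  fixes W :: "nat \<Rightarrow> 'c :: linorder list"
  assumes "is_knot D" "slices D = us @ vs" "colouring us W" "W 0 = []" "W (length us) = replicate n b"
    "us \<noteq> []" "b \<in> set (W 1)" "n = wd 0 us" "finite C" "b \<in> C" "ok 0 (us @ vs @ rest)"
  shows "tsum C \<sigma> \<Phi> (replicate n b) (vs @ rest) = tsum C \<sigma> (\<lambda>r. \<Phi> (r(b := vs @ r b))) [] rest"
  using assms(2-)
proof (induction vs arbitrary: us W n \<Phi>)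
  case Nil
  then have "n = 0"
    using width_slices(1)[of D] by (simp add: width_eq_wd)
  then show ?case by simp
next
  case (Cons ei vs)
  obtain e i where ei: "ei = (e, i)" by force
  let ?j = "strands_in e" and ?o = "strands_out e"
  define l where "l = n - i - ?j"
  let ?x = "replicate i b" and ?y = "replicate l b"
  have le: "i + ?j \<le> n" using Cons.prems ei by simp
  have n: "replicate n b = ?x @ replicate ?j b @ ?y"
    unfolding l_def by (rule replicate_split[OF le])
  have good: "(replicate ?o b, Some b) \<in> outs C e (replicate ?j b)"
    using Cons.prems(9) by (cases e) (auto simp: numeral_2_eq_2)
  \<comment> \<open>A nonzero summand in which another colour appears would extend \<open>W\<close>
    to a colouring of the knot with two colours.\<close>
  have zero: "tsum C \<sigma> \<Psi> (?x @ m' @ ?y) (vs @ rest) = 0"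
    if o: "(m', oc) \<in> outs C e (replicate ?j b)" "(m', oc) \<noteq> (replicate ?o b, Some b)" for m' oc \<Psi>
  proof (rule ccontr)
    assume nz: "tsum C \<sigma> \<Psi> (?x @ m' @ ?y) (vs @ rest) \<noteq> 0"
    note oU = outs_UNIV[OF o(1)]
    have "\<exists>b'. b' \<noteq> b \<and> b' \<in> set m'"
      using o by (cases e) (auto simp: numeral_2_eq_2)
    then obtain b' where b': "b' \<noteq> b" "b' \<in> set m'" by blast
    have "cpath (?x @ m' @ ?y) (vs @ rest) []"
      by (rule tsum_nonzero_cpath[OF nz]) (use Cons.prems ei length_outs[OF oU] le in \<open>simp add: l_def add_ac\<close>)
    from cpath_appendD[OF this] obtain d where d: "cpath (?x @ m' @ ?y) vs d" by blast
    from cpath_colouring[OF d] obtain V where V: "colouring vs V" "V 0 = ?x @ m' @ ?y" by blast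
    define V' where "V' = (\<lambda>k. case k of 0 \<Rightarrow> replicate n b | Suc k \<Rightarrow> V k)"
    have "step (e, i) (replicate n b) (?x @ m' @ ?y)"
      unfolding n step_def using oU
      by (intro exI[of _ ?x] exI[of _ "replicate ?j b"] exI[of _ m'] exI[of _ oc] exI[of _ ?y]) simp
    then have V': "colouring (ei # vs) V'" "V' 0 = replicate n b" "V' 1 = ?x @ m' @ ?y"
      using V by (auto simp: colouring_def V'_def ei less_Suc_eq_0_disj)
    define U where "U = (\<lambda>k. if k \<le> length us then W k else V' (k - length us))"
    have "colouring (slices D) U"
      unfolding Cons.prems(1) U_def by (rule colouring_append[OF Cons.prems(2) V'(1)]) (simp add: V' Cons.prems)
    moreover have "U 0 = []" by (simp add: U_def Cons.prems(3))
    moreover have "1 \<le> length (slices D)" "Suc (length us) \<le> length (slices D)"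
      unfolding Cons.prems(1) by simp_all
    moreover have "b \<in> set (U 1)"
      using Cons.prems(5,6) by (cases us) (simp_all add: U_def)
    moreover have "b' \<in> set (U (Suc (length us)))"
      using V'(3) b'(2) by (simp add: U_def)
    ultimately have "b = b'"
      by (rule is_knot_colouring[OF assms(1)])
    with b' show False by simp
  qed
  have n': "?o + n - ?j = i + ?o + l" using le by (simp add: l_def)
  have "tsum C \<sigma> \<Phi> (replicate n b) ((ei # vs) @ rest) =
      coef \<sigma> e (replicate ?j b) * (\<Sum>(m', oc) \<in> outs C e (replicate ?j b).
        tsum C \<sigma> (\<lambda>r. \<Phi> (upd e ?x oc r)) (?x @ m' @ ?y) (vs @ rest))"
    unfolding n ei using tsum_step[of "replicate ?j b" e C \<sigma> \<Phi> ?x ?y "vs @ rest"] by simp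
  also have "(\<Sum>(m', oc) \<in> outs C e (replicate ?j b).
        tsum C \<sigma> (\<lambda>r. \<Phi> (upd e ?x oc r)) (?x @ m' @ ?y) (vs @ rest)) =
      (\<Sum>z \<in> outs C e (replicate ?j b). if z = (replicate ?o b, Some b) then
        tsum C \<sigma> (\<lambda>r. \<Phi> (upd e ?x (Some b) r)) (?x @ replicate ?o b @ ?y) (vs @ rest) else 0)"
    using zero by (intro sum.cong) (auto split: prod.splits)
  also have "\<dots> = tsum C \<sigma> (\<lambda>r. \<Phi> (upd e ?x (Some b) r)) (?x @ replicate ?o b @ ?y) (vs @ rest)"
    using good Cons.prems(8) by (simp add: sum.delta)
  also have "coef \<sigma> e (replicate ?j b) = 1"
    by (cases e) (auto simp: numeral_2_eq_2)
  also have "?x @ replicate ?o b @ ?y = replicate (i + ?o + l) b"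
    by (simp add: replicate_add)
  also have "tsum C \<sigma> (\<lambda>r. \<Phi> (upd e ?x (Some b) r)) (replicate (i + ?o + l) b) (vs @ rest) =
      tsum C \<sigma> (\<lambda>r. \<Phi> (upd e ?x (Some b) (r(b := vs @ r b)))) [] rest"
  proof (rule Cons.IH)
    show "slices D = (us @ [ei]) @ vs" using Cons.prems by simp
    let ?W = "W(Suc (length us) := replicate (i + ?o + l) b)"
    have "step (e, i) (replicate n b) (replicate (i + ?o + l) b)"
      unfolding step_def n using good[THEN outs_UNIV]
      by (intro exI[of _ ?x] exI[of _ "replicate ?j b"] exI[of _ "replicate ?o b"] exI[of _ "Some b"] exI[of _ ?y])
        (simp add: replicate_add)
    then show "colouring (us @ [ei]) ?W"
      using Cons.prems(2,4) by (auto simp: colouring_def nth_append less_Suc_eq ei)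
    show "i + ?o + l = wd 0 (us @ [ei])"
      using Cons.prems(7) n' by (simp add: ei)
    show "b \<in> set (?W 1)"
      using Cons.prems(5,6) by (cases us) simp_all
  qed (use Cons.prems(3,8-10) in simp_all)
  finally show ?case
    by (simp add: ei count_list_replicate fun_upd_def cong: if_cong)
qed

lemma tsum_knot:
  assumes "is_knot D" "finite C" "ok 0 (slices D @ rest)"
  shows "tsum C \<sigma> \<Phi> [] (slices D @ rest) = (\<Sum>b \<in> C. tsum C \<sigma> (\<lambda>r. \<Phi> (r(b := slices D @ r b))) [] rest)"
proof -
  obtain e i vs where "slices D = (e, i) # vs"
    using closed_slices(2)[of D] by (cases "slices D") auto
  with width_slices(2)[of D] have D: "slices D = (Cap, 0) # vs"
    by (cases e) auto
  have "tsum C \<sigma> (\<lambda>r. \<Phi> (r(b := (Cap, 0) # r b))) (replicate 2 b) (vs @ rest) =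
      tsum C \<sigma> (\<lambda>r. \<Phi> ((r(b := vs @ r b))(b := (Cap, 0) # (r(b := vs @ r b)) b))) [] rest" if b: "b \<in> C" for b
  proof (rule tsum_knot_aux[OF assms(1), where us = "[(Cap, 0)]" and W = "\<lambda>k. if k = 0 then [] else [b, b]"])
    have "step (Cap, 0) [] [b, b]"
      unfolding step_def by (intro exI[of _ "[]"] exI[of _ "[b, b]"] exI[of _ "Some b"]) simp
    then show "colouring [(Cap, 0)] (\<lambda>k. if k = 0 then [] else [b, b])"
      by (simp add: colouring_def)
  qed (use D assms b in \<open>auto simp: numeral_2_eq_2\<close>)
  then show ?thesis
    using tsum_Cap[of C \<sigma> \<Phi> "[]" "[]" "vs @ rest"] by (simp add: D numeral_2_eq_2)
qed

section \<open>Stacked diagrams and estimates of the number of 2-colourings\<close>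

lemma closed_append: "closed_tangle us \<Longrightarrow> closed_tangle vs \<Longrightarrow> closed_tangle (us @ vs)"
  by (simp add: closed_tangle_def)

lemma closed_concat: "closed_tangle (concat (map slices Ds))"
  by (induction Ds) (auto intro: closed_append simp: closed_tangle_def[of "[]"])

lemma cnt_cross:
  assumes "closed_tangle (us @ (Cross s, i) # vs)" "sep us i vs []"
  shows "cnt [] (us @ (Cross s, i) # vs) = 2 * cnt [] (us @ vs)"
    "cnt [] (us @ (Cup, i) # (Cap, i) # vs) = cnt [] (us @ vs)"
proof -
  show "cnt [] (us @ (Cross s, i) # vs) = 2 * cnt [] (us @ vs)"
    using cnt_cross_aux[of us i vs "[]" "[]" s] assms by (auto simp: closed_tangle_def)
  have "separable i vs us ([] :: bool list)"
    using assms(2) by (auto simp: separable_def)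
  then show "cnt [] (us @ (Cup, i) # (Cap, i) # vs) = cnt [] (us @ vs)"
    using assms(1) by (intro cnt_smoothings) (auto simp: closed_tangle_def)
qed

lemma cnt_nonneg: "cnt c ws \<ge> 0"
  unfolding cnt_def
proof (induction ws arbitrary: c)
  case (Cons ei ws)
  then show ?case by (cases ei) (auto simp: tsum.simps intro!: sum_nonneg)
qed simp

lemma cnt_const: "ok n ws \<Longrightarrow> wd n ws = 0 \<Longrightarrow> cnt (replicate n b) ws \<ge> 1"
proof (induction n ws rule: ok.induct)
  case (2 n e i ws)
  let ?j = "strands_in e" and ?o = "strands_out e"
  let ?x = "replicate i b" and ?y = "replicate (n - i - ?j) b"
  have le: "i + ?j \<le> n" using 2 by simp
  have "1 \<le> cnt (replicate (n - ?j + ?o) b) ws"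
    using 2 by auto
  also have "replicate (n - ?j + ?o) b = ?x @ replicate ?o b @ ?y"
    using le by (simp flip: replicate_add)
  also have "cnt (?x @ replicate ?o b @ ?y) ws \<le>
      (\<Sum>z \<in> outs UNIV e (replicate ?j b). cnt (?x @ fst z @ ?y) ws)"
  proof -
    have "(replicate ?o b, Some b) \<in> outs UNIV e (replicate ?j b)"
      by (cases e) (auto simp: numeral_2_eq_2)
    from member_le_sum[OF this, of "\<lambda>z. cnt (?x @ fst z @ ?y) ws"] cnt_nonneg show ?thesis by simp
  qed
  also have "\<dots> = cnt (replicate n b) ((e, i) # ws)"
    using cnt_step[of "replicate ?j b" e ?x ?y ws] replicate_split[OF le, of b] by (simp add: case_prod_unfold)
  finally show ?case .
qed simp

lemma closed_Cap:
  assumes "closed_tangle ws" "ws \<noteq> []"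
  obtains vs where "ws = (Cap, 0) # vs"
proof -
  obtain e i vs where ws: "ws = (e, i) # vs" using assms(2) by (cases ws) auto
  with assms(1) have "e = Cap \<and> i = 0" by (cases e) (auto simp: closed_tangle_def)
  with ws that show ?thesis by simp
qed

lemma cnt_ge_2:
  assumes "closed_tangle ws" "ws \<noteq> []"
  shows "cnt [] ws \<ge> 2"
proof -
  from closed_Cap[OF assms] obtain vs where ws: "ws = (Cap, 0) # vs" .
  have *: "cnt [b, b] vs \<ge> 1" for b
    using cnt_const[of 2 vs b] assms(1) by (simp add: ws closed_tangle_def numeral_2_eq_2)
  have "cnt [] ws = cnt [False, False] vs + cnt [True, True] vs"
    using cnt_elem(1)[of "[]" "[]" vs] by (simp add: ws UNIV_bool)
  with *[of False] *[of True] show ?thesis by simp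
qed

lemma cnt_append:
  "ok (length c) us \<Longrightarrow> wd (length c) us = 0 \<Longrightarrow> cnt c (us @ vs) = cnt c us * cnt [] vs"
proof (induction us arbitrary: c)
  case (Cons ei us)
  obtain e i where ei: "ei = (e, i)" by force
  with Cons.prems have "i + strands_in e \<le> length c" by simp
  then obtain x m y where c: "c = x @ m @ y" "length x = i" "length m = strands_in e"
    by (rule split_word)
  have step: "cnt c ((e, i) # ws) = (\<Sum>(m', oc) \<in> outs UNIV e m. cnt (x @ m' @ y) ws)" for ws
    using cnt_step[OF c(3), of x y ws] unfolding c(1,2) by simp
  have IH: "cnt (x @ m' @ y) (us @ vs) = cnt (x @ m' @ y) us * cnt [] vs" if "(m', oc) \<in> outs UNIV e m" for m' oc
    using Cons.prems length_outs[OF that c(3)] c by (intro Cons.IH) (auto simp: ei add_ac)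
  show ?case
    unfolding ei append_Cons step sum_distrib_right by (intro sum.cong) (auto simp: IH)
qed simp

lemma cnt_ri: "ri 0 ws ws' \<Longrightarrow> closed_tangle ws \<Longrightarrow> cnt [] ws = cnt [] ws'"
  using move_inv_ri[OF framed_move_inv[OF cnt_framed], of 0 ws ws' "[]" "[]"] by (simp add: closed_tangle_def)

section \<open>Reduction to unlinked knots\<close>

lemma layers_cpath: "layers c ws P n \<Longrightarrow> cpath c ws []"
  by (induction rule: layers.induct) (auto intro: cpath.intros)

text \<open>A colour that occurs anywhere has a non-empty layer, so a colouring with both colours
  splits off two non-trivial parts.\<close>

lemma colouring_layers:
  assumes "colouring ws W" "W (length ws) = []"
  shows "\<exists>P n. layers (W 0) ws P n \<and> (\<forall>k \<le> length ws. \<forall>b \<in> set (W k). P b \<noteq> [])"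
  using assms
proof (induction ws arbitrary: W)
  case Nil
  then show ?case using layers.Nil by auto
next
  case (Cons ei ws)
  have "colouring ws (\<lambda>k. W (Suc k))"
    using colouring_drop[of "[ei]" ws W] Cons.prems(1) by simp
  from Cons.IH[OF this] Cons.prems(2) obtain P n where P: "layers (W (Suc 0)) ws P n"
    "\<And>k b. k \<le> length ws \<Longrightarrow> b \<in> set (W (Suc k)) \<Longrightarrow> P b \<noteq> []" by auto
  have "step ei (W 0) (W (Suc 0))"
    using Cons.prems by (auto simp: colouring_def)
  then obtain x m m' oc y where s: "W 0 = x @ m @ y" "W (Suc 0) = x @ m' @ y" "length x = snd ei"
     "length m = strands_in (fst ei)" "(m', oc) \<in> outs UNIV (fst ei) m"
    unfolding step_def by blast
  define P' where "P' = upd (fst ei) x oc P"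
  obtain n' where P': "layers (W 0) (ei # ws) P' n'"
    using layers.Cons[OF s(4,5) P(1)[unfolded s(2)]] s(1,3) by (auto simp: P'_def)
  have P'_ne: "P' b \<noteq> []" if "P b \<noteq> []" for b
    using that by (cases oc) (auto simp: P'_def)
  have "P' b \<noteq> []" if "k \<le> length (ei # ws)" "b \<in> set (W k)" for k b
  proof (cases k)
    case 0
    have "count_list (W 0) b \<noteq> 0" using that 0 by (simp add: count_list_0_iff)
    then show ?thesis using layers_valid[OF P', unfolded valid_fam_def, rule_format, OF UNIV_I, of b] by auto
  next
    case (Suc l)
    then show ?thesis using P(2)[of l b] P'_ne that by simp
  qed
  then show ?case using P' by blast
qed

lemma sep_ConsI:
  assumes "sep us i vs (x @ m' @ y)" "length m = strands_in e" "(m', oc) \<in> outs UNIV e m"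
  shows "sep ((e, length x) # us) i vs (x @ m @ y)"
  using assms(1) cpath.Cons[OF assms(2,3)] unfolding sep_def by blast

text \<open>The layering is itself a colouring that separates the strands of the first wrong
  crossing. As that crossing lies in no layer, switching it leaves \<open>P\<close>
  unchanged.\<close>

lemma layers_switch:
  "layers c ws P n \<Longrightarrow> n > 0 \<Longrightarrow> \<exists>us s i vs. ws = us @ (Cross s, i) # vs \<and>
    layers c (us @ (Cross (\<not> s), i) # vs) P (n - 1) \<and> sep us i vs c"
proof (induction rule: layers.induct)
  case (Cons m e m' oc x y ws P n)
  show ?case
  proof (cases "under e m")
    case True
    then obtain s where s: "e = Cross s" by (cases e) auto
    with Cons.hyps(1) obtain b q where bq: "m = [b, q]" by (auto simp: length_2_conv)
    have "q = (\<not> b)" "s = (\<not> b)" using True s bq by auto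
    with s bq Cons.hyps(2) have m: "e = Cross (\<not> b)" "m = [b, \<not> b]" "m' = [\<not> b, b]" "oc = None" by simp_all
    have "sep [] (length x) ws (x @ m @ y)"
      using layers_cpath[OF Cons.hyps(3)] m unfolding sep_def
      by - (rule exI[of _ x], rule exI[of _ b], rule exI[of _ y], simp add: cpath.Nil)
    moreover have "layers (x @ m @ y) ((Cross b, length x) # ws) P n"
      using layers.Cons[of m "Cross b" m' None x y ws P n] Cons.hyps(3) m by simp
    ultimately show ?thesis
      using m by - (rule exI[of _ "[]"], rule exI[of _ "\<not> b"], rule exI[of _ "length x"], rule exI[of _ ws], simp)
  next
    case False
    hence "n > 0" using Cons.prems by simp
    from Cons.IH[OF this] obtain us s i vs where *: "ws = us @ (Cross s, i) # vs"
      "layers (x @ m' @ y) (us @ (Cross (\<not> s), i) # vs) P (n - 1)" "sep us i vs (x @ m' @ y)" by blast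
    show ?thesis
      using layers.Cons[OF Cons.hyps(1,2) *(2)] sep_ConsI[OF *(3) Cons.hyps(1,2)] *(1) False
      by - (rule exI[of _ "(e, length x) # us"], rule exI[of _ s], rule exI[of _ i], rule exI[of _ vs], simp)
  qed
qed simp

lemma cpath_const: "ok n ws \<Longrightarrow> cpath (replicate n b) ws (replicate (wd n ws) b)"
proof (induction n ws rule: ok.induct)
  case (2 n e i ws)
  let ?j = "strands_in e" and ?o = "strands_out e"
  let ?x = "replicate i b" and ?y = "replicate (n - i - ?j) b"
  have le: "i + ?j \<le> n" using 2 by simp
  have "replicate (n - ?j + ?o) b = ?x @ replicate ?o b @ ?y"
    using le by (simp flip: replicate_add)
  hence "cpath (?x @ replicate ?o b @ ?y) ws (replicate (wd n ((e, i) # ws)) b)"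
    using 2 by auto
  moreover have "(replicate ?o b, Some b) \<in> outs UNIV e (replicate ?j b)"
    by (cases e) (auto simp: numeral_2_eq_2)
  ultimately show ?case
    using cpath.Cons[of "replicate ?j b" e "replicate ?o b" "Some b" ?x ?y] replicate_split[OF le, of b] by simp
qed (simp add: cpath.Nil)

lemma closed_cpath: "closed_tangle ws \<Longrightarrow> cpath [] ws []"
  using cpath_const[of 0 ws] by (simp add: closed_tangle_def)

lemma sep_context:
  assumes "closed_tangle us'" "closed_tangle vs'" "sep us i vs []"
  shows "sep (us' @ us) i (vs @ vs') []"
  using assms(3) cpath_append[OF closed_cpath[OF assms(1)]] cpath_append[OF _ closed_cpath[OF assms(2)]]
  unfolding sep_def by blast

context
  fixes Pr :: "slices \<Rightarrow> bool"
  assumes Pr_inv: "move_inv 0 Pr"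
    and Pr_skein: "\<And>us s i vs. closed_tangle (us @ (Cross s, i) # vs) \<Longrightarrow> sep us i vs [] \<Longrightarrow>
      Pr (us @ (Cross (\<not> s), i) # vs) \<Longrightarrow> Pr (us @ (Cup, i) # (Cap, i) # vs) \<Longrightarrow> Pr (us @ vs) \<Longrightarrow>
      Pr (us @ (Cross s, i) # vs)"
begin

text \<open>Here \<open>n\<close> bounds the number of components. The surrounding \<open>U\<close>
  and \<open>V\<close> are needed because each of two layers is reduced in the presence of the
  other.\<close>

lemma skein_induct_aux:
  assumes "closed_tangle D" "D \<noteq> []" "cnt [] D \<le> 2 ^ n" "closed_tangle U" "closed_tangle V"
    "\<And>Ds. \<forall>K \<in> set Ds. is_knot K \<Longrightarrow> Ds \<noteq> [] \<Longrightarrow> Pr (U @ concat (map slices Ds) @ V)"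
  shows "Pr (U @ D @ V)"
  using assms
proof (induction n arbitrary: D U V)
  case 0
  then show ?case using cnt_ge_2[of D] by simp
next
  case (Suc n)
  note outer = Suc.IH and U = Suc.prems(4) and V = Suc.prems(5) and hyp = Suc.prems(6)
  \<comment> \<open>Inner induction on the number of wrong crossings. Switching one keeps the layers
    and the number of colourings, while either smoothing halves that number and falls to the outer
    induction.\<close>
  have layered: "Pr (U @ D @ V)" if "layers [] D P k" "P True \<noteq> []" "P False \<noteq> []"
    "closed_tangle D" "cnt [] D \<le> 2 ^ Suc n" for D P k
    using that
  proof (induction k arbitrary: D rule: nat_induct[case_names zero succ])
    case zero
    then have 0: "layers [] D P 0" "P True \<noteq> []" "P False \<noteq> []" "closed_tangle D" "cnt [] D \<le> 2 ^ Suc n"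
      by blast+
    have cl: "closed_tangle (P b)" for b
      using layers_valid[OF 0(1)] by (simp add: closed_tangle_def valid_fam_def)
    have ri: "ri 0 D (P True @ P False)"
      using layers_ri[OF 0(1)] by simp
    \<comment> \<open>Each layer has at least the two constant colourings, so the other has at most
      half of those of \<open>D\<close>.\<close>
    have ge: "cnt [] (P True) \<ge> 2" "cnt [] (P False) \<ge> 2"
      using cnt_ge_2 cl 0(2,3) by auto
    have "cnt [] (P True) * cnt [] (P False) \<le> 2 * 2 ^ n"
      using cnt_ri[OF ri 0(4)] cnt_append[of "[]" "P True" "P False"] cl[of True] 0(5) by (simp add: closed_tangle_def)
    moreover have "2 * cnt [] (P False) \<le> cnt [] (P True) * cnt [] (P False)"
      "cnt [] (P True) * 2 \<le> cnt [] (P True) * cnt [] (P False)"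
      using ge by (simp_all add: mult_right_mono mult_left_mono)
    ultimately have le: "cnt [] (P True) \<le> 2 ^ n" "cnt [] (P False) \<le> 2 ^ n" by linarith+
    \<comment> \<open>The upper layer is replaced by knots above the lower one, then the lower layer
      by knots below those.\<close>
    have "Pr (U @ P True @ (P False @ V))"
    proof (rule outer[OF cl 0(2) le(1) U])
      show "closed_tangle (P False @ V)" using cl V by (rule closed_append)
      fix Ds assume Ds: "\<forall>K \<in> set Ds. is_knot K" "Ds \<noteq> []"
      have "Pr ((U @ concat (map slices Ds)) @ P False @ V)"
      proof (rule outer[OF cl 0(3) le(2) _ V])
        show "closed_tangle (U @ concat (map slices Ds))"
          using U closed_concat by (rule closed_append)
        fix Ds' assume "\<forall>K \<in> set Ds'. is_knot K" "Ds' \<noteq> []"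
        with hyp[of "Ds @ Ds'"] Ds
        show "Pr ((U @ concat (map slices Ds)) @ concat (map slices Ds') @ V)" by auto
      qed
      then show "Pr (U @ concat (map slices Ds) @ P False @ V)" by simp
    qed
    moreover have "Pr (U @ D @ V) = Pr (U @ (P True @ P False) @ V)"
      using U V 0(4) by (intro move_inv_ri[OF Pr_inv ri]) (auto simp: closed_tangle_def)
    ultimately show ?case by simp
  next
    case (succ k)
    then have L: "layers [] D P (Suc k)" "P True \<noteq> []" "P False \<noteq> []"
      and D: "closed_tangle D" "cnt [] D \<le> 2 ^ Suc n" by blast+
    from layers_switch[OF L(1)] obtain us s i vs where *: "D = us @ (Cross s, i) # vs"
      "layers [] (us @ (Cross (\<not> s), i) # vs) P k" "sep us i vs []" by auto
    have cl: "closed_tangle (us @ (Cross t, i) # vs)" for t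
      using D(1) *(1) by (auto simp: closed_tangle_def)
    have cnt: "cnt [] (us @ (Cross t, i) # vs) \<le> 2 ^ Suc n" for t
      using cnt_cross(1)[OF cl[of t] *(3)] cnt_cross(1)[OF cl[of s] *(3)] D(2) *(1) by simp
    have cnt': "cnt [] (us @ vs) \<le> 2 ^ n" "cnt [] (us @ (Cup, i) # (Cap, i) # vs) \<le> 2 ^ n"
      using cnt_cross[OF cl[of s] *(3)] D(2) *(1) by simp_all
    have cl': "closed_tangle (us @ vs)" "closed_tangle (us @ (Cup, i) # (Cap, i) # vs)"
      using cl[of True] by (auto simp: closed_tangle_def)
    have ne: "us @ vs \<noteq> []"
      using cl[of True] by (auto simp: closed_tangle_def)
    have "Pr ((U @ us) @ (Cross s, i) # (vs @ V))"
    proof (rule Pr_skein)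
      show "closed_tangle ((U @ us) @ (Cross s, i) # (vs @ V))"
        using closed_append[OF U closed_append[OF cl V]] by simp
      show "sep (U @ us) i (vs @ V) []"
        by (rule sep_context[OF U V *(3)])
      show "Pr ((U @ us) @ (Cross (\<not> s), i) # (vs @ V))"
        using succ.IH[OF *(2) L(2,3) cl cnt] by simp
      show "Pr ((U @ us) @ (Cup, i) # (Cap, i) # (vs @ V))"
        using outer[OF cl'(2) _ cnt'(2) U V hyp] by simp
      show "Pr ((U @ us) @ (vs @ V))"
        using outer[OF cl'(1) ne cnt'(1) U V hyp] by simp
    qed
    then show ?case using *(1) by simp
  qed
  show ?case
  proof (cases "is_knot (Abs_link_diagram D)")
    case True
    then show ?thesis using Suc.prems(6)[of "[Abs_link_diagram D]"] Suc.prems(1,2) by simp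
  next
    case False
    from not_is_knot_colouring[OF False] Suc.prems(1,2) obtain W :: "nat \<Rightarrow> bool list" and k l where
      W: "colouring D W" "W 0 = []" "W (length D) = []" "k \<le> length D" "l \<le> length D"
        "True \<in> set (W k)" "False \<in> set (W l)" by auto
    from colouring_layers[OF W(1,3)] W obtain P n' where "layers [] D P n'" "P True \<noteq> []" "P False \<noteq> []"
      by auto
    then show ?thesis using layered Suc.prems(1,3) by blast
  qed
qed

theorem skein_induct:
  assumes "closed_tangle D" "D \<noteq> []"
    "\<And>Ds. \<forall>K \<in> set Ds. is_knot K \<Longrightarrow> Ds \<noteq> [] \<Longrightarrow> Pr (concat (map slices Ds))"
  shows "Pr D"
proof -
  obtain n where "cnt [] D \<le> 2 ^ n"
    using real_arch_pow[of 2 "cnt [] D"] by (auto intro: less_imp_le)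
  from skein_induct_aux[OF assms(1,2) this, of "[]" "[]"] assms(3) show ?thesis
    by (simp add: closed_tangle_def)
qed

end

section \<open>Multiplicativity of the Kauffman polynomial\<close>

lemma framed_linear:
  "framed a m X \<Longrightarrow> framed a m Y \<Longrightarrow> framed a m (\<lambda>s. X s - c * Y s)"
  unfolding framed_def by (simp add: algebra_simps)

lemma skein_linear:
  assumes "skein w m X" "skein w m Y"
  shows "skein w m (\<lambda>s. X s - c * Y s)"
  unfolding skein_def
proof (intro allI impI)
  fix us i vs assume *: "ok m (us @ (Cross True, i) # vs)" "wd m (us @ (Cross True, i) # vs) = 0"
  have "c * (Y (us @ (Cross True, i) # vs) + Y (us @ (Cross False, i) # vs)) =
      c * (w * (Y (us @ (Cup, i) # (Cap, i) # vs) + Y (us @ vs)))"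
    using assms(2)[unfolded skein_def, rule_format, OF *] by simp
  moreover have "X (us @ (Cross True, i) # vs) + X (us @ (Cross False, i) # vs) =
      w * (X (us @ (Cup, i) # (Cap, i) # vs) + X (us @ vs))"
    using assms(1)[unfolded skein_def, rule_format, OF *] by simp
  ultimately show "X (us @ (Cross True, i) # vs) - c * Y (us @ (Cross True, i) # vs) +
      (X (us @ (Cross False, i) # vs) - c * Y (us @ (Cross False, i) # vs)) =
      w * (X (us @ (Cup, i) # (Cap, i) # vs) - c * Y (us @ (Cup, i) # (Cap, i) # vs) + (X (us @ vs) - c * Y (us @ vs)))"
    by (simp add: algebra_simps)
qed

lemma circle_linear:
  "circle_factor g X \<Longrightarrow> circle_factor g Y \<Longrightarrow> circle_factor g (\<lambda>s. X s - c * Y s)"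
  unfolding circle_factor_def by (simp add: algebra_simps)

lemma framed_append: "framed a 0 X \<Longrightarrow> closed_tangle R \<Longrightarrow> framed a 0 (\<lambda>s. X (s @ R))"
  unfolding framed_def closed_tangle_def
proof (intro allI impI)
  fix us l r vs f
  assume X: "\<forall>us l r vs f. framed_move a f l r \<longrightarrow> ok 0 (us @ l @ vs) \<longrightarrow> ok 0 (us @ r @ vs) \<longrightarrow>
      wd 0 (us @ l @ vs) = 0 \<longrightarrow> X (us @ l @ vs) = f * X (us @ r @ vs)"
    and R: "ok 0 R \<and> wd 0 R = 0"
    and m: "framed_move a f l r" "ok 0 (us @ l @ vs)" "ok 0 (us @ r @ vs)" "wd 0 (us @ l @ vs) = 0"
  have "wd (wd 0 us) l = wd (wd 0 us) r"
    using m basic_move_wd[of l r "wd 0 us"] by (auto simp: framed_move_def elim!: curl.cases)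
  with X[rule_format, OF m(1), of us "vs @ R"] R m show "X ((us @ l @ vs) @ R) = f * X ((us @ r @ vs) @ R)"
    by auto
qed

lemma skein_append: "skein w 0 X \<Longrightarrow> closed_tangle R \<Longrightarrow> skein w 0 (\<lambda>s. X (s @ R))"
  unfolding skein_def closed_tangle_def
proof (intro allI impI)
  fix us i vs
  assume X: "\<forall>us i vs. ok 0 (us @ (Cross True, i) # vs) \<longrightarrow> wd 0 (us @ (Cross True, i) # vs) = 0 \<longrightarrow>
      X (us @ (Cross True, i) # vs) + X (us @ (Cross False, i) # vs) =
       w * (X (us @ (Cup, i) # (Cap, i) # vs) + X (us @ vs))"
    and R: "ok 0 R \<and> wd 0 R = 0"
    and m: "ok 0 (us @ (Cross True, i) # vs)" "wd 0 (us @ (Cross True, i) # vs) = 0"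
  from X[rule_format, of us i "vs @ R"] R m
  show "X ((us @ (Cross True, i) # vs) @ R) + X ((us @ (Cross False, i) # vs) @ R) =
       w * (X ((us @ (Cup, i) # (Cap, i) # vs) @ R) + X ((us @ vs) @ R))"
    by auto
qed

lemma circle_append:
  assumes "circle_factor g X" "closed_tangle R"
  shows "circle_factor g (\<lambda>s. X (s @ R))"
  unfolding circle_factor_def
proof (intro allI impI)
  fix us i vs assume "closed_tangle (us @ (Cap, i) # (Cup, i) # vs)"
  from closed_append[OF this assms(2)] assms(1)[unfolded circle_factor_def, rule_format, of us i "vs @ R"]
  show "X ((us @ (Cap, i) # (Cup, i) # vs) @ R) = g * X ((us @ vs) @ R)" by simp
qed

text \<open>As functions of \<open>D\<close> both sides obey the same linear rules, and
  \<open>X [] = 1\<close> makes them agree on the empty diagram.\<close>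

lemma split_union_mult:
  assumes "framed a 0 X" "skein w 0 X" "circle_factor g X" "X [] = 1" "closed_tangle D" "closed_tangle R"
  shows "X (D @ R) = X D * X R"
proof -
  have "(\<lambda>s. X (s @ R) - X R * X s) D = 0"
    by (rule skein_vanishing[of a _ w g])
      (use assms in \<open>auto intro: framed_linear framed_append skein_linear skein_append circle_linear circle_append\<close>)
  then show ?thesis by simp
qed

text \<open>The origin of \<gamma>: in the skein relation at a kink of a neighbouring strand the two
  kinks contribute a and 1/a, one smoothing straightens to the plain strand, and the other is the
  strand with a circle beside it.\<close>

lemma circle_beside:
  assumes X: "framed a 0 X" "skein w 0 X" and w: "w \<noteq> 0" and pos: "0 < wd 0 us"
    and cl: "closed_tangle (us @ (Cap, i) # (Cup, i) # vs)"
  shows "X (us @ (Cap, i) # (Cup, i) # vs) = ((a + inverse a) / w - 1) * X (us @ vs)"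
proof -
  have ok: "i \<le> wd 0 us" "ok 0 us" "ok (wd 0 us) vs" "wd (wd 0 us) vs = 0"
    using cl by (auto simp: closed_tangle_def)
  let ?n = "wd 0 us"
  \<comment> \<open>\<open>j\<close> is the place of the kink's crossing: 1 if the circle is left of
    the first strand, \<open>i - 1\<close> if it is right of some strand.\<close>
  have "\<exists>j \<le> ?n. (\<forall>s. curl s [(Cap, i), (Cross (\<not> s), j), (Cup, i)] []) \<and>
      ri ?n [(Cap, i), (Cup, j)] [] \<and> ri ?n [(Cap, j), (Cup, i)] []"
  proof (cases i)
    case 0
    then show ?thesis
      using pos curl.curl_left[of _ 0] ri_zigzag[of 0 ?n] by (intro exI[of _ "Suc 0"]) auto
  next
    case (Suc j)
    then show ?thesis
      using ok curl.curl_right[of _ j] ri_zigzag[of j ?n] by (intro exI[of _ j]) auto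
  qed
  then obtain j where j: "j \<le> ?n" "\<And>s. curl s [(Cap, i), (Cross (\<not> s), j), (Cup, i)] []"
    and ri: "ri ?n [(Cap, i), (Cup, j)] []" "ri ?n [(Cap, j), (Cup, i)] []" by blast
  have kink: "X ((us @ [(Cap, i)]) @ (Cross (\<not> s), j) # (Cup, i) # vs) = (if s then a else inverse a) * X (us @ vs)" for s
    using framed_curl[OF X(1) j(2)[of s], of us vs] ok j(1) by simp
  have "ri ?n ([(Cap, i), (Cup, j)] @ [(Cap, j), (Cup, i)]) ([] @ [(Cap, j), (Cup, i)])"
    by (rule ri.suffix[OF ri(1)])
  also have "ri ?n \<dots> []" using ri(2) by simp
  finally have "ri ?n [(Cap, i), (Cup, j), (Cap, j), (Cup, i)] []" by simp
  from move_inv_ri[OF framed_move_inv[OF X(1)] this HOL.refl, of vs] ok j(1)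
  have L0: "X ((us @ [(Cap, i)]) @ (Cup, j) # (Cap, j) # (Cup, i) # vs) = X (us @ vs)" by simp
  have "X ((us @ [(Cap, i)]) @ (Cross True, j) # (Cup, i) # vs) + X ((us @ [(Cap, i)]) @ (Cross False, j) # (Cup, i) # vs) =
      w * (X ((us @ [(Cap, i)]) @ (Cup, j) # (Cap, j) # (Cup, i) # vs) + X ((us @ [(Cap, i)]) @ (Cup, i) # vs))"
    using X(2)[unfolded skein_def, rule_format, of "us @ [(Cap, i)]" j "(Cup, i) # vs"] ok j(1) by simp
  then have "(a + inverse a) * X (us @ vs) = w * (X (us @ vs) + X (us @ (Cap, i) # (Cup, i) # vs))"
    using kink[of True] kink[of False] L0 by (simp add: algebra_simps)
  then show ?thesis using w by (simp add: field_simps)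
qed

text \<open>A circle with no strand at its height is moved next to the minimum above it or the
  maximum below it. Only a circle that is the whole diagram has no neighbour, and \<open>U\<close>
  covers it.\<close>

lemma circle_from_skein:
  assumes X: "framed a 0 X" "skein w 0 X" and w: "w \<noteq> 0"
    and U: "X [(Cap, 0), (Cup, 0)] = ((a + inverse a) / w - 1) * X []"
  shows "circle_factor ((a + inverse a) / w - 1) X"
  unfolding circle_factor_def
proof (intro allI impI)
  fix us i vs assume cl: "closed_tangle (us @ (Cap, i) # (Cup, i) # vs)"
  let ?g = "(a + inverse a) / w - 1"
  note X_ri = move_inv_ri[OF framed_move_inv[OF X(1)] _ HOL.refl]
  show "X (us @ (Cap, i) # (Cup, i) # vs) = ?g * X (us @ vs)"
  proof (cases "wd 0 us = 0")
    case False
    then show ?thesis using circle_beside[OF X w _ cl] by simp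
  next
    case w0: True
    have i: "i = 0" and ok: "ok 0 us" "ok 0 vs" "wd 0 vs = 0"
      using cl w0 by (auto simp: closed_tangle_def)
    show ?thesis
    proof (cases us rule: rev_cases)
      case (snoc us' ej)
      obtain e j where ej: "ej = (e, j)" by force
      have us': "us = us' @ [(Cup, 0)]" "wd 0 us' = 2" "ok 0 us'"
        using ok(1) w0 snoc ej by (cases e; auto)+
      have "ri 2 ([(Cup, 0), (Cap, 0)] @ [(Cup, 0)]) ([(Cap, 2), (Cup, 0)] @ [(Cup, 0)])"
        using ri_interchange[of 0 Cup 0 Cap 2] by (intro ri.suffix) (simp add: numeral_2_eq_2)
      also have "\<dots> = [(Cap, 2)] @ [(Cup, 0), (Cup, 0)]" by simp
      also have "ri 2 \<dots> ([(Cap, 2)] @ [(Cup, 2), (Cup, 0)])"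
        using ri_interchange[of 0 Cup 0 Cup "Suc (Suc 2)"] by (intro ri.prefix) (auto intro: ri.symmetric simp: numeral_2_eq_2)
      finally have r: "ri (wd 0 us') [(Cup, 0), (Cap, 0), (Cup, 0)] [(Cap, 2), (Cup, 2), (Cup, 0)]"
        using us' by simp
      have "X (us @ (Cap, i) # (Cup, i) # vs) = X (us' @ (Cap, 2) # (Cup, 2) # (Cup, 0) # vs)"
        using X_ri[OF r, of vs] us' ok i by (simp add: numeral_2_eq_2)
      also have "\<dots> = ?g * X (us' @ (Cup, 0) # vs)"
        by (rule circle_beside[OF X w]) (use us' ok in \<open>auto simp: closed_tangle_def\<close>)
      finally show ?thesis using us' by simp
    next
      case us: Nil
      show ?thesis
      proof (cases "vs = []")
        case True
        then show ?thesis using U us i by simp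
      next
        case False
        obtain vs' where vs: "vs = (Cap, 0) # vs'"
          using closed_Cap[of vs] False ok by (auto simp: closed_tangle_def)
        have "ri 0 ([(Cap, 0)] @ [(Cup, 0), (Cap, 0)]) ([(Cap, 0)] @ [(Cap, 2), (Cup, 0)])"
          using ri_interchange[of 0 Cup 0 Cap 2] by (intro ri.prefix) (simp add: numeral_2_eq_2)
        also have "\<dots> = [(Cap, 0), (Cap, 2)] @ [(Cup, 0)]" by simp
        also have "ri 0 \<dots> ([(Cap, 0), (Cap, 0)] @ [(Cup, 0)])"
          using ri_interchange[of 0 Cap 0 Cap 0] by (intro ri.suffix) (simp add: numeral_2_eq_2)
        finally have r: "ri (wd 0 []) [(Cap, 0), (Cup, 0), (Cap, 0)] [(Cap, 0), (Cap, 0), (Cup, 0)]"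
          by simp
        have "X (us @ (Cap, i) # (Cup, i) # vs) = X ([(Cap, 0)] @ (Cap, 0) # (Cup, 0) # vs')"
          using X_ri[OF r, of vs'] us ok i vs by (simp add: numeral_2_eq_2)
        also have "\<dots> = ?g * X ([(Cap, 0)] @ vs')"
          by (rule circle_beside[OF X w]) (use vs ok in \<open>auto simp: closed_tangle_def\<close>)
        finally show ?thesis using us vs by simp
      qed
    qed
  qed
qed

section \<open>Sums over colourings of the components by \<open>N\<close> colours\<close>

definition colour_sum :: "nat \<Rightarrow> (slices \<Rightarrow> real) \<Rightarrow> slices \<Rightarrow> real" where
  "colour_sum N q = tsum {..<N} (- 1) (\<lambda>r. \<Prod>b<N. q (r b)) []"

lemma prod_upd:
  "b < N \<Longrightarrow> (\<Prod>b'<N. q (if b' = b then s else r b')) = q s * (\<Prod>b' \<in> {..<N} - {b}. q (r b'))"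
  for q :: "slices \<Rightarrow> real" and N :: nat
  by (subst prod.remove[of "{..<N}" b]) (auto intro!: prod.cong)

lemma framed_mult:
  assumes "framed a m X"
  shows "framed a m (\<lambda>s. X s * c)"
  unfolding framed_def
proof (intro allI impI)
  fix us l r vs f
  assume "framed_move a f l r" "ok m (us @ l @ vs)" "ok m (us @ r @ vs)" "wd m (us @ l @ vs) = 0"
  from assms[unfolded framed_def, rule_format, OF this]
  show "X (us @ l @ vs) * c = f * (X (us @ r @ vs) * c)" by simp
qed

lemma skein_mult:
  assumes "skein w m X"
  shows "skein w m (\<lambda>s. X s * c)"
  unfolding skein_def
proof (intro allI impI)
  fix us i vs assume "ok m (us @ (Cross True, i) # vs)" "wd m (us @ (Cross True, i) # vs) = 0"
  from assms[unfolded skein_def, rule_format, OF this]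
  show "X (us @ (Cross True, i) # vs) * c + X (us @ (Cross False, i) # vs) * c =
      w * (X (us @ (Cup, i) # (Cap, i) # vs) * c + X (us @ vs) * c)"
    by (simp flip: distrib_right)
qed

lemma framed_colour_sum: "framed a 0 q \<Longrightarrow> framed a 0 (colour_sum N q)"
  unfolding colour_sum_def
  by (rule framed_tsum) (auto simp: fam_def prod_upd intro: framed_mult)

lemma colour_sum_skein:
  assumes q: "skein w 0 q" and cl: "closed_tangle (us @ (Cross True, i) # vs)" and sep: "sep us i vs []"
  shows "colour_sum N q (us @ (Cross True, i) # vs) + colour_sum N q (us @ (Cross False, i) # vs) =
    w * (colour_sum N q (us @ (Cup, i) # (Cap, i) # vs) + colour_sum N q (us @ vs))"
  unfolding colour_sum_def
proof (rule tsum_skein)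
  show "separable i vs us ([] :: nat list)"
    using sep by (auto simp: separable_def)
  show "fam (skein w) {..<N} [] (\<lambda>r. \<Prod>b<N. q (r b))"
    using q by (auto simp: fam_def prod_upd intro: skein_mult)
qed (use cl in \<open>auto simp: closed_tangle_def\<close>)

text \<open>The knots are read off one at a time, each with a free choice of colour;
  \<open>S b\<close> collects those that have already received colour \<open>b\<close>.\<close>

lemma tsum_unlinked:
  assumes mult: "\<And>D R. closed_tangle D \<Longrightarrow> closed_tangle R \<Longrightarrow> q (D @ R) = q D * q R"
    and "\<forall>K \<in> set Ds. is_knot K" "\<And>b. closed_tangle (S b)"
  shows "tsum {..<N} \<sigma> (\<lambda>r. \<Prod>b<N. q (S b @ r b)) [] (concat (map slices Ds)) =
    real N ^ length Ds * (\<Prod>K \<leftarrow> Ds. q (slices K)) * (\<Prod>b<N. q (S b))"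
  using assms(2-)
proof (induction Ds arbitrary: S)
  case (Cons K Ds)
  let ?c = "\<Prod>K \<leftarrow> Ds. q (slices K)"
  have "tsum {..<N} \<sigma> (\<lambda>r. \<Prod>b<N. q (S b @ r b)) [] (concat (map slices (K # Ds))) =
      (\<Sum>b<N. tsum {..<N} \<sigma> (\<lambda>r. \<Prod>b'<N. q (S b' @ (r(b := slices K @ r b)) b')) [] (concat (map slices Ds)))"
    using Cons.prems closed_append[OF closed_slices(1)[of K] closed_concat[of Ds]]
    by (simp add: tsum_knot closed_tangle_def)
  also have "\<dots> = (\<Sum>b<N. real N ^ length Ds * ?c * (q (slices K) * (\<Prod>b'<N. q (S b'))))"
  proof (intro sum.cong HOL.refl)
    fix b assume b: "b \<in> {..<N}"
    let ?S = "S(b := S b @ slices K)"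
    have e: "S b' @ (r(b := slices K @ r b)) b' = ?S b' @ r b'" for r b' by simp
    have "tsum {..<N} \<sigma> (\<lambda>r. \<Prod>b'<N. q (?S b' @ r b')) [] (concat (map slices Ds)) =
        real N ^ length Ds * ?c * (\<Prod>b'<N. q (?S b'))"
      by (rule Cons.IH) (use Cons.prems closed_append in auto)
    also have "(\<Prod>b'<N. q (?S b')) = q (slices K) * (\<Prod>b'<N. q (S b'))"
      using b prod_upd[of b N q "S b @ slices K" S] mult[OF Cons.prems(2)[of b] closed_slices(1)[of K]]
        prod.remove[of "{..<N}" b "\<lambda>b'. q (S b')"] by simp
    finally show "tsum {..<N} \<sigma> (\<lambda>r. \<Prod>b'<N. q (S b' @ (r(b := slices K @ r b)) b')) [] (concat (map slices Ds)) =
        real N ^ length Ds * ?c * (q (slices K) * (\<Prod>b'<N. q (S b')))"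
      unfolding e .
  qed
  finally show ?case by simp
qed simp

lemma colour_sum_unlinked:
  assumes mult: "\<And>D R. closed_tangle D \<Longrightarrow> closed_tangle R \<Longrightarrow> q (D @ R) = q D * q R" and "q [] = 1"
    and Ds: "\<forall>K \<in> set Ds. is_knot K"
  shows "colour_sum N q (concat (map slices Ds)) = real N ^ length Ds * q (concat (map slices Ds))"
proof -
  have "q (concat (map slices Ds)) = (\<Prod>K \<leftarrow> Ds. q (slices K))"
    using assms(2) by (induction Ds) (auto simp: mult closed_concat)
  then show ?thesis
    using tsum_unlinked[of q Ds "\<lambda>_. []" N "- 1"] assms by (simp add: colour_sum_def closed_tangle_def)
qed

lemma cnt_unlinked:
  assumes "\<forall>K \<in> set Ds. is_knot K"
  shows "cnt [] (concat (map slices Ds)) = 2 ^ length Ds"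
  using assms
proof (induction Ds)
  case (Cons K Ds)
  then show ?case
    using closed_append[OF closed_slices(1)[of K] closed_concat[of Ds]] tsum_knot[of K "UNIV :: bool set" "concat (map slices Ds)" 1]
    by (simp add: cnt_def closed_tangle_def)
qed simp

text \<open>
  The factor \<open>cnt [] ws powr log 2 (z / w)\<close> is \<open>(z / w)^c\<close> for a diagram with $c$ components. It turns
  the skein relation with coefficient \<open>w\<close> into that with coefficient \<open>z\<close>, as smoothing a mixed crossing
  merges two components.
\<close>

definition state_sum :: "nat \<Rightarrow> real \<Rightarrow> real \<Rightarrow> (slices \<Rightarrow> real) \<Rightarrow> slices \<Rightarrow> real" where
  "state_sum N z w q ws = cnt [] ws powr log 2 (z / w) * colour_sum N q ws"

lemma framed_state_sum:
  assumes "framed a 0 q"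
  shows "framed a 0 (state_sum N z w q)"
  unfolding framed_def
proof (intro allI impI)
  fix us l r vs f
  assume *: "framed_move a f l r" "ok 0 (us @ l @ vs)" "ok 0 (us @ r @ vs)" "wd 0 (us @ l @ vs) = 0"
  have "framed_move 1 1 l r" using *(1) by (auto simp: framed_move_def)
  from cnt_framed[unfolded framed_def, rule_format, OF this *(2-)]
  have "cnt [] (us @ l @ vs) = cnt [] (us @ r @ vs)" by simp
  with framed_colour_sum[OF assms, unfolded framed_def, rule_format, OF *]
  show "state_sum N z w q (us @ l @ vs) = f * state_sum N z w q (us @ r @ vs)"
    by (simp add: state_sum_def)
qed

lemma state_sum_skein:
  assumes q: "skein w 0 q" and cl: "closed_tangle (us @ (Cross True, i) # vs)" and sep: "sep us i vs []"
    and pos: "z > 0" "w > 0"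
  shows "state_sum N z w q (us @ (Cross True, i) # vs) + state_sum N z w q (us @ (Cross False, i) # vs) =
    z * (state_sum N z w q (us @ (Cup, i) # (Cap, i) # vs) + state_sum N z w q (us @ vs))"
proof -
  have cl': "closed_tangle (us @ (Cross s, i) # vs)" for s
    using cl by (auto simp: closed_tangle_def)
  let ?k = "cnt [] (us @ vs) powr log 2 (z / w)"
  \<comment> \<open>The crossing has twice as many 2-colourings as its smoothings, and 2 powr log 2
    (z / w) = z / w.\<close>
  have c: "cnt [] (us @ (Cross s, i) # vs) powr log 2 (z / w) = z / w * ?k" for s
    unfolding cnt_cross(1)[OF cl' sep] using pos cnt_nonneg by (simp add: powr_mult)
  have c0: "cnt [] (us @ (Cup, i) # (Cap, i) # vs) = cnt [] (us @ vs)"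
    using cnt_cross(2)[OF cl sep] .
  have "state_sum N z w q (us @ (Cross True, i) # vs) + state_sum N z w q (us @ (Cross False, i) # vs) =
      z / w * ?k * (colour_sum N q (us @ (Cross True, i) # vs) + colour_sum N q (us @ (Cross False, i) # vs))"
    by (simp add: state_sum_def c algebra_simps)
  also have "\<dots> = z * (?k * (colour_sum N q (us @ (Cup, i) # (Cap, i) # vs) + colour_sum N q (us @ vs)))"
    unfolding colour_sum_skein[OF q cl sep] using pos by simp
  finally show ?thesis by (simp add: state_sum_def c0 algebra_simps)
qed

lemma state_sum_unlinked:
  assumes mult: "\<And>D R. closed_tangle D \<Longrightarrow> closed_tangle R \<Longrightarrow> q (D @ R) = q D * q R" and "q [] = 1"
    and Ds: "\<forall>K \<in> set Ds. is_knot K" and pos: "z > 0" "w > 0"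
  shows "state_sum N z w q (concat (map slices Ds)) = (z / w * real N) ^ length Ds * q (concat (map slices Ds))"
proof -
  have "(2 ^ n) powr x = ((2 :: real) powr x) ^ n" for n :: nat and x
    by (induction n) (simp_all add: powr_mult)
  then have "(2 ^ length Ds) powr log 2 (z / w) = (z / w) ^ length Ds"
    using pos by simp
  then show ?thesis
    using colour_sum_unlinked[OF mult assms(2) Ds, of N] cnt_unlinked[OF Ds]
    by (simp add: state_sum_def power_mult_distrib power_divide)
qed

section \<open>Evaluation of Laurent polynomials\<close>

abbreviation (input) "lookup \<equiv> Poly_Mapping.lookup"
abbreviation (input) "keys \<equiv> Poly_Mapping.keys"

definition evalp :: "('k \<Rightarrow> real) \<Rightarrow> ('k \<Rightarrow>\<^sub>0 int) \<Rightarrow> real" where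
  "evalp m p = (\<Sum>k \<in> keys p. of_int (lookup p k) * m k)"

lemma evalp_superset:
  "finite S \<Longrightarrow> keys p \<subseteq> S \<Longrightarrow> evalp m p = (\<Sum>k \<in> S. of_int (lookup p k) * m k)"
  unfolding evalp_def by (rule sum.mono_neutral_left) (auto simp: in_keys_iff)

lemma evalp_single [simp]: "evalp m (Poly_Mapping.single k v) = of_int v * m k"
  by (subst evalp_superset[of "{k}"]) auto

lemma evalp_0 [simp]: "evalp m 0 = 0"
  by (simp add: evalp_def)

lemma evalp_add [simp]: "evalp m (p + q) = evalp m p + evalp m q"
proof -
  let ?S = "keys p \<union> keys q"
  have "keys (p + q) \<subseteq> ?S" by (rule keys_add)
  then show ?thesis
    by (simp add: evalp_superset[of ?S] lookup_add sum.distrib distrib_right)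
qed

lemma evalp_uminus [simp]: "evalp m (- p) = - evalp m p"
  using evalp_add[of m p "- p"] by simp

lemma evalp_minus [simp]: "evalp m (p - q) = evalp m p - evalp m q"
  using evalp_add[of m p "- q"] by simp

lemma evalp_sum [simp]: "evalp m (sum f A) = (\<Sum>x \<in> A. evalp m (f x))"
  by (induction A rule: infinite_finite_induct) auto

lemma sum_single: "(\<Sum>k \<in> keys p. Poly_Mapping.single k (lookup p k)) = p"
  by (rule poly_mapping_eqI)
    (auto simp: lookup_sum lookup_single when_def in_keys_iff intro: sum.neutral)

lemma evalp_mult:
  assumes m: "\<And>j k. m (j + k) = m j * m k"
  shows "evalp m (p * q) = evalp m p * evalp m q"
proof -
  have "p * q = (\<Sum>j \<in> keys p. Poly_Mapping.single j (lookup p j)) * (\<Sum>k \<in> keys q. Poly_Mapping.single k (lookup q k))"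
    by (simp add: sum_single)
  also have "evalp m \<dots> = (\<Sum>j \<in> keys p. \<Sum>k \<in> keys q. (of_int (lookup p j) * m j) * (of_int (lookup q k) * m k))"
    by (simp add: sum_product mult_single m mult_ac)
  also have "\<dots> = evalp m p * evalp m q"
    by (simp add: evalp_def sum_product)
  finally show ?thesis .
qed

fun mono2 :: "real \<Rightarrow> real \<Rightarrow> int \<times> int \<Rightarrow> real" where
  "mono2 w a (i, j) = w powi i * a powi j"

fun mono4 :: "real \<Rightarrow> real \<Rightarrow> real \<Rightarrow> real \<Rightarrow> nat \<times> int \<times> int \<times> int \<Rightarrow> real" where
  "mono4 z w a e (h, i, j, k) = z ^ h * w powi i * a powi j * e powi k"

lemma mono2_add: "w \<noteq> 0 \<Longrightarrow> a \<noteq> 0 \<Longrightarrow> mono2 w a (x + y) = mono2 w a x * mono2 w a y"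
  by (cases x; cases y) (simp add: power_int_add)

lemma mono4_add:
  "w \<noteq> 0 \<Longrightarrow> a \<noteq> 0 \<Longrightarrow> e \<noteq> 0 \<Longrightarrow> mono4 z w a e (x + y) = mono4 z w a e x * mono4 z w a e y"
  by (cases x; cases y) (simp add: power_int_add power_add)

lemma evalp_monom_wa: "evalp (mono2 w a) (monom_wa i j) = w powi i * a powi j"
  by (simp add: monom_wa_def)

lemma evalp_one_wa: "evalp (mono2 w a) 1 = 1"
  by (simp add: zero_prod_def flip: single_one)

lemma evalp_var_z: "evalp (mono4 z w a e) var_z = z"
  by (simp add: var_z_def)

lemma evalp_E_power: "evalp (mono4 z w a e) (E_power k) = e powi k"
  by (simp add: E_power_def)

lemma evalp_embed: "evalp (mono4 z w a e) (embed_wa p) = evalp (mono2 w a) p"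
  unfolding embed_wa_def by (simp add: evalp_def[of "mono2 w a"] case_prod_unfold)
    (auto intro!: sum.cong)

section \<open>A Laurent polynomial is determined by its values\<close>

lemma power_int_tendsto_0:
  assumes "e < 0"
  shows "(\<lambda>n. real n powi e) \<longlonglongrightarrow> 0"
proof -
  have "(\<lambda>n. inverse (real n) ^ nat (- e)) \<longlonglongrightarrow> 0 ^ nat (- e)"
    by (intro tendsto_power lim_inverse_n)
  then show ?thesis using assms by (simp add: power_int_def zero_power)
qed

text \<open>After division by the highest power, its coefficient is the limit for large
  \<open>n\<close>, so it would be 0.\<close>

lemma laurent_zero:
  fixes c :: "'k \<Rightarrow> real" and d :: "'k \<Rightarrow> int"
  assumes "finite S" "inj_on d S" "\<forall>\<^sub>F n in sequentially. (\<Sum>k \<in> S. c k * real n powi d k) = 0"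
    and nz: "\<And>k. k \<in> S \<Longrightarrow> c k \<noteq> 0"
  shows "S = {}"
proof (rule ccontr)
  assume "S \<noteq> {}"
  then have "Max (d ` S) \<in> d ` S" using assms(1) by (intro Max_in) auto
  then obtain k0 where k0: "k0 \<in> S" "d k0 = Max (d ` S)" by auto
  have less: "d k < d k0" if "k \<in> S - {k0}" for k
  proof -
    have "d k \<le> d k0" unfolding k0(2) using that assms(1) by (intro Max_ge) auto
    moreover have "d k \<noteq> d k0" using that k0(1) assms(2) by (auto simp: inj_on_def)
    ultimately show ?thesis by simp
  qed
  have "(\<lambda>n. c k0 + (\<Sum>k \<in> S - {k0}. c k * real n powi (d k - d k0))) \<longlonglongrightarrow> c k0 + (\<Sum>k \<in> S - {k0}. c k * 0)"
    by (intro tendsto_intros power_int_tendsto_0) (use less in auto)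
  moreover have "\<forall>\<^sub>F n in sequentially. c k0 + (\<Sum>k \<in> S - {k0}. c k * real n powi (d k - d k0)) = 0"
    using assms(3) eventually_gt_at_top[of 0]
  proof eventually_elim
    case (elim n)
    have "c k0 + (\<Sum>k \<in> S - {k0}. c k * real n powi (d k - d k0)) =
        (\<Sum>k \<in> S. c k * real n powi (d k - d k0))"
      using elim(2) by (simp add: sum.remove[OF assms(1) k0(1)])
    also have "\<dots> = (\<Sum>k \<in> S. c k * real n powi d k) * real n powi (- d k0)"
      using elim(2) by (simp add: sum_distrib_right mult.assoc flip: power_int_add)
    finally show ?case using elim(1) by simp
  qed
  ultimately have "(\<lambda>n. 0 :: real) \<longlonglongrightarrow> c k0"
    using Lim_transform_eventually by fastforce
  then have "c k0 = 0" by (simp add: LIMSEQ_const_iff)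
  then show False using nz k0(1) by blast
qed

lemma digit_unique:
  fixes B :: int
  assumes "x + B * y = x' + B * y'" "\<bar>x - x'\<bar> < B"
  shows "x = x' \<and> y = y'"
proof -
  have "B * (y' - y) = x - x'" using assms(1) by (simp add: algebra_simps)
  then have "B dvd x - x'" by (metis dvd_triv_left)
  then have "x - x' = 0" using assms(2) dvd_imp_le_int[of "x - x'" B] by linarith
  with assms show ?thesis by auto
qed

text \<open>
  Evaluate at \<open>a = t\<close>, \<open>w = t^B\<close>, \<open>z = t^(B^2)\<close>, \<open>N = t^(B^3)\<close>: for large \<open>B\<close> different monomials yield different
  powers of \<open>t\<close>.
\<close>

lemma evalp_separation:
  fixes p :: laurent_zwaE
  assumes zero: "\<And>N z w a. N \<ge> 1 \<Longrightarrow> z > 0 \<Longrightarrow> w > 0 \<Longrightarrow> a > 0 \<Longrightarrow> (a + inverse a) / w - 1 \<noteq> 0 \<Longrightarrow>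
      evalp (mono4 z w a (w / (real N * z))) p = 0"
  shows "p = 0"
proof -
  define b where "b = (\<lambda>(h, i, j, k). int h + \<bar>i\<bar> + \<bar>j\<bar> + \<bar>k\<bar> :: int)"
  define M where "M = (\<Sum>x \<in> keys p. b x)"
  have b0: "b x \<ge> 0" for x by (cases x) (auto simp: b_def)
  have bM: "b x \<le> M" if "x \<in> keys p" for x
    unfolding M_def using that b0 by (intro member_le_sum) auto
  have M0: "M \<ge> 0" unfolding M_def using b0 by (intro sum_nonneg) auto
  \<comment> \<open>The digits of \<open>d\<close> below are at most \<open>M\<close> in absolute
    value, so two of them differ by less than \<open>C\<close>. That \<open>C\<close> is at least 2
    keeps w = t^C away from t + 1/t, where \<gamma> vanishes.\<close>
  define C where "C = nat (4 * M + 2)"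
  define B where "B = int C"
  have B: "B > 4 * M" "B \<ge> 2" using M0 by (auto simp: B_def C_def)
  have C2: "C \<ge> 2" using M0 by (simp add: C_def)
  \<comment> \<open>The exponent of t in z^h w^i a^j E^k, written in base \<open>B\<close>, where E
    = w / (N z) = t^(B - B^2 - B^3).\<close>
  define d :: "nat \<times> int \<times> int \<times> int \<Rightarrow> int" where
    "d = (\<lambda>(h, i, j, k). j + B * ((i + k) + B * ((int h - k) + B * (- k))))"
  have inj: "inj_on d (keys p)"
  proof (rule inj_onI)
    fix x x' assume x: "x \<in> keys p" "x' \<in> keys p" and e: "d x = d x'"
    obtain h i j k where 1: "x = (h, i, j, k)" by (cases x)
    obtain h' i' j' k' where 2: "x' = (h', i', j', k')" by (cases x')
    have le: "int h + \<bar>i\<bar> + \<bar>j\<bar> + \<bar>k\<bar> \<le> M" "int h' + \<bar>i'\<bar> + \<bar>j'\<bar> + \<bar>k'\<bar> \<le> M"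
      using bM[OF x(1)] bM[OF x(2)] by (simp_all add: 1 2 b_def)
    have "j + B * ((i + k) + B * ((int h - k) + B * (- k))) = j' + B * ((i' + k') + B * ((int h' - k') + B * (- k')))"
      using e by (simp add: d_def 1 2)
    moreover have "\<bar>j - j'\<bar> < B" using le B by linarith
    ultimately have j: "j = j'"
      and e1: "(i + k) + B * ((int h - k) + B * (- k)) = (i' + k') + B * ((int h' - k') + B * (- k'))"
      using digit_unique by blast+
    have "\<bar>(i + k) - (i' + k')\<bar> < B" using le B by linarith
    from digit_unique[OF e1 this] have ik: "i + k = i' + k'"
      and e2: "(int h - k) + B * (- k) = (int h' - k') + B * (- k')" by blast+
    have "\<bar>(int h - k) - (int h' - k')\<bar> < B" using le B by linarith
    from digit_unique[OF e2 this] have "int h - k = int h' - k'" "- k = - k'" by blast+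
    with j ik show "x = x'" by (simp add: 1 2)
  qed
  have "\<forall>\<^sub>F t in sequentially. (\<Sum>x \<in> keys p. of_int (lookup p x) * real t powi d x) = 0"
    using eventually_ge_at_top[of 2]
  proof eventually_elim
    case (elim t)
    let ?t = "real t"
    have t: "?t \<ge> 2" "?t \<noteq> 0" using elim by auto
    have m: "mono4 (?t ^ (C ^ 2)) (?t ^ C) ?t (?t ^ C / (real (t ^ (C ^ 3)) * ?t ^ (C ^ 2))) x = ?t powi d x" for x
    proof -
      obtain h i j k where x: "x = (h, i, j, k)" by (cases x)
      have p: "?t powi B = ?t ^ C" "?t powi (B ^ n) = ?t ^ (C ^ n)" for n
        using power_int_of_nat[of ?t C] power_int_of_nat[of ?t "C ^ n"] by (simp_all add: B_def)
      have "?t ^ C / (real (t ^ (C ^ 3)) * ?t ^ (C ^ 2)) = ?t powi (B - B ^ 3 - B ^ 2)"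
        using t(2) by (simp only: power_int_diff p of_nat_power divide_divide_eq_left simp_thms)
      moreover have "(?t ^ (C ^ 2)) ^ h = ?t powi (B ^ 2 * int h)"
        by (simp only: power_int_mult p power_int_of_nat)
      moreover have "(?t ^ C) powi i = ?t powi (B * i)"
        by (simp only: power_int_mult p)
      ultimately have "mono4 (?t ^ (C ^ 2)) (?t ^ C) ?t (?t ^ C / (real (t ^ (C ^ 3)) * ?t ^ (C ^ 2))) x =
          ?t powi (B ^ 2 * int h) * ?t powi (B * i) * ?t powi j * ?t powi ((B - B ^ 3 - B ^ 2) * k)"
        by (simp add: x power_int_mult)
      also have "\<dots> = ?t powi (B ^ 2 * int h + B * i + j + (B - B ^ 3 - B ^ 2) * k)"
        using t(2) by (simp add: power_int_add)
      also have "B ^ 2 * int h + B * i + j + (B - B ^ 3 - B ^ 2) * k = d x"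
        by (simp add: d_def x algebra_simps power2_eq_square power3_eq_cube)
      finally show ?thesis .
    qed
    have "?t + inverse ?t \<noteq> ?t ^ C"
    proof -
      have "inverse ?t \<le> 1" using t by (simp add: field_simps)
      then have "?t + inverse ?t < 2 * ?t" using t by linarith
      also have "\<dots> \<le> ?t ^ 2" using t by (simp add: power2_eq_square)
      also have "\<dots> \<le> ?t ^ C" using t C2 by (intro power_increasing) auto
      finally show ?thesis by simp
    qed
    then have "evalp (mono4 (?t ^ (C ^ 2)) (?t ^ C) ?t (?t ^ C / (real (t ^ (C ^ 3)) * ?t ^ (C ^ 2)))) p = 0"
      using t elim by (intro zero) (auto simp: field_simps)
    then show ?case unfolding evalp_def m .
  qed
  from laurent_zero[OF _ inj this] have "keys p = {}" by (simp add: in_keys_iff)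
  then show "p = 0" by simp
qed

section \<open>The invariant\<close>

text \<open>A link diagram is non-empty while a tangle may be empty; moves on closed diagrams must
  not leave the type.\<close>

lemma basic_move_not_Nil:
  assumes "basic_move l r" "ok 0 l"
  shows "l \<noteq> [] \<and> r \<noteq> []"
  using assms by (cases rule: basic_move_cases) auto

lemma basic_move_context_not_Nil:
  assumes "basic_move l r" "ok 0 (us @ l @ vs)"
  shows "us @ l @ vs \<noteq> [] \<and> us @ r @ vs \<noteq> []"
proof (cases "us @ vs = []")
  case True
  then show ?thesis using basic_move_not_Nil[OF assms(1)] assms(2) by simp
next
  case False
  then show ?thesis by auto
qed

lemma curl_context_not_Nil:
  assumes "curl s l r" "ok 0 (us @ l @ vs)"
  shows "us @ l @ vs \<noteq> [] \<and> us @ r @ vs \<noteq> []"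
  using assms by (cases us) (auto elim: curl.cases)

lemma closed_replace:
  "basic_move l r \<or> curl s l r \<Longrightarrow> ok 0 (us @ l @ vs) \<Longrightarrow> ok 0 (us @ r @ vs) \<Longrightarrow> wd 0 (us @ l @ vs) = 0 \<Longrightarrow>
    closed_tangle (us @ l @ vs) \<and> closed_tangle (us @ r @ vs)"
  using basic_move_wd[of l r "wd 0 us"] by (auto simp: closed_tangle_def elim!: curl.cases)

lemma replacesI:
  assumes "R l r" "closed_tangle (us @ l @ vs)" "closed_tangle (us @ r @ vs)" "us @ l @ vs \<noteq> []" "us @ r @ vs \<noteq> []"
  shows "replaces R (Abs_link_diagram (us @ l @ vs)) (Abs_link_diagram (us @ r @ vs))"
  using assms unfolding replaces_def by (intro exI[of _ us] exI[of _ vs] exI[of _ l] exI[of _ r]) simp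

lemma regular_isotopy_invariant_move_inv:
  assumes "regular_isotopy_invariant I"
  shows "move_inv 0 (\<lambda>ws. I (Abs_link_diagram ws))"
  unfolding move_inv_def
proof (intro allI impI)
  fix us l r vs
  assume *: "basic_move l r" "ok 0 (us @ l @ vs)" "ok 0 (us @ r @ vs)" "wd 0 (us @ l @ vs) = 0"
  have "replaces basic_move (Abs_link_diagram (us @ l @ vs)) (Abs_link_diagram (us @ r @ vs))"
    using closed_replace[of l r True us vs] basic_move_context_not_Nil[OF *(1,2)] * by (intro replacesI) auto
  then have "regular_isotopic (Abs_link_diagram (us @ l @ vs)) (Abs_link_diagram (us @ r @ vs))"
    unfolding regular_isotopic_def by (rule r_into_equivclp)
  then show "I (Abs_link_diagram (us @ l @ vs)) = I (Abs_link_diagram (us @ r @ vs))"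
    using assms by (simp add: regular_isotopy_invariant_def)
qed

lemma move_inv_regular_isotopy_invariant:
  assumes "move_inv 0 X"
  shows "regular_isotopy_invariant (\<lambda>D. X (slices D))"
proof -
  have step: "X (slices D) = X (slices D')" if "replaces basic_move D D'" for D D'
  proof -
    from that obtain us vs l r where *: "basic_move l r" "slices D = us @ l @ vs" "slices D' = us @ r @ vs"
      by (auto simp: replaces_def)
    then show ?thesis
      using assms[unfolded move_inv_def, rule_format, OF *(1), of us vs] closed_slices(1)[of D] closed_slices(1)[of D']
      by (simp add: closed_tangle_def)
  qed
  have "X (slices D) = X (slices D')" if "regular_isotopic D D'" for D D'
    using that unfolding regular_isotopic_def
    by (induction rule: equivclp_induct) (auto dest: step)
  then show ?thesis by (simp add: regular_isotopy_invariant_def)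
qed

text \<open>Kinks change \<open>Y\<close> by non-zero factors only, so its vanishing, unlike its
  value, is invariant under full isotopy.\<close>

lemma framed_isotopic:
  assumes "framed a 0 Y" "a \<noteq> 0" "isotopic D S"
  shows "Y (slices D) = 0 \<longleftrightarrow> Y (slices S) = 0"
proof -
  let ?R = "sup planar_move (sup (curl True) (sup (curl False) (sup reidemeister2 reidemeister3)))"
  have step: "Y (slices D) = 0 \<longleftrightarrow> Y (slices D') = 0" if "replaces ?R D D'" for D D'
  proof -
    from that obtain us vs l r where *: "?R l r" "slices D = us @ l @ vs" "slices D' = us @ r @ vs"
      by (auto simp: replaces_def)
    from *(1) have "basic_move l r \<or> (\<exists>s. curl s l r)" by auto
    then obtain f where f: "f \<noteq> 0" "framed_move a f l r"
    proof
      assume "basic_move l r"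
      then show ?thesis by (intro that[of 1]) (auto simp: framed_move_def)
    next
      assume "\<exists>s. curl s l r"
      then obtain s where "curl s l r" ..
      from framed_move_curl[OF this, of a] assms(2) show ?thesis
        by (intro that[of "if s then a else inverse a"]) auto
    qed
    show ?thesis
      using assms(1)[unfolded framed_def, rule_format, OF f(2), of us vs] closed_slices(1)[of D] closed_slices(1)[of D'] * f(1)
      by (simp add: closed_tangle_def)
  qed
  show ?thesis
    using assms(3) unfolding isotopic_def
    by (induction rule: equivclp_induct) (auto dest: step)
qed

lemma conway_quadruple_atI:
  assumes "closed_tangle (us @ (Cross True, i) # vs)"
  shows "conway_quadruple_at us i (Abs_link_diagram (us @ (Cross True, i) # vs)) (Abs_link_diagram (us @ (Cross False, i) # vs))
    (Abs_link_diagram (us @ (Cup, i) # (Cap, i) # vs)) (Abs_link_diagram (us @ vs))"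
proof -
  have "closed_tangle (us @ (Cross False, i) # vs)" "closed_tangle (us @ (Cup, i) # (Cap, i) # vs)" "closed_tangle (us @ vs)"
    "us @ vs \<noteq> []"
    using assms by (auto simp: closed_tangle_def)
  with assms show ?thesis unfolding conway_quadruple_at_def by simp
qed

lemma unlinked_concat:
  assumes "\<forall>K \<in> set Ds. is_knot K" "Ds \<noteq> []"
  shows "unlinked_knots (length Ds) (Abs_link_diagram (concat (map slices Ds)))"
    "slices (Abs_link_diagram (concat (map slices Ds))) = concat (map slices Ds)"
proof -
  show s: "slices (Abs_link_diagram (concat (map slices Ds))) = concat (map slices Ds)"
    using assms(2) closed_slices(2) by (intro slices_Abs closed_concat) (cases Ds, auto)
  show "unlinked_knots (length Ds) (Abs_link_diagram (concat (map slices Ds)))"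
    using assms s unfolding unlinked_knots_def isotopic_def
    by (intro exI[of _ Ds] exI[of _ "Abs_link_diagram (concat (map slices Ds))"]) simp
qed

context
  fixes Q :: "link_diagram \<Rightarrow> laurent_wa"
  assumes Q: "kauffman_polynomial Q"
begin

text \<open>Multiplicativity forces the value 1 on the empty diagram, and then \<gamma> on the
  unknot.\<close>

definition kauffman_eval :: "real \<Rightarrow> real \<Rightarrow> slices \<Rightarrow> real" where
  "kauffman_eval w a ws = (if ws = [] then 1 else ((a + inverse a) / w - 1) * evalp (mono2 w a) (Q (Abs_link_diagram ws)))"

lemma kauffman_eval_not_Nil:
  "ws \<noteq> [] \<Longrightarrow> kauffman_eval w a ws = ((a + inverse a) / w - 1) * evalp (mono2 w a) (Q (Abs_link_diagram ws))"
  by (simp add: kauffman_eval_def)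

lemma kauffman_eval_framed:
  assumes "w > 0" "a > 0"
  shows "framed a 0 (kauffman_eval w a)"
  unfolding framed_def
proof (intro allI impI)
  fix us l r vs f
  assume *: "framed_move a f l r" "ok 0 (us @ l @ vs)" "ok 0 (us @ r @ vs)" "wd 0 (us @ l @ vs) = 0"
  let ?D = "Abs_link_diagram (us @ l @ vs)" and ?D' = "Abs_link_diagram (us @ r @ vs)"
  note hom = evalp_mult[of "mono2 w a", OF mono2_add]
  from *(1) consider (basic) "f = 1" "basic_move l r" | (pos) "f = a" "curl True l r" | (neg) "f = inverse a" "curl False l r"
    by (auto simp: framed_move_def)
  then show "kauffman_eval w a (us @ l @ vs) = f * kauffman_eval w a (us @ r @ vs)"
  proof cases
    case basic
    have Q_inv: "move_inv 0 (\<lambda>ws. Q (Abs_link_diagram ws))"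
      using Q by (intro regular_isotopy_invariant_move_inv) (simp add: kauffman_polynomial_def)
    note ne = basic_move_context_not_Nil[OF basic(2) *(2)]
    from Q_inv[unfolded move_inv_def, rule_format, OF basic(2) *(2-4)] show ?thesis
      by (simp only: kauffman_eval_not_Nil[OF ne[THEN conjunct1]] kauffman_eval_not_Nil[OF ne[THEN conjunct2]] basic(1) mult_1)
  next
    case pos
    note ne = curl_context_not_Nil[OF pos(2) *(2)]
    have "replaces (curl True) ?D ?D'"
      using closed_replace[of l r True us vs] ne pos * by (intro replacesI) auto
    then have "Q ?D = monom_wa 0 1 * Q ?D'" using Q by (simp add: kauffman_polynomial_def)
    then show ?thesis
      unfolding kauffman_eval_not_Nil[OF ne[THEN conjunct1]] kauffman_eval_not_Nil[OF ne[THEN conjunct2]]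
      using assms pos(1) by (simp add: hom evalp_monom_wa)
  next
    case neg
    note ne = curl_context_not_Nil[OF neg(2) *(2)]
    have "replaces (curl False) ?D ?D'"
      using closed_replace[of l r False us vs] ne neg * by (intro replacesI) auto
    then have "Q ?D = monom_wa 0 (- 1) * Q ?D'" using Q by (simp add: kauffman_polynomial_def)
    then show ?thesis
      unfolding kauffman_eval_not_Nil[OF ne[THEN conjunct1]] kauffman_eval_not_Nil[OF ne[THEN conjunct2]]
      using assms neg(1) by (simp add: hom evalp_monom_wa)
  qed
qed

lemma kauffman_eval_skein:
  assumes "w > 0" "a > 0"
  shows "skein w 0 (kauffman_eval w a)"
  unfolding skein_def
proof (intro allI impI)
  fix us i vs
  assume *: "ok 0 (us @ (Cross True, i) # vs)" "wd 0 (us @ (Cross True, i) # vs) = 0"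
  let ?g = "(a + inverse a) / w - 1"
  let ?e = "\<lambda>ws. evalp (mono2 w a) (Q (Abs_link_diagram ws))"
  have ne: "us @ vs \<noteq> []" using * by auto
  have "Q (Abs_link_diagram (us @ (Cross True, i) # vs)) + Q (Abs_link_diagram (us @ (Cross False, i) # vs)) =
      monom_wa 1 0 * (Q (Abs_link_diagram (us @ (Cup, i) # (Cap, i) # vs)) + Q (Abs_link_diagram (us @ vs)))"
  proof -
    have "conway_quadruple (Abs_link_diagram (us @ (Cross True, i) # vs)) (Abs_link_diagram (us @ (Cross False, i) # vs))
        (Abs_link_diagram (us @ (Cup, i) # (Cap, i) # vs)) (Abs_link_diagram (us @ vs))"
      using conway_quadruple_atI[of us i vs] * unfolding conway_quadruple_def closed_tangle_def by blast
    then show ?thesis using Q unfolding kauffman_polynomial_def by blast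
  qed
  from arg_cong[OF this, of "evalp (mono2 w a)"] assms
  have "?e (us @ (Cross True, i) # vs) + ?e (us @ (Cross False, i) # vs) =
      w * (?e (us @ (Cup, i) # (Cap, i) # vs) + ?e (us @ vs))"
    by (simp add: evalp_mult[of "mono2 w a", OF mono2_add] evalp_monom_wa)
  from arg_cong[OF this, of "\<lambda>x. ?g * x"] ne
  show "kauffman_eval w a (us @ (Cross True, i) # vs) + kauffman_eval w a (us @ (Cross False, i) # vs) =
      w * (kauffman_eval w a (us @ (Cup, i) # (Cap, i) # vs) + kauffman_eval w a (us @ vs))"
    by (simp add: kauffman_eval_not_Nil kauffman_eval_not_Nil[OF ne] distrib_left mult.left_commute del: append_is_Nil_conv)
qed

lemma kauffman_eval_mult:
  assumes "w > 0" "a > 0" "closed_tangle D" "closed_tangle R"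
  shows "kauffman_eval w a (D @ R) = kauffman_eval w a D * kauffman_eval w a R"
proof (rule split_union_mult[OF kauffman_eval_framed kauffman_eval_skein])
  have "Q (Abs_link_diagram [(Cap, 0), (Cup, 0)]) = 1"
    using Q by (simp add: kauffman_polynomial_def unknot_diagram_def)
  then show "circle_factor ((a + inverse a) / w - 1) (kauffman_eval w a)"
    using assms by (intro circle_from_skein kauffman_eval_framed kauffman_eval_skein)
      (auto simp: kauffman_eval_def evalp_one_wa)
qed (use assms in \<open>auto simp: kauffman_eval_def\<close>)

text \<open>The factor in front of \<open>evalp\<close> is the state sum of the unknot.\<close>

definition state_poly :: "slices \<Rightarrow> laurent_zwaE \<Rightarrow> bool" where
  "state_poly ws p \<longleftrightarrow> (\<forall>N z w a. N \<ge> 1 \<longrightarrow> z > 0 \<longrightarrow> w > 0 \<longrightarrow> a > 0 \<longrightarrow>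
     (z / w * real N) * ((a + inverse a) / w - 1) * evalp (mono4 z w a (w / (real N * z))) p =
       state_sum N z w (kauffman_eval w a) ws)"

text \<open>The prefactor can be cancelled wherever \<gamma> is not 0, and those points suffice for
  \<open>evalp_separation\<close>.\<close>

lemma state_poly_unique:
  assumes "state_poly ws p" "state_poly ws p'"
  shows "p = p'"
proof -
  have "p - p' = 0"
  proof (rule evalp_separation)
    fix N :: nat and z w a :: real
    assume *: "N \<ge> 1" "z > 0" "w > 0" "a > 0" and g: "(a + inverse a) / w - 1 \<noteq> 0"
    from assms(1)[unfolded state_poly_def, rule_format, OF *] assms(2)[unfolded state_poly_def, rule_format, OF *]
    have "(z / w * real N) * ((a + inverse a) / w - 1) * evalp (mono4 z w a (w / (real N * z))) p =
        (z / w * real N) * ((a + inverse a) / w - 1) * evalp (mono4 z w a (w / (real N * z))) p'" by simp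
    moreover have "(z / w * real N) * ((a + inverse a) / w - 1) \<noteq> 0" using * g by simp
    ultimately show "evalp (mono4 z w a (w / (real N * z))) (p - p') = 0"
      by (simp only: mult_cancel_left evalp_minus) simp
  qed
  then show ?thesis by simp
qed

lemma state_poly_move_inv: "move_inv 0 (\<lambda>ws. state_poly ws p)"
  unfolding move_inv_def
proof (intro allI impI)
  fix us l r vs
  assume *: "basic_move l r" "ok 0 (us @ l @ vs)" "ok 0 (us @ r @ vs)" "wd 0 (us @ l @ vs) = 0"
  have "state_sum N z w (kauffman_eval w a) (us @ l @ vs) = state_sum N z w (kauffman_eval w a) (us @ r @ vs)"
    if "w > 0" "a > 0" for N z w a
    using framed_move_inv[OF framed_state_sum[OF kauffman_eval_framed[OF that]]]
    unfolding move_inv_def using * by blast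
  then show "state_poly (us @ l @ vs) p = state_poly (us @ r @ vs) p"
    by (simp add: state_poly_def)
qed

lemma state_poly_skein:
  assumes cl: "closed_tangle (us @ (Cross s, i) # vs)" and sep: "sep us i vs []"
    and p: "state_poly (us @ (Cross (\<not> s), i) # vs) p" "state_poly (us @ (Cup, i) # (Cap, i) # vs) p0"
      "state_poly (us @ vs) p'"
  shows "state_poly (us @ (Cross s, i) # vs) (var_z * (p0 + p') - p)"
  unfolding state_poly_def
proof (intro allI impI)
  fix N :: nat and z w a :: real
  assume *: "N \<ge> 1" "z > 0" "w > 0" "a > 0"
  let ?k = "(z / w * real N) * ((a + inverse a) / w - 1)" and ?m = "mono4 z w a (w / (real N * z))"
  let ?V = "state_sum N z w (kauffman_eval w a)"
  have cl': "closed_tangle (us @ (Cross True, i) # vs)"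
    using cl by (auto simp: closed_tangle_def)
  have hom: "evalp ?m (x * y) = evalp ?m x * evalp ?m y" for x y
    using * by (intro evalp_mult mono4_add) auto
  have "?V (us @ (Cross True, i) # vs) + ?V (us @ (Cross False, i) # vs) =
      z * (?V (us @ (Cup, i) # (Cap, i) # vs) + ?V (us @ vs))"
    using * by (intro state_sum_skein[OF _ cl' sep] kauffman_eval_skein) auto
  then have "?V (us @ (Cross s, i) # vs) = z * (?V (us @ (Cup, i) # (Cap, i) # vs) + ?V (us @ vs)) -
      ?V (us @ (Cross (\<not> s), i) # vs)"
    by (cases s) auto
  also have "\<dots> = z * (?k * evalp ?m p0 + ?k * evalp ?m p') - ?k * evalp ?m p"
    using p[unfolded state_poly_def, rule_format, OF *] by simp
  also have "\<dots> = ?k * evalp ?m (var_z * (p0 + p') - p)"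
    unfolding evalp_minus hom evalp_add evalp_var_z by (simp add: algebra_simps)
  finally show "?k * evalp ?m (var_z * (p0 + p') - p) = ?V (us @ (Cross s, i) # vs)" by simp
qed

text \<open>\<open>D\<close> need not be a stack of knots, nor regularly isotopic to one. The
  formula is computed on the stack \<open>S\<close> and stated as the vanishing of a framed
  function, which \<open>framed_isotopic\<close> carries over to \<open>D\<close>.\<close>

lemma state_poly_unlinked:
  assumes "unlinked_knots r D" "1 \<le> r"
  shows "state_poly (slices D) (E_power (1 - int r) * embed_wa (Q D))"
  unfolding state_poly_def
proof (intro allI impI)
  fix N :: nat and z w a :: real
  assume *: "N \<ge> 1" "z > 0" "w > 0" "a > 0"
  let ?k = "(z / w * real N) * ((a + inverse a) / w - 1)" and ?m = "mono4 z w a (w / (real N * z))"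
  let ?V = "state_sum N z w (kauffman_eval w a)" and ?q = "kauffman_eval w a"
  let ?c = "z / w * real N"
  from assms(1) obtain Ks S where Ks: "length Ks = r" "\<forall>K \<in> set Ks. is_knot K"
    "slices S = concat (map slices Ks)" "isotopic D S" by (auto simp: unlinked_knots_def)
  have "?V (slices S) = ?c ^ r * ?q (slices S)"
    unfolding Ks(3) Ks(1)[symmetric] using * Ks(2)
    by (intro state_sum_unlinked kauffman_eval_mult) (auto simp: kauffman_eval_def)
  moreover have "framed a 0 (\<lambda>ws. ?V ws - ?c ^ r * ?q ws)"
    using * by (intro framed_linear framed_state_sum kauffman_eval_framed)
  ultimately have V: "?V (slices D) = ?c ^ r * ?q (slices D)"
    using framed_isotopic[of a "\<lambda>ws. ?V ws - ?c ^ r * ?q ws", OF _ _ Ks(4)] * by simp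
  have hom: "evalp ?m (x * y) = evalp ?m x * evalp ?m y" for x y
    using * by (intro evalp_mult mono4_add) auto
  \<comment> \<open>E is the inverse of \<open>?c\<close>, so E^(1-r) supplies the missing
    \<open>r - 1\<close> factors.\<close>
  have e: "(w / (real N * z)) powi (1 - int r) = ?c ^ (r - 1)"
  proof -
    have "w / (real N * z) = inverse ?c" by (simp add: field_simps)
    moreover have "1 - int r = - int (r - 1)" using assms(2) by simp
    ultimately show ?thesis
      by (simp only: power_int_minus power_int_of_nat power_inverse inverse_inverse_eq)
  qed
  have "?k * evalp ?m (E_power (1 - int r) * embed_wa (Q D)) =
      (?c * ?c ^ (r - 1)) * (((a + inverse a) / w - 1) * evalp (mono2 w a) (Q D))"
    unfolding hom evalp_E_power evalp_embed e by (simp only: mult_ac)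
  also have "?c * ?c ^ (r - 1) = ?c ^ r"
    using assms(2) by (cases r) auto
  also have "((a + inverse a) / w - 1) * evalp (mono2 w a) (Q D) = ?q (slices D)"
    by (simp add: kauffman_eval_def)
  finally show "?k * evalp ?m (E_power (1 - int r) * embed_wa (Q D)) = ?V (slices D)"
    using V by simp
qed

lemma state_poly_exists:
  assumes "closed_tangle ws" "ws \<noteq> []"
  shows "\<exists>p. state_poly ws p"
proof (rule skein_induct[OF _ _ assms])
  show "move_inv 0 (\<lambda>ws. \<exists>p. state_poly ws p)"
    using state_poly_move_inv unfolding move_inv_def by blast
  show "\<exists>p. state_poly (us @ (Cross s, i) # vs) p"
    if "closed_tangle (us @ (Cross s, i) # vs)" "sep us i vs []" "\<exists>p. state_poly (us @ (Cross (\<not> s), i) # vs) p"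
      "\<exists>p. state_poly (us @ (Cup, i) # (Cap, i) # vs) p" "\<exists>p. state_poly (us @ vs) p" for us s i vs
    using that state_poly_skein[OF that(1,2)] by blast
  show "\<exists>p. state_poly (concat (map slices Ds)) p" if "\<forall>K \<in> set Ds. is_knot K" "Ds \<noteq> []" for Ds
    using state_poly_unlinked[OF unlinked_concat(1)[OF that]] that unlinked_concat(2)[OF that]
    by (auto simp: Suc_le_eq)
qed

end

section \<open>Uniqueness and existence\<close>

definition three_variable :: "(link_diagram \<Rightarrow> laurent_wa) \<Rightarrow> (link_diagram \<Rightarrow> laurent_zwaE) \<Rightarrow> bool" where
  "three_variable Q K \<longleftrightarrow> regular_isotopy_invariant K \<and>
    (\<forall>Lp Lm L0 Linf. mixed_conway_quadruple Lp Lm L0 Linf \<longrightarrow> K Lp + K Lm = var_z * (K L0 + K Linf)) \<and>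
    (\<forall>r D. 1 \<le> r \<and> unlinked_knots r D \<longrightarrow> K D = E_power (1 - int r) * embed_wa (Q D))"

lemma three_variable_unique:
  assumes "three_variable Q K" "three_variable Q K'"
  shows "K = K'"
proof
  fix D
  let ?Pr = "\<lambda>ws. K (Abs_link_diagram ws) = K' (Abs_link_diagram ws)"
  have "?Pr (slices D)"
  proof (rule skein_induct[of ?Pr])
    have "move_inv 0 (\<lambda>ws. K (Abs_link_diagram ws))" "move_inv 0 (\<lambda>ws. K' (Abs_link_diagram ws))"
      using assms by (auto simp: three_variable_def intro: regular_isotopy_invariant_move_inv)
    then show "move_inv 0 ?Pr" unfolding move_inv_def by simp
    show "?Pr (us @ (Cross s, i) # vs)"
      if cl: "closed_tangle (us @ (Cross s, i) # vs)" and sep: "sep us i vs []"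
        and IH: "?Pr (us @ (Cross (\<not> s), i) # vs)" "?Pr (us @ (Cup, i) # (Cap, i) # vs)" "?Pr (us @ vs)" for us s i vs
    proof -
      have cl': "closed_tangle (us @ (Cross True, i) # vs)"
        using cl by (auto simp: closed_tangle_def)
      note q = conway_quadruple_atI[OF cl']
      have "mixed_conway_quadruple (Abs_link_diagram (us @ (Cross True, i) # vs)) (Abs_link_diagram (us @ (Cross False, i) # vs))
          (Abs_link_diagram (us @ (Cup, i) # (Cap, i) # vs)) (Abs_link_diagram (us @ vs))"
        using q sep_not_same_component[OF sep, of _ True] slices_Abs[OF cl'] unfolding mixed_conway_quadruple_def by blast
      then have "K (Abs_link_diagram (us @ (Cross True, i) # vs)) + K (Abs_link_diagram (us @ (Cross False, i) # vs)) =
          K' (Abs_link_diagram (us @ (Cross True, i) # vs)) + K' (Abs_link_diagram (us @ (Cross False, i) # vs))"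
        using assms IH(2,3) by (simp add: three_variable_def)
      with IH(1) show ?thesis by (cases s) auto
    qed
    show "?Pr (concat (map slices Ds))" if "\<forall>K \<in> set Ds. is_knot K" "Ds \<noteq> []" for Ds
    proof -
      have "1 \<le> length Ds" using that(2) by (cases Ds) auto
      then show ?thesis
        using assms unlinked_concat(1)[OF that] by (auto simp: three_variable_def)
    qed
  qed simp_all
  then show "K D = K' D" by simp
qed

lemma three_variable_exists:
  assumes Q: "kauffman_polynomial Q"
  shows "\<exists>K. three_variable Q K"
proof -
  define X where "X = (\<lambda>ws. THE p. state_poly Q ws p)"
  have X_eq: "X ws = p" if "state_poly Q ws p" for ws p
    unfolding X_def using that state_poly_unique[OF Q] by blast
  have X: "state_poly Q ws (X ws)" if "closed_tangle ws" "ws \<noteq> []" for ws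
    using state_poly_exists[OF Q that] X_eq by blast
  have "three_variable Q (\<lambda>D. X (slices D))"
    unfolding three_variable_def
  proof (intro conjI allI impI)
    have "move_inv 0 X"
      unfolding move_inv_def
    proof (intro allI impI)
      fix us l r vs
      assume "basic_move l r" "ok 0 (us @ l @ vs)" "ok 0 (us @ r @ vs)" "wd 0 (us @ l @ vs) = 0"
      then have "state_poly Q (us @ l @ vs) p = state_poly Q (us @ r @ vs) p" for p
        using state_poly_move_inv[OF Q, of p] unfolding move_inv_def by blast
      \<comment> \<open>The two predicates coincide, hence so do their definite descriptions, and
        existence need not be invoked here.\<close>
      then have "state_poly Q (us @ l @ vs) = state_poly Q (us @ r @ vs)" by (rule ext)
      then show "X (us @ l @ vs) = X (us @ r @ vs)" by (simp only: X_def)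
    qed
    then show "regular_isotopy_invariant (\<lambda>D. X (slices D))"
      by (rule move_inv_regular_isotopy_invariant)
  next
    fix Lp Lm L0 Linf assume "mixed_conway_quadruple Lp Lm L0 Linf"
    then obtain us i vs where L: "slices Lp = us @ (Cross True, i) # vs" "slices Lm = us @ (Cross False, i) # vs"
       "slices L0 = us @ (Cup, i) # (Cap, i) # vs" "slices Linf = us @ vs"
      and mixed: "\<not> same_component Lp (length us, i) (length us, Suc i)"
      by (auto simp: mixed_conway_quadruple_def conway_quadruple_at_def)
    have "state_poly Q (slices Lp) (var_z * (X (slices L0) + X (slices Linf)) - X (slices Lm))"
      unfolding L(1)
    proof (rule state_poly_skein[OF Q])
      show "closed_tangle (us @ (Cross True, i) # vs)" using closed_slices(1)[of Lp] L by simp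
      show "sep us i vs []" by (rule not_same_component_sep[OF mixed L(1)])
    qed (use X[of "slices Lm"] X[of "slices L0"] X[of "slices Linf"] L closed_slices in \<open>metis\<close>)+
    then have "X (slices Lp) = var_z * (X (slices L0) + X (slices Linf)) - X (slices Lm)"
      by (rule X_eq)
    then show "X (slices Lp) + X (slices Lm) = var_z * (X (slices L0) + X (slices Linf))" by simp
  next
    fix r D assume "1 \<le> r \<and> unlinked_knots r D"
    then show "X (slices D) = E_power (1 - int r) * embed_wa (Q D)"
      using X_eq[OF state_poly_unlinked[OF Q]] by blast
  qed
  then show ?thesis by blast
qed

theorem theorem3:
  fixes Q :: "link_diagram \<Rightarrow> laurent_wa"
  assumes "kauffman_polynomial Q"
  shows "\<exists>!K :: link_diagram \<Rightarrow> laurent_zwaE.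
    regular_isotopy_invariant K \<and>
    (\<forall>Lp Lm L0 Linf. mixed_conway_quadruple Lp Lm L0 Linf \<longrightarrow>
       K Lp + K Lm = var_z * (K L0 + K Linf)) \<and>
    (\<forall>r D. 1 \<le> r \<and> unlinked_knots r D \<longrightarrow>
       K D = E_power (1 - int r) * embed_wa (Q D))"
  using three_variable_exists[OF assms] three_variable_unique[of Q] unfolding three_variable_def by blast

end
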